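(* Fix $0<\beta_-\le\beta_+<S$, $M>0$, $0<c\le 1\le C<\infty$, and $0<\alpha,\alpha'<1$. (i) If $\beta_+\le 2\beta_-$, there are random sets $C_n$ (based on the $n$ observations) and a constant $K<\infty$ such that $$\liminf_{n\to\infty}\ \inf_{\beta\in[\beta_-,\beta_+],\ f\in\mathcal F_\beta(M),\ g\in\mathcal G(c,C)}\mathbb P_{f,g}(f\in C_n)\ \ge\ 1-\alpha,$$ and, for every $\beta\in[\beta_-,\beta_+]$, $$\limsup_{n\to\infty}\ \sup_{f\in\mathcal F_\beta(M),\ g\in\mathcal G(c,C)}\mathbb P_{f,g}\{\operatorname{diam}_2(C_n)>K\varepsilon_n(\beta)\}\ \le\ \alpha'.$$ (ii) If $\beta_+>2\beta_-$, there exist random sets $C_n$ (based on the $n$ observations) and constants $L_0,K<\infty$ such that, for every $L\ge L_0$, $$\liminf_{n\to\infty}\ \inf_{f\in\mathcal F_n^{\mathrm{sep}}(L),\ g\in\mathcal G(c,C)}\mathbb P_{f,g}(f\in C_n)\ \ge\ 1-\alpha,$$ and, for every $\beta\in[\beta_-,\beta_+]$, $$\limsup_{n\to\infty}\ \sup_{f\in\mathcal F_n^{\mathrm{sep}}(L)\cap\mathcal F_\beta(M),\ g\in\mathcal G(c,C)}\mathbb P_{f,g}\{\operatorname{diam}_2(C_n)>K\varepsilon_n(\beta)\}\ \le\ \alpha'.$$ All constants may depend only on the displayed fixed parameters, $d$, and the chosen wavelet basis.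
   Context: **Model.** Fix an integer $d\ge1$ and $\mathcal X=[0,1]^d$. For each $n$ one observes independent pairs $(X_i,Y_i)_{i=1}^n$ with $X_i\sim g$ (density on $\mathcal X$) and $Y_i\mid X_i=x\sim\mathrm{Bernoulli}(f(x))$; the law is $\mathbb P_{f,g}$. Both $f$ and $g$ are unknown; $M,c,C,\beta_-,\beta_+$ are known. The design class is $$\mathcal G(c,C)=\Big\{g:\int_{\mathcal X}g(x)\,dx=1,\ c\le g\le C\text{ almost everywhere}\Big\}.$$ Write $\|h\|_2^2=\int_{\mathcal X}h(x)^2dx$, and for nonempty $C\subset L^2(dx)$ let $\operatorname{diam}_2(C)=\sup_{u,v\in C}\|u-v\|_2$, with $\operatorname{diam}_2(\varnothing)=0$. For a set $\mathcal A\subset L^2(dx)$, $\operatorname{dist}_2(f,\mathcal A)=\inf_{h\in\mathcal A}\|f-h\|_2$. Random (confidence) sets $C_n$ are Effros-measurable random closed subsets of $L^2(dx)$ (for every open $O$ the event $\{C_n\cap O\ne\varnothing\}$ is measurable), determined by the $n$ observations; they may depend on the known fixed parameters but not on $f,g,\beta$. **Wavelets.** Fix $S>\beta_+$ and a compactly supported, tensor-product, boundary-corrected orthonormal wavelet basis of Cohen–Daubechies–Vial type on $[0,1]^d$, built from a compactly supported orthonormal Daubechies system on $\mathbb R$ (scaling function $\varphi$, wavelet $\psi$) with Hölder–Zygmund regularity $R_{\mathrm w}>S$ and an integer number $N_{\mathrm w}>S$ of vanishing moments. Thus for an integer $J_0\ge0$ and every $j\ge J_0$ there are orthonormal families $(\varphi^I_{j,k})_{k\in\mathcal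 I_j}$, $(\psi^I_{j,k})_{k\in\mathcal I_j}$ in $L^2([0,1])$, $|\mathcal I_j|=2^j$, each consisting of the ordinary functions $2^{j/2}\varphi(2^jx-k)$ (resp. $2^{j/2}\psi(2^jx-k)$) with support in $(0,1)$ together with a number, independent of $j$, of boundary functions that are $L^2$-normalized level-$j$ dilates of fixed compactly supported prototypes; $J_0$ is large enough that left- and right-boundary functions have disjoint supports at every level $j\ge J_0$. The spans $V^I_j,W^I_j$ satisfy $V^I_{j+1}=V^I_j\oplus W^I_j$ (orthogonal), $L^2([0,1])=V^I_{J_0}\oplus\bigoplus_{j\ge J_0}W^I_j$, and $V^I_j$ contains all polynomials of degree at most $N_{\mathrm w}-1$. On $[0,1]^d$ put $\Lambda_j=\mathcal I_j^d$, $\varphi_{j,\lambda}(x)=\prod_{\ell=1}^d\varphi^I_{j,k_\ell}(x_\ell)$ for $\lambda=(k_1,\dots,k_d)$, $V_j=\operatorname{span}\{\varphi_{j,\lambda}:\lambda\in\Lambda_j\}$; $P_J$ is the $L^2(dx)$-orthogonal projection onto $V_J$ and $Q_j=P_{j+1}-P_j$. **Function classes.** For $s\ge0$, $$\|h\|_{\mathbb B^s_{2,\infty}}=2^{J_0s}\|P_{J_0}h\|_2+\sup_{j\ge J_0}2^{js}\|Q_jh\|_2,$$ $\mathcal B_s(M)=\{h\in L^2(dx):\|h\|_{\mathbb B^s_{2,\infty}}\le M\}$, and $\mathcal F_s(M)=\{f\in\mathcal B_s(M):0\le f\le1\text{ a.e.}\}$. **Rates and separated classes.** $\varepsilon_n(s)=n^{-s/(2s+d)}$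 and $\rho_n(s)=n^{-2s/(4s+d)}$. When $\beta_+>2\beta_-$, put $N=\lceil\log_2(\beta_+/\beta_-)\rceil$, $s_j=2^{j-1}\beta_-$ for $j=1,\dots,N$, and for $L>0$ $$\mathcal F_n^{\mathrm{sep}}(L)=\mathcal F_{s_N}(M)\cup\bigcup_{j=1}^{N-1}\big\{f\in\mathcal F_{s_j}(M):\operatorname{dist}_2(f,\mathcal F_{s_{j+1}}(M))\ge L\rho_n(s_j)\big\}.$$ *)

theory Defs
  imports "HOL-Probability.Probability" "HOL-Computational_Algebra.Polynomial"
begin

section \<open>The space of square-integrable functions on the unit cube\<close>

text \<open>
  Elements of \<open>L\<^sup>2([0,1]\<^sup>d)\<close> are represented by Borel functions; only their values on the unit
  cube matter, and \<open>L2_dist\<close> is a pseudometric identifying functions that agree almost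
  everywhere.  Sets that are open or closed in the sense below are automatically saturated under
  almost-everywhere equality, so they correspond exactly to the open and closed subsets of
  the quotient.  The type is left general so that it covers both the interval (\<open>'a = real\<close>) and the
  cube (\<open>'a = real ^ 'n\<close>).
\<close>

definition cube_measure :: "'a::euclidean_space measure" where
  "cube_measure = restrict_space lborel (cbox 0 One)"

definition L2_space :: "('a::euclidean_space \<Rightarrow> real) set" where
  "L2_space = {h. h \<in> borel_measurable cube_measure \<and> integrable cube_measure (\<lambda>x. (h x)\<^sup>2)}"

definition L2_inner :: "('a::euclidean_space \<Rightarrow> real) \<Rightarrow> ('a \<Rightarrow> real) \<Rightarrow> real" where
  "L2_inner u v = (\<integral>x. u x * v x \<partial>cube_measure)"

definition L2_norm :: "('a::euclidean_space \<Rightarrow> real) \<Rightarrow> real" where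
  "L2_norm h = sqrt (\<integral>x. (h x)\<^sup>2 \<partial>cube_measure)"

definition L2_dist :: "('a::euclidean_space \<Rightarrow> real) \<Rightarrow> ('a \<Rightarrow> real) \<Rightarrow> real" where
  "L2_dist u v = L2_norm (\<lambda>x. u x - v x)"

definition L2_setdist :: "('a::euclidean_space \<Rightarrow> real) \<Rightarrow> ('a \<Rightarrow> real) set \<Rightarrow> real" where
  "L2_setdist f A = (INF h\<in>A. L2_dist f h)"

definition L2_diam :: "('a::euclidean_space \<Rightarrow> real) set \<Rightarrow> ennreal" where
  "L2_diam A = (if A = {} then 0 else (SUP u\<in>A. SUP v\<in>A. ennreal (L2_dist u v)))"

definition L2_open :: "('a::euclidean_space \<Rightarrow> real) set \<Rightarrow> bool" where
  "L2_open U \<longleftrightarrow> U \<subseteq> L2_space \<and>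
     (\<forall>h\<in>U. \<exists>e>0. \<forall>u\<in>L2_space. L2_dist u h < e \<longrightarrow> u \<in> U)"

definition L2_closed :: "('a::euclidean_space \<Rightarrow> real) set \<Rightarrow> bool" where
  "L2_closed A \<longleftrightarrow> A \<subseteq> L2_space \<and> L2_open (L2_space - A)"

definition ae_equal_sets :: "('a::euclidean_space \<Rightarrow> real) set \<Rightarrow> ('a \<Rightarrow> real) set \<Rightarrow> bool" where
  "ae_equal_sets A B \<longleftrightarrow>
     (\<forall>u\<in>A. \<exists>v\<in>B. AE x in cube_measure. u x = v x) \<and>
     (\<forall>v\<in>B. \<exists>u\<in>A. AE x in cube_measure. u x = v x)"

text \<open>For the finite-dimensional spaces \<open>V\<close> used below the projection exists and is unique.\<close>

definition L2_proj :: "('a::euclidean_space \<Rightarrow> real) set \<Rightarrow> ('a \<Rightarrow> real) \<Rightarrow> 'a \<Rightarrow> real" where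
  "L2_proj V h = (SOME p. p \<in> V \<and> (\<forall>v\<in>V. L2_inner (\<lambda>x. h x - p x) v = 0))"


section \<open>Boundary-corrected wavelets\<close>

text \<open>
  The space \<open>\<C>\<^sup>r(\<real>)\<close>, \<open>r > 0\<close>: write \<open>r = m + \<gamma>\<close> with \<open>m\<close> a natural number and \<open>0 < \<gamma> \<le> 1\<close>;
  derivatives up to order \<open>m\<close> are bounded and continuous and the \<open>m\<close>-th one satisfies the
  second-difference condition of order \<open>\<gamma>\<close> (for \<open>\<gamma> < 1\<close> this is the usual Hoelder condition).
\<close>

definition holder_zygmund :: "real \<Rightarrow> (real \<Rightarrow> real) \<Rightarrow> bool" where
  "holder_zygmund r f \<longleftrightarrow> (\<exists>m::nat. \<exists>D::nat \<Rightarrow> real \<Rightarrow> real.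
     real m < r \<and> r \<le> real m + 1 \<and> D 0 = f \<and>
     (\<forall>i<m. \<forall>x. (D i has_real_derivative D (Suc i) x) (at x)) \<and>
     (\<forall>i\<le>m. continuous_on UNIV (D i) \<and> bounded (range (D i))) \<and>
     (\<exists>B. \<forall>x h. \<bar>D m (x + h) + D m (x - h) - 2 * D m x\<bar> \<le> B * \<bar>h\<bar> powr (r - real m)))"

definition compactly_supported :: "(real \<Rightarrow> real) \<Rightarrow> bool" where
  "compactly_supported f \<longleftrightarrow> (\<exists>B. \<forall>x. \<bar>x\<bar> > B \<longrightarrow> f x = 0)"

text \<open>
  A Daubechies system of order \<open>N\<close>: an orthonormal refinable function \<open>\<phi>\<close> whose filter \<open>h\<close> has
  \<open>2 N\<close> consecutive taps, with the wavelet \<open>\<psi>\<close> given by the quadrature mirror filter and having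
  \<open>N\<close> vanishing moments.  The wavelet is only canonical up to integer translation and sign, whence
  \<open>q\<close> and \<open>\<sigma>\<close>; the position \<open>a\<close> of the filter is likewise left free.
\<close>

definition daubechies_system :: "nat \<Rightarrow> (real \<Rightarrow> real) \<Rightarrow> (real \<Rightarrow> real) \<Rightarrow> bool" where
  "daubechies_system N \<phi> \<psi> \<longleftrightarrow>
     \<phi> \<in> borel_measurable borel \<and> compactly_supported \<phi> \<and> compactly_supported \<psi> \<and>
     (\<integral>x. \<phi> x \<partial>lborel) = 1 \<and>
     (\<forall>k::int. (\<integral>x. \<phi> x * \<phi> (x - of_int k) \<partial>lborel) = (if k = 0 then 1 else 0)) \<and>
     (\<exists>(h :: int \<Rightarrow> real) (a :: int) (q :: int) (\<sigma> :: real).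
        \<sigma> \<in> {1, -1} \<and>
        (\<forall>k. k \<notin> {a..<a + 2 * int N} \<longrightarrow> h k = 0) \<and>
        (\<forall>x. \<phi> x = sqrt 2 * (\<Sum>k\<in>{a..<a + 2 * int N}. h k * \<phi> (2 * x - of_int k))) \<and>
        (\<forall>x. \<psi> x = sqrt 2 * (\<Sum>k\<in>{a..<a + 2 * int N}.
            \<sigma> * (-1) powi (2 * q + 1 - k) * h k * \<phi> (2 * x - of_int (2 * q + 1 - k))))) \<and>
     (\<forall>p<N. (\<integral>x. x ^ p * \<psi> x \<partial>lborel) = 0)"

definition support01 :: "(real \<Rightarrow> real) \<Rightarrow> real set" where
  "support01 f = closure {x \<in> {0..1}. f x \<noteq> 0}"

text \<open>
  A level-\<open>j\<close> family of \<open>2 ^ j\<close> functions on \<open>[0,1]\<close>: indices \<open>k < nl\<close> are the left-boundary functions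
  (dilates about \<open>0\<close> of the prototypes \<open>L\<close>), the last \<open>nr\<close> indices are the right-boundary functions
  (dilates about \<open>1\<close> of the prototypes \<open>R\<close>), and the ones in between run, in order, through all the
  ordinary functions \<open>2\<^sup>j\<^sup>/\<^sup>2 \<theta>(2\<^sup>j x - l)\<close> whose support is contained in the open interval
  \<open>(0,1)\<close>; the integer \<open>t\<close> only aligns the index \<open>k\<close> with the translate \<open>l\<close>.
\<close>

definition boundary_corrected_family ::
  "nat \<Rightarrow> (real \<Rightarrow> real) \<Rightarrow> nat \<Rightarrow> nat \<Rightarrow> (nat \<Rightarrow> nat \<Rightarrow> real \<Rightarrow> real) \<Rightarrow> bool" where
  "boundary_corrected_family J0 \<theta> nl nr F \<longleftrightarrow>
     (\<exists>(L :: nat \<Rightarrow> real \<Rightarrow> real) (R :: nat \<Rightarrow> real \<Rightarrow> real) (t :: int).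
        (\<forall>i<nl. L i \<in> borel_measurable borel \<and> bounded (range (L i)) \<and> compactly_supported (L i)) \<and>
        (\<forall>i<nr. R i \<in> borel_measurable borel \<and> bounded (range (R i)) \<and> compactly_supported (R i)) \<and>
        (\<forall>j\<ge>J0. nl + nr \<le> 2 ^ j \<and>
           (\<lambda>k. int k + t) ` {nl..<2 ^ j - nr} =
             {l::int. closure {x. \<theta> (2 ^ j * x - of_int l) \<noteq> 0} \<subseteq> {0<..<1}} \<and>
           (\<forall>x\<in>{0..1}.
              (\<forall>k<nl. F j k x = 2 powr (real j / 2) * L k (2 ^ j * x)) \<and>
              (\<forall>k\<in>{nl..<2 ^ j - nr}.
                 F j k x = 2 powr (real j / 2) * \<theta> (2 ^ j * x - of_int (int k + t))) \<and>
              (\<forall>i<nr. F j (2 ^ j - nr + i) x = 2 powr (real j / 2) * R i (2 ^ j * (x - 1))))))"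

definition level_span :: "(nat \<Rightarrow> nat \<Rightarrow> real \<Rightarrow> real) \<Rightarrow> nat \<Rightarrow> (real \<Rightarrow> real) set" where
  "level_span F j = {u. \<exists>a :: nat \<Rightarrow> real. u = (\<lambda>x. \<Sum>k<2 ^ j. a k * F j k x)}"

definition cdv_basis ::
  "real \<Rightarrow> nat \<Rightarrow> (nat \<Rightarrow> nat \<Rightarrow> real \<Rightarrow> real) \<Rightarrow> (nat \<Rightarrow> nat \<Rightarrow> real \<Rightarrow> real) \<Rightarrow> bool" where
  "cdv_basis S J0 phiI psiI \<longleftrightarrow>
     (\<exists>(\<phi> :: real \<Rightarrow> real) (\<psi> :: real \<Rightarrow> real) (Nw :: nat) (Rw :: real)
        (nl :: nat) (nr :: nat) (ml :: nat) (mr :: nat).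
        real Nw > S \<and> Rw > S \<and>
        daubechies_system Nw \<phi> \<psi> \<and> holder_zygmund Rw \<phi> \<and> holder_zygmund Rw \<psi> \<and>
        boundary_corrected_family J0 \<phi> nl nr phiI \<and>
        boundary_corrected_family J0 \<psi> ml mr psiI \<and>
        (\<forall>j\<ge>J0.
           (\<forall>u \<in> phiI j ` {..<nl} \<union> psiI j ` {..<ml}.
              \<forall>v \<in> phiI j ` {2 ^ j - nr..<2 ^ j} \<union> psiI j ` {2 ^ j - mr..<2 ^ j}.
                support01 u \<inter> support01 v = {}) \<and>
           (\<forall>k<2 ^ j. \<forall>l<2 ^ j. L2_inner (phiI j k) (phiI j l) = (if k = l then 1 else 0)) \<and>
           (\<forall>k<2 ^ j. \<forall>l<2 ^ j. L2_inner (psiI j k) (psiI j l) = (if k = l then 1 else 0)) \<and>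
           (\<forall>u\<in>level_span phiI j. \<forall>w\<in>level_span psiI j. L2_inner u w = 0) \<and>
           ae_equal_sets (level_span phiI (Suc j))
             {v. \<exists>u\<in>level_span phiI j. \<exists>w\<in>level_span psiI j. v = (\<lambda>x. u x + w x)} \<and>
           (\<forall>p :: real poly. degree p \<le> Nw - 1 \<longrightarrow>
              (\<exists>v\<in>level_span phiI j. AE x in cube_measure. v x = poly p x))) \<and>
        (\<forall>h\<in>L2_space. \<forall>e>0. \<exists>J\<ge>J0. \<exists>u\<in>level_span phiI J0. \<exists>w :: nat \<Rightarrow> real \<Rightarrow> real.
           (\<forall>j\<in>{J0..<J}. w j \<in> level_span psiI j) \<and>
           L2_dist h (\<lambda>x. u x + (\<Sum>j\<in>{J0..<J}. w j x)) < e))"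

definition tensor_scaling ::
  "(nat \<Rightarrow> nat \<Rightarrow> real \<Rightarrow> real) \<Rightarrow> nat \<Rightarrow> ('n::finite \<Rightarrow> nat) \<Rightarrow> real ^ 'n \<Rightarrow> real" where
  "tensor_scaling phiI j \<kappa> x = (\<Prod>l\<in>UNIV. phiI j (\<kappa> l) (x $ l))"

definition V_space :: "(nat \<Rightarrow> nat \<Rightarrow> real \<Rightarrow> real) \<Rightarrow> nat \<Rightarrow> (real ^ 'n::finite \<Rightarrow> real) set" where
  "V_space phiI j = {u. \<exists>a :: ('n \<Rightarrow> nat) \<Rightarrow> real.
     u = (\<lambda>x. \<Sum>\<kappa> | \<forall>l. \<kappa> l < 2 ^ j. a \<kappa> * tensor_scaling phiI j \<kappa> x)}"

definition P_proj ::
  "(nat \<Rightarrow> nat \<Rightarrow> real \<Rightarrow> real) \<Rightarrow> nat \<Rightarrow> (real ^ 'n::finite \<Rightarrow> real) \<Rightarrow> real ^ 'n \<Rightarrow> real" where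
  "P_proj phiI J h = L2_proj (V_space phiI J) h"

definition Q_proj ::
  "(nat \<Rightarrow> nat \<Rightarrow> real \<Rightarrow> real) \<Rightarrow> nat \<Rightarrow> (real ^ 'n::finite \<Rightarrow> real) \<Rightarrow> real ^ 'n \<Rightarrow> real" where
  "Q_proj phiI j h = (\<lambda>x. P_proj phiI (Suc j) h x - P_proj phiI j h x)"


section \<open>Function classes, rates and separated classes\<close>

definition besov_norm ::
  "(nat \<Rightarrow> nat \<Rightarrow> real \<Rightarrow> real) \<Rightarrow> nat \<Rightarrow> real \<Rightarrow> (real ^ 'n::finite \<Rightarrow> real) \<Rightarrow> ennreal" where
  "besov_norm phiI J0 s h =
     ennreal (2 powr (real J0 * s) * L2_norm (P_proj phiI J0 h)) +
     (SUP j\<in>{J0..}. ennreal (2 powr (real j * s) * L2_norm (Q_proj phiI j h)))"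

definition besov_ball ::
  "(nat \<Rightarrow> nat \<Rightarrow> real \<Rightarrow> real) \<Rightarrow> nat \<Rightarrow> real \<Rightarrow> real \<Rightarrow> (real ^ 'n::finite \<Rightarrow> real) set" where
  "besov_ball phiI J0 M s = {h \<in> L2_space. besov_norm phiI J0 s h \<le> ennreal M}"

definition F_class ::
  "(nat \<Rightarrow> nat \<Rightarrow> real \<Rightarrow> real) \<Rightarrow> nat \<Rightarrow> real \<Rightarrow> real \<Rightarrow> (real ^ 'n::finite \<Rightarrow> real) set" where
  "F_class phiI J0 M s =
     {f \<in> besov_ball phiI J0 M s. AE x in cube_measure. 0 \<le> f x \<and> f x \<le> 1}"

definition G_class :: "real \<Rightarrow> real \<Rightarrow> (real ^ 'n::finite \<Rightarrow> real) set" where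
  "G_class c C = {g \<in> borel_measurable cube_measure.
     (\<integral>x. g x \<partial>cube_measure) = 1 \<and> (AE x in cube_measure. c \<le> g x \<and> g x \<le> C)}"

definition eps_rate :: "nat \<Rightarrow> nat \<Rightarrow> real \<Rightarrow> real" where
  "eps_rate d n s = real n powr (- s / (2 * s + real d))"

definition rho_rate :: "nat \<Rightarrow> nat \<Rightarrow> real \<Rightarrow> real" where
  "rho_rate d n s = real n powr (- 2 * s / (4 * s + real d))"

definition num_scales :: "real \<Rightarrow> real \<Rightarrow> nat" where
  "num_scales bm bp = nat \<lceil>log 2 (bp / bm)\<rceil>"

definition scale :: "real \<Rightarrow> nat \<Rightarrow> real" where
  "scale bm j = 2 ^ (j - 1) * bm"

definition F_sep ::
  "(nat \<Rightarrow> nat \<Rightarrow> real \<Rightarrow> real) \<Rightarrow> nat \<Rightarrow> real \<Rightarrow> real \<Rightarrow> real \<Rightarrow> real \<Rightarrow> nat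
     \<Rightarrow> (real ^ 'n::finite \<Rightarrow> real) set" where
  "F_sep phiI J0 M bm bp L n =
     F_class phiI J0 M (scale bm (num_scales bm bp)) \<union>
     (\<Union>j\<in>{1..num_scales bm bp - 1}.
        {f \<in> F_class phiI J0 M (scale bm j).
           L2_setdist f (F_class phiI J0 M (scale bm (j + 1)))
             \<ge> L * rho_rate CARD('n) n (scale bm j)})"


section \<open>The regression model and random confidence sets\<close>

definition obs_space :: "((real ^ 'n::finite) \<times> bool) measure" where
  "obs_space = cube_measure \<Otimes>\<^sub>M count_space UNIV"

text \<open>
  The joint law of \<open>(X, Y)\<close>: \<open>X\<close> has density \<open>g\<close> and \<open>Y\<close> given \<open>X = x\<close> is Bernoulli with parameter
  \<open>f x\<close>.  (The library's \<open>bernoulli_pmf\<close> truncates its parameter to \<open>[0,1]\<close>, which only matters on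
  the null set where \<open>f\<close> leaves that interval.)
\<close>

definition obs_law ::
  "(real ^ 'n::finite \<Rightarrow> real) \<Rightarrow> (real ^ 'n \<Rightarrow> real) \<Rightarrow> ((real ^ 'n) \<times> bool) measure" where
  "obs_law f g = density obs_space (\<lambda>(x, y). ennreal (g x * pmf (bernoulli_pmf (f x)) y))"

definition sample_space :: "nat \<Rightarrow> (nat \<Rightarrow> (real ^ 'n::finite) \<times> bool) measure" where
  "sample_space n = Pi\<^sub>M {..<n} (\<lambda>_. obs_space)"

definition sample_law ::
  "nat \<Rightarrow> (real ^ 'n::finite \<Rightarrow> real) \<Rightarrow> (real ^ 'n \<Rightarrow> real)
     \<Rightarrow> (nat \<Rightarrow> (real ^ 'n) \<times> bool) measure" where
  "sample_law n f g = Pi\<^sub>M {..<n} (\<lambda>_. obs_law f g)"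

definition random_closed_set ::
  "nat \<Rightarrow> ((nat \<Rightarrow> (real ^ 'n::finite) \<times> bool) \<Rightarrow> (real ^ 'n \<Rightarrow> real) set) \<Rightarrow> bool" where
  "random_closed_set n A \<longleftrightarrow>
     (\<forall>\<omega>\<in>space (sample_space n). L2_closed (A \<omega>)) \<and>
     (\<forall>U. L2_open U \<longrightarrow> {\<omega> \<in> space (sample_space n). A \<omega> \<inter> U \<noteq> {}} \<in> sets (sample_space n))"

definition coverage_prob ::
  "nat \<Rightarrow> ((nat \<Rightarrow> (real ^ 'n::finite) \<times> bool) \<Rightarrow> (real ^ 'n \<Rightarrow> real) set)
     \<Rightarrow> (real ^ 'n \<Rightarrow> real) \<Rightarrow> (real ^ 'n \<Rightarrow> real) \<Rightarrow> real" where
  "coverage_prob n A f g =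
     measure (sample_law n f g) {\<omega> \<in> space (sample_law n f g). f \<in> A \<omega>}"

definition diam_exceed_prob ::
  "nat \<Rightarrow> ((nat \<Rightarrow> (real ^ 'n::finite) \<times> bool) \<Rightarrow> (real ^ 'n \<Rightarrow> real) set)
     \<Rightarrow> real \<Rightarrow> (real ^ 'n \<Rightarrow> real) \<Rightarrow> (real ^ 'n \<Rightarrow> real) \<Rightarrow> real" where
  "diam_exceed_prob n A r f g =
     measure (sample_law n f g) {\<omega> \<in> space (sample_law n f g). L2_diam (A \<omega>) > ennreal r}"

end

theory Submission
  imports Defs
begin

text \<open>
  The argument lives in \<open>L\<^sup>2\<close> of the cube.  The wavelets enter through two facts: \<open>V\<^sub>j\<close> has an
  orthonormal basis of \<open>2\<^sup>j\<^sup>d\<close> functions, and an element of \<open>\<F>\<^sub>s(M)\<close> is within a constant times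
  \<open>2 powr (- j s)\<close> of \<open>V\<^sub>j\<close> (\<open>F_class_bias\<close>).

  The design density \<open>g\<close> cannot be estimated, but it does not have to be.  For a candidate \<open>h\<close> the
  residuals \<open>Y - h(X)\<close> reveal the coefficients of \<open>(f - h) g\<close>.  Pairing \<open>(f - h) g\<close> with the
  projection of \<open>f - h\<close> onto \<open>V\<^sub>J\<close> shows that the squared length \<open>T\<close> of the coefficient vector
  (called \<open>signal\<close>) determines \<open>\<parallel>f - h\<parallel>\<^sup>2\<close> up to the constants \<open>c\<close>, \<open>C\<close> and the distances of \<open>f\<close>
  and \<open>h\<close> from \<open>V\<^sub>J\<close> (\<open>sqrt_signal_le\<close>, \<open>dist_le_signal\<close>).  Comparison
  up to constants is all that claims about rates call for.

  The sample is split into three blocks of size \<open>m = n div 3\<close>.  On the first block a penalised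
  least squares estimator over a finite net attains the rate \<open>\<epsilon>\<^sub>n(\<beta>)\<close> for all smoothness degrees at
  once (\<open>net_estimator\<close>).  The other two blocks give two independent estimates of the coefficients
  of \<open>(f - h) g\<close>, and their inner product estimates \<open>T\<close> with an error of order
  \<open>sqrt (T / m) + sqrt D / m\<close>, where \<open>D = 2\<^sup>J\<^sup>d\<close> (\<open>cross_stat_variance\<close>).  With \<open>2\<^sup>J\<close> of order
  \<open>n powr (2 / (4 b + d))\<close> the noise and the approximation error over \<open>\<F>\<^sub>b(M)\<close> are both of order
  \<open>\<rho>\<^sub>n(b)\<close>.  A ball around the estimator whose radius is computed from this statistic therefore
  covers every \<open>f\<close> in \<open>\<F>\<^sub>b(M)\<close>, and its radius is of order \<open>\<parallel>f - h\<parallel> + \<rho>\<^sub>n(b)\<close>.  This is of order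
  \<open>\<epsilon>\<^sub>n(\<beta>)\<close> exactly as long as \<open>\<beta> \<le> 2 b\<close>, which is the first part (\<open>window_confidence_set\<close>).

  For a longer range of smoothness degrees the windows \<open>[s\<^sub>j, 2 s\<^sub>j]\<close> have to be told apart.  The same
  two-stage construction, with candidates restricted to \<open>\<F>\<^bsub>2b\<^esub>(M)\<close>, tests \<open>\<F>\<^bsub>2b\<^esub>(M)\<close> against functions
  of \<open>\<F>\<^sub>b(M)\<close> at distance at least \<open>L \<rho>\<^sub>n(b)\<close> from it; the two error terms match because
  \<open>\<epsilon>\<^sub>n(2 b) = \<rho>\<^sub>n(b)\<close> (\<open>smoothness_test\<close>).  On the separated class the first scale whose test rejects is,
  with high probability, the scale of the component that contains \<open>f\<close>, and the confidence set of
  that window is reported (\<open>adaptive_separated\<close>).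
\<close>

section \<open>Square-integrable functions on the cube\<close>

lemma space_cube_measure [simp]: "space cube_measure = cbox 0 One"
  by (simp add: cube_measure_def space_restrict_space)

lemma emeasure_cube_measure: "A \<in> sets borel \<Longrightarrow> emeasure cube_measure (A \<inter> cbox 0 One) = emeasure lborel (A \<inter> cbox 0 One)"
  by (auto simp: cube_measure_def intro!: emeasure_restrict_space)

lemma prob_space_cube_measure: "prob_space (cube_measure :: 'a::euclidean_space measure)"
proof
  have "emeasure (cube_measure::'a measure) (cbox 0 One) = emeasure lborel (cbox 0 One :: 'a set)"
    using emeasure_cube_measure[of "UNIV :: 'a set"] by simp
  then show "emeasure (cube_measure::'a measure) (space cube_measure) = 1"
    by (simp only: space_cube_measure) (simp add: emeasure_lborel_cbox_eq)
qed

interpretation cube: prob_space "cube_measure :: 'a::euclidean_space measure"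
  by (rule prob_space_cube_measure)

lemma borel_measurable_cubeI: "f \<in> borel_measurable borel \<Longrightarrow> f \<in> borel_measurable cube_measure"
  by (simp add: cube_measure_def measurable_restrict_space1)

lemma L2_spaceD [measurable_dest]: "u \<in> L2_space \<Longrightarrow> u \<in> borel_measurable cube_measure"
  by (simp add: L2_space_def)

lemma integrable_square: "u \<in> L2_space \<Longrightarrow> integrable cube_measure (\<lambda>x. (u x)\<^sup>2)"
  by (simp add: L2_space_def)

lemma integrable_mult:
  assumes [measurable]: "u \<in> L2_space" "v \<in> L2_space"
  shows "integrable cube_measure (\<lambda>x. u x * v x)"
proof (rule Bochner_Integration.integrable_bound)
  show "integrable cube_measure (\<lambda>x. (u x)\<^sup>2 + (v x)\<^sup>2)"
    using assms by (simp add: integrable_square)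
  have "\<bar>a * b\<bar> \<le> \<bar>a\<^sup>2 + b\<^sup>2\<bar>" for a b :: real
  proof -
    have "0 \<le> (\<bar>a\<bar> - \<bar>b\<bar>)\<^sup>2" by simp
    moreover have "0 \<le> \<bar>a\<bar> * \<bar>b\<bar>" by simp
    ultimately have "\<bar>a\<bar> * \<bar>b\<bar> \<le> a\<^sup>2 + b\<^sup>2"
      unfolding power2_diff power2_abs mult.assoc by linarith
    then show ?thesis by (simp add: abs_mult)
  qed
  then show "AE x in cube_measure. norm (u x * v x) \<le> norm ((u x)\<^sup>2 + (v x)\<^sup>2)"
    by simp
qed measurable

lemma L2_space_add [intro]:
  assumes "u \<in> L2_space" "v \<in> L2_space"
  shows "(\<lambda>x. u x + v x) \<in> L2_space"
  using assms integrable_mult[OF assms]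
  by (auto simp: L2_space_def power2_sum mult.assoc)

lemma L2_space_scale [intro]: "u \<in> L2_space \<Longrightarrow> (\<lambda>x. a * u x) \<in> L2_space"
  by (auto simp: L2_space_def power_mult_distrib)

lemma L2_space_diff [intro]:
  assumes "u \<in> L2_space" "v \<in> L2_space"
  shows "(\<lambda>x. u x - v x) \<in> L2_space"
  using L2_space_add[OF assms(1) L2_space_scale[OF assms(2), of "-1"]] by simp

lemma L2_space_bounded:
  assumes [measurable]: "u \<in> borel_measurable cube_measure"
    and "\<And>x. x \<in> cbox 0 One \<Longrightarrow> \<bar>u x\<bar> \<le> B"
  shows "u \<in> L2_space"
  unfolding L2_space_def
proof (intro CollectI conjI assms(1) cube.integrable_const_bound[where B = "B\<^sup>2"])
  show "AE x in cube_measure. norm ((u x)\<^sup>2) \<le> B\<^sup>2"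
    using power_mono[OF assms(2), of _ 2] by (intro AE_I2) auto
qed measurable

lemma L2_space_const [intro, simp]: "(\<lambda>x. a) \<in> L2_space"
  by (simp add: L2_space_def)

lemma L2_space_sum [intro]:
  assumes "\<And>k. k \<in> A \<Longrightarrow> u k \<in> L2_space"
  shows "(\<lambda>x. \<Sum>k\<in>A. u k x) \<in> L2_space"
  using assms
proof (induction A rule: infinite_finite_induct)
  case (insert x F)
  then have "(\<lambda>y. u x y + (\<Sum>k\<in>F. u k y)) \<in> L2_space"
    by (intro L2_space_add) auto
  with insert show ?case by simp
qed simp_all

lemma L2_space_mult_bounded:
  assumes [measurable]: "u \<in> L2_space" "w \<in> borel_measurable cube_measure"
    and "\<And>x. x \<in> cbox 0 One \<Longrightarrow> \<bar>w x\<bar> \<le> B"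
  shows "(\<lambda>x. u x * w x) \<in> L2_space"
  unfolding L2_space_def
proof (intro CollectI conjI)
  show "integrable cube_measure (\<lambda>x. (u x * w x)\<^sup>2)"
  proof (rule Bochner_Integration.integrable_bound)
    show "integrable cube_measure (\<lambda>x. B\<^sup>2 * (u x)\<^sup>2)"
      using assms(1) by (simp add: integrable_square)
    have "(w x)\<^sup>2 \<le> B\<^sup>2" if "x \<in> cbox 0 One" for x
      using power_mono[OF assms(3)[OF that], of 2] by simp
    then show "AE x in cube_measure. norm ((u x * w x)\<^sup>2) \<le> norm (B\<^sup>2 * (u x)\<^sup>2)"
      by (intro AE_I2) (auto simp: power_mult_distrib mult.commute[of "B\<^sup>2"] intro: mult_left_mono)
  qed measurable
qed measurable

lemma L2_inner_commute: "L2_inner u v = L2_inner v u"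
  by (simp add: L2_inner_def mult.commute)

lemma L2_inner_add:
  assumes "u \<in> L2_space" "v \<in> L2_space" "w \<in> L2_space"
  shows "L2_inner w (\<lambda>x. u x + v x) = L2_inner w u + L2_inner w v"
  using assms by (simp add: L2_inner_def distrib_left integrable_mult)

lemma L2_inner_diff:
  assumes "u \<in> L2_space" "v \<in> L2_space" "w \<in> L2_space"
  shows "L2_inner w (\<lambda>x. u x - v x) = L2_inner w u - L2_inner w v"
  using assms by (simp add: L2_inner_def right_diff_distrib integrable_mult)

lemma L2_inner_add_left:
  assumes "u \<in> L2_space" "v \<in> L2_space" "w \<in> L2_space"
  shows "L2_inner (\<lambda>x. u x + v x) w = L2_inner u w + L2_inner v w"
  using L2_inner_add[OF assms] by (simp add: L2_inner_commute)

lemma L2_inner_diff_left: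
  assumes "u \<in> L2_space" "v \<in> L2_space" "w \<in> L2_space"
  shows "L2_inner (\<lambda>x. u x - v x) w = L2_inner u w - L2_inner v w"
  using L2_inner_diff[OF assms] by (simp add: L2_inner_commute)

lemma L2_inner_scale: "L2_inner w (\<lambda>x. a * u x) = a * L2_inner w u"
  by (simp add: L2_inner_def mult.left_commute)

lemma L2_inner_sum:
  assumes "w \<in> L2_space" "\<And>k. k \<in> A \<Longrightarrow> u k \<in> L2_space"
  shows "L2_inner w (\<lambda>x. \<Sum>k\<in>A. u k x) = (\<Sum>k\<in>A. L2_inner w (u k))"
  unfolding L2_inner_def sum_distrib_left
  by (rule Bochner_Integration.integral_sum) (use assms integrable_mult in blast)

lemma L2_norm_nonneg [simp]: "0 \<le> L2_norm u"
  by (simp add: L2_norm_def integral_nonneg_AE)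

lemma L2_norm_square: "(L2_norm u)\<^sup>2 = L2_inner u u"
  by (simp add: L2_norm_def L2_inner_def power2_eq_square[symmetric] integral_nonneg_AE)

lemma L2_norm_add_square:
  assumes "u \<in> L2_space" "v \<in> L2_space"
  shows "(L2_norm (\<lambda>x. u x + v x))\<^sup>2 = (L2_norm u)\<^sup>2 + 2 * L2_inner u v + (L2_norm v)\<^sup>2"
  using assms unfolding L2_norm_square
  by (simp add: L2_inner_add L2_inner_add_left L2_inner_commute[of v u] L2_space_add)

lemma L2_norm_diff_square:
  assumes "u \<in> L2_space" "v \<in> L2_space"
  shows "(L2_norm (\<lambda>x. u x - v x))\<^sup>2 = (L2_norm u)\<^sup>2 - 2 * L2_inner u v + (L2_norm v)\<^sup>2"
  using assms unfolding L2_norm_square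
  by (simp add: L2_inner_diff L2_inner_diff_left L2_inner_commute[of v u] L2_space_diff)

lemma L2_norm_scale: "L2_norm (\<lambda>x. a * u x) = \<bar>a\<bar> * L2_norm u"
  by (simp add: L2_norm_def power_mult_distrib real_sqrt_mult)

lemma L2_Cauchy_Schwarz:
  assumes "u \<in> L2_space" "v \<in> L2_space"
  shows "L2_inner u v \<le> L2_norm u * L2_norm v"
proof -
  let ?a = "L2_norm u" and ?b = "L2_norm v"
  have *: "0 \<le> s\<^sup>2 * ?a\<^sup>2 - 2 * (s * t * L2_inner u v) + t\<^sup>2 * ?b\<^sup>2" for s t
    using L2_norm_diff_square[OF L2_space_scale[OF assms(1), of s] L2_space_scale[OF assms(2), of t]]
    by (simp add: L2_norm_scale L2_inner_scale L2_inner_commute[of "\<lambda>x. s * u x"]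
        L2_inner_commute[of v u] power_mult_distrib mult_ac) (metis mult.commute zero_le_power2)
  show ?thesis
  proof (cases "?a * ?b = 0")
    case False
    then have pos: "0 < ?a * ?b"
      using L2_norm_nonneg by (metis less_eq_real_def mult_nonneg_nonneg)
    have "2 * (?a * ?b * L2_inner u v) \<le> 2 * (?a * ?b * (?a * ?b))"
      using *[of ?b ?a] by (simp add: power2_eq_square mult_ac)
    with pos show ?thesis
      using mult_le_cancel_left_pos[OF pos] by simp
  next
    case True
    then consider "?a = 0" | "?b = 0" by auto
    then show ?thesis
    proof cases
      case 1
      have "2 * s * L2_inner u v \<le> ?b\<^sup>2" for s using *[of s 1] 1 by simp
      from this[of "(?b\<^sup>2 + 1) / (2 * L2_inner u v)"] have "L2_inner u v = 0"
        by (cases "L2_inner u v = 0") auto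
      then show ?thesis using 1 by simp
    next
      case 2
      have "2 * s * L2_inner u v \<le> ?a\<^sup>2" for s using *[of 1 s] 2 by simp
      from this[of "(?a\<^sup>2 + 1) / (2 * L2_inner u v)"] have "L2_inner u v = 0"
        by (cases "L2_inner u v = 0") auto
      then show ?thesis using 2 by simp
    qed
  qed
qed

lemma L2_norm_triangle:
  assumes "u \<in> L2_space" "v \<in> L2_space"
  shows "L2_norm (\<lambda>x. u x + v x) \<le> L2_norm u + L2_norm v"
proof (rule power2_le_imp_le)
  show "(L2_norm (\<lambda>x. u x + v x))\<^sup>2 \<le> (L2_norm u + L2_norm v)\<^sup>2"
    using L2_Cauchy_Schwarz[OF assms] by (simp add: L2_norm_add_square[OF assms] power2_sum)
qed simp

lemma L2_dist_commute: "L2_dist u v = L2_dist v u"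
  by (simp add: L2_dist_def L2_norm_def power2_commute)

lemma L2_dist_nonneg [simp]: "0 \<le> L2_dist u v"
  by (simp add: L2_dist_def)

lemma L2_dist_self [simp]: "L2_dist u u = 0"
  by (simp add: L2_dist_def L2_norm_def)

lemma L2_dist_triangle:
  assumes "u \<in> L2_space" "v \<in> L2_space" "w \<in> L2_space"
  shows "L2_dist u w \<le> L2_dist u v + L2_dist v w"
  using L2_norm_triangle[OF L2_space_diff[OF assms(1,2)] L2_space_diff[OF assms(2,3)]]
  by (simp add: L2_dist_def)

lemma L2_inner_cong_AE:
  assumes [measurable]: "u \<in> borel_measurable cube_measure" "u' \<in> borel_measurable cube_measure"
      "v \<in> borel_measurable cube_measure" "v' \<in> borel_measurable cube_measure"
    and "AE x in cube_measure. u x = u' x" "AE x in cube_measure. v x = v' x"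
  shows "L2_inner u v = L2_inner u' v'"
  unfolding L2_inner_def by (rule integral_cong_AE) (use assms(5,6) in auto)

lemma L2_norm_cong_AE:
  assumes "u \<in> borel_measurable cube_measure" "u' \<in> borel_measurable cube_measure"
    and "AE x in cube_measure. u x = u' x"
  shows "L2_norm u = L2_norm u'"
  using L2_norm_square[of u] L2_norm_square[of u'] L2_inner_cong_AE[OF assms(1,2,1,2,3,3)]
  by (metis L2_norm_nonneg power2_eq_imp_eq)

lemma L2_dist_cong_AE:
  assumes [measurable]: "u \<in> borel_measurable cube_measure" "u' \<in> borel_measurable cube_measure"
      "v \<in> borel_measurable cube_measure" "v' \<in> borel_measurable cube_measure"
    and "AE x in cube_measure. u x = u' x" "AE x in cube_measure. v x = v' x"
  shows "L2_dist u v = L2_dist u' v'"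
  unfolding L2_dist_def by (rule L2_norm_cong_AE) (use assms(5,6) in auto)

lemma L2_dist_le_const:
  assumes "u \<in> L2_space" "v \<in> L2_space" "\<And>x. x \<in> cbox 0 One \<Longrightarrow> \<bar>u x - v x\<bar> \<le> B" "0 \<le> B"
  shows "L2_dist u v \<le> B"
proof -
  have "(\<integral>x. (u x - v x)\<^sup>2 \<partial>cube_measure) \<le> (\<integral>x. B\<^sup>2 \<partial>(cube_measure :: 'a measure))"
  proof (rule integral_mono)
    show "integrable cube_measure (\<lambda>x. (u x - v x)\<^sup>2)"
      using L2_space_diff[OF assms(1,2)] by (rule integrable_square)
    show "(u x - v x)\<^sup>2 \<le> B\<^sup>2" if "x \<in> space cube_measure" for x
      using power_mono[OF assms(3)[of x], of 2] that by simp
  qed simp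
  then show ?thesis
    using assms(4) by (simp add: L2_dist_def L2_norm_def real_le_lsqrt cube.prob_space[simplified])
qed

section \<open>Finite orthonormal systems\<close>

definition orthonormal_system :: "'k set \<Rightarrow> ('k \<Rightarrow> 'a::euclidean_space \<Rightarrow> real) \<Rightarrow> bool" where
  "orthonormal_system \<Lambda> e \<longleftrightarrow> finite \<Lambda> \<and> (\<forall>k\<in>\<Lambda>. e k \<in> L2_space) \<and>
     (\<forall>k\<in>\<Lambda>. \<forall>l\<in>\<Lambda>. L2_inner (e k) (e l) = (if k = l then 1 else 0))"

definition lincomb :: "'k set \<Rightarrow> ('k \<Rightarrow> 'a \<Rightarrow> real) \<Rightarrow> ('k \<Rightarrow> real) \<Rightarrow> 'a \<Rightarrow> real" where
  "lincomb \<Lambda> e a = (\<lambda>x. \<Sum>k\<in>\<Lambda>. a k * e k x)"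

definition os_proj :: "'k set \<Rightarrow> ('k \<Rightarrow> 'a::euclidean_space \<Rightarrow> real) \<Rightarrow> ('a \<Rightarrow> real) \<Rightarrow> 'a \<Rightarrow> real" where
  "os_proj \<Lambda> e h = lincomb \<Lambda> e (\<lambda>k. L2_inner h (e k))"

context
  fixes \<Lambda> :: "'k set" and e :: "'k \<Rightarrow> 'a::euclidean_space \<Rightarrow> real"
  assumes os: "orthonormal_system \<Lambda> e"
begin

lemma os_finite: "finite \<Lambda>" and os_L2: "k \<in> \<Lambda> \<Longrightarrow> e k \<in> L2_space"
  using os by (auto simp: orthonormal_system_def)

lemma lincomb_L2: "lincomb \<Lambda> e a \<in> L2_space"
  unfolding lincomb_def by (intro L2_space_sum L2_space_scale os_L2)

lemma os_proj_L2: "os_proj \<Lambda> e h \<in> L2_space"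
  by (simp add: os_proj_def lincomb_L2)

lemma L2_inner_lincomb:
  "h \<in> L2_space \<Longrightarrow> L2_inner h (lincomb \<Lambda> e a) = (\<Sum>k\<in>\<Lambda>. a k * L2_inner h (e k))"
  unfolding lincomb_def by (subst L2_inner_sum) (auto simp: L2_inner_scale os_L2 L2_space_scale)

lemma L2_inner_lincomb_basis: "k \<in> \<Lambda> \<Longrightarrow> L2_inner (lincomb \<Lambda> e a) (e k) = a k"
proof -
  assume k: "k \<in> \<Lambda>"
  have "L2_inner (lincomb \<Lambda> e a) (e k) = (\<Sum>l\<in>\<Lambda>. a l * (if k = l then 1 else 0))"
    using os k unfolding L2_inner_commute[of "lincomb \<Lambda> e a"] L2_inner_lincomb[OF os_L2[OF k]]
    by (intro sum.cong) (auto simp: orthonormal_system_def)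
  then show ?thesis
    using k os_finite by (simp add: if_distrib cong: if_cong)
qed

lemma L2_norm_lincomb: "(L2_norm (lincomb \<Lambda> e a))\<^sup>2 = (\<Sum>k\<in>\<Lambda>. (a k)\<^sup>2)"
  unfolding L2_norm_square
  by (subst L2_inner_lincomb[OF lincomb_L2])
     (simp add: L2_inner_lincomb_basis power2_eq_square)

lemma pythagoras:
  assumes h: "h \<in> L2_space"
  shows "(L2_dist h (lincomb \<Lambda> e a))\<^sup>2 =
    (L2_dist h (os_proj \<Lambda> e h))\<^sup>2 + (\<Sum>k\<in>\<Lambda>. (a k - L2_inner h (e k))\<^sup>2)"
proof -
  have *: "(L2_dist h (lincomb \<Lambda> e b))\<^sup>2 =
      (L2_norm h)\<^sup>2 - 2 * (\<Sum>k\<in>\<Lambda>. b k * L2_inner h (e k)) + (\<Sum>k\<in>\<Lambda>. (b k)\<^sup>2)" for b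
    unfolding L2_dist_def
    by (simp add: L2_norm_diff_square[OF h lincomb_L2] L2_inner_lincomb[OF h] L2_norm_lincomb)
  show ?thesis
    unfolding os_proj_def *
    by (simp add: power2_diff sum.distrib sum_subtractf sum_distrib_left sum_negf
        power2_eq_square algebra_simps)
qed

lemma bessel:
  assumes h: "h \<in> L2_space"
  shows "(\<Sum>k\<in>\<Lambda>. (L2_inner h (e k))\<^sup>2) \<le> (L2_norm h)\<^sup>2"
  using pythagoras[OF h, of "\<lambda>_. 0"] by (simp add: lincomb_def L2_dist_def)

lemma os_proj_nearest:
  assumes h: "h \<in> L2_space"
  shows "L2_dist h (os_proj \<Lambda> e h) \<le> L2_dist h (lincomb \<Lambda> e a)"
  by (rule power2_le_imp_le) (simp_all add: pythagoras[OF h] sum_nonneg)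

end

section \<open>The regression model\<close>

definition residual :: "('a \<Rightarrow> real) \<Rightarrow> 'a \<times> bool \<Rightarrow> real" where
  "residual h z = of_bool (snd z) - h (fst z)"

lemma fst_obs_measurable [measurable]: "fst \<in> obs_space \<rightarrow>\<^sub>M cube_measure"
  by (simp add: obs_space_def)

lemma snd_obs_measurable [measurable]: "snd \<in> obs_space \<rightarrow>\<^sub>M count_space UNIV"
  by (simp add: obs_space_def)

lemma residual_measurable [measurable]:
  assumes [measurable]: "h \<in> borel_measurable cube_measure"
  shows "residual h \<in> borel_measurable obs_space"
  unfolding residual_def[abs_def] by measurable

lemma sets_obs_law [simp, measurable_cong]: "sets (obs_law f g) = sets obs_space"
  by (simp add: obs_law_def)

lemma space_obs_law [simp]: "space (obs_law f g) = space obs_space"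
  by (simp add: obs_law_def)

lemma sets_sample_law [simp, measurable_cong]: "sets (sample_law n f g) = sets (sample_space n)"
  unfolding sample_law_def sample_space_def by (intro sets_PiM_cong) simp_all

lemma space_sample_law [simp]: "space (sample_law n f g) = space (sample_space n)"
  by (rule sets_eq_imp_space_eq) simp

lemma sample_component_measurable [measurable (raw)]:
  "i < n \<Longrightarrow> (\<lambda>\<omega>. \<omega> i) \<in> sample_space n \<rightarrow>\<^sub>M obs_space"
  unfolding sample_space_def by (rule measurable_component_singleton) simp

lemma pmf_bernoulli_clip:
  "pmf (bernoulli_pmf p) y = (if y then max 0 (min 1 p) else 1 - max 0 (min 1 p))"
proof -
  consider "p < 0" | "0 \<le> p" "p \<le> 1" | "1 < p" by linarith
  then show ?thesis
    by cases (auto simp: bernoulli_pmf.rep_eq)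
qed

lemma pmf_bernoulli_measurable:
  assumes [measurable]: "f \<in> borel_measurable cube_measure"
  shows "(\<lambda>(x, y). pmf (bernoulli_pmf (f x)) y) \<in> borel_measurable obs_space"
  unfolding pmf_bernoulli_clip case_prod_unfold by measurable

text \<open>
  The range conditions hold everywhere rather than almost everywhere, which keeps pointwise estimates
  free of null sets; \<open>obs_law_clip\<close> reduces the general case to this one.
\<close>

locale binary_regression =
  fixes f g :: "real ^ 'n::finite \<Rightarrow> real" and c C :: real
  assumes f_measurable [measurable]: "f \<in> borel_measurable cube_measure"
    and f_range: "0 \<le> f x" "f x \<le> 1"
    and g_measurable [measurable]: "g \<in> borel_measurable cube_measure"
    and g_range: "c \<le> g x" "g x \<le> C"
    and g_integral: "(\<integral>x. g x \<partial>cube_measure) = 1"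
    and c_pos: "0 < c"
begin

lemma C_pos: "0 < C"
  using g_range[of undefined] c_pos by linarith

lemma g_nonneg [simp]: "0 \<le> g x"
  using g_range(1)[of x] c_pos by linarith

lemma g_abs: "\<bar>g x\<bar> \<le> C"
  using g_range(2)[of x] by simp

lemma f_L2: "f \<in> L2_space"
  by (rule L2_space_bounded[where B = 1]) (use f_range in auto)

lemma g_integrable: "integrable cube_measure g"
  using g_integral not_integrable_integral_eq by fastforce

lemma obs_law_eq: "obs_law f g = density obs_space
   (\<lambda>z. ennreal (g (fst z) * (if snd z then f (fst z) else 1 - f (fst z))))"
proof -
  have "pmf (bernoulli_pmf (f x)) y = (if y then f x else 1 - f x)" for x y
    using f_range[of x] by (cases y) auto
  then show ?thesis
    unfolding obs_law_def by (simp add: case_prod_unfold)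
qed

lemma nn_integral_obs_law:
  assumes [measurable]: "F \<in> borel_measurable obs_space"
  shows "(\<integral>\<^sup>+z. F z \<partial>obs_law f g) =
    (\<integral>\<^sup>+x. ennreal (g x) * (ennreal (f x) * F (x, True) + ennreal (1 - f x) * F (x, False)) \<partial>cube_measure)"
proof -
  interpret B: sigma_finite_measure "count_space (UNIV :: bool set)"
    by (rule sigma_finite_measure_count_space_finite) simp
  have "(\<integral>\<^sup>+z. F z \<partial>obs_law f g) = (\<integral>\<^sup>+z. ennreal (g (fst z) * (if snd z then f (fst z) else 1 - f (fst z))) * F z \<partial>obs_space)"
    unfolding obs_law_eq by (subst nn_integral_density) auto
  also have "\<dots> = (\<integral>\<^sup>+x. (\<integral>\<^sup>+y. ennreal (g x * (if y then f x else 1 - f x)) * F (x, y) \<partial>count_space UNIV) \<partial>cube_measure)"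
  proof -
    have "(\<lambda>z. ennreal (g (fst z) * (if snd z then f (fst z) else 1 - f (fst z))) * F z)
        \<in> borel_measurable (cube_measure \<Otimes>\<^sub>M count_space UNIV)"
      unfolding obs_space_def[symmetric] by measurable
    from B.nn_integral_fst[OF this] show ?thesis
      unfolding obs_space_def fst_conv snd_conv by (rule sym)
  qed
  also have "\<dots> = (\<integral>\<^sup>+x. ennreal (g x) * (ennreal (f x) * F (x, True) + ennreal (1 - f x) * F (x, False)) \<partial>cube_measure)"
    using f_range
    by (intro nn_integral_cong)
       (simp add: nn_integral_count_space_finite UNIV_bool ennreal_mult distrib_left mult.assoc add.commute)
  finally show ?thesis .
qed

lemma prob_space_obs_law: "prob_space (obs_law f g)"
proof
  have "emeasure (obs_law f g) (space (obs_law f g)) = (\<integral>\<^sup>+z. 1 \<partial>obs_law f g)"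
    by simp
  also have "\<dots> = (\<integral>\<^sup>+x. ennreal (g x) \<partial>cube_measure)"
    using f_range by (subst nn_integral_obs_law) (auto simp: ennreal_plus[symmetric] simp del: ennreal_plus)
  also have "\<dots> = 1"
    using g_integrable g_integral by (simp add: nn_integral_eq_integral)
  finally show "emeasure (obs_law f g) (space (obs_law f g)) = 1" .
qed

text \<open>
  The integral over the finite second component is a sum of two terms, so integrability in \<open>x\<close> for
  both responses is all that Fubini's theorem requires.
\<close>

lemma integral_obs_law:
  assumes [measurable]: "F \<in> borel_measurable obs_space"
    and int: "\<And>b. integrable cube_measure (\<lambda>x. F (x, b))"
  shows "integrable (obs_law f g) F"
    and "(\<integral>z. F z \<partial>obs_law f g) =
      (\<integral>x. g x * (f x * F (x, True) + (1 - f x) * F (x, False)) \<partial>cube_measure)"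
proof -
  interpret B: sigma_finite_measure "count_space (UNIV :: bool set)"
    by (rule sigma_finite_measure_count_space_finite) simp
  interpret P: pair_sigma_finite "cube_measure :: (real ^ 'n) measure" "count_space (UNIV :: bool set)" ..
  let ?w = "\<lambda>z. g (fst z) * (if snd z then f (fst z) else 1 - f (fst z))"
  have w: "?w \<in> borel_measurable obs_space" "AE z in obs_space. 0 \<le> ?w z"
    using f_range by (auto intro!: AE_I2)
  have [measurable]: "(\<lambda>z. ?w z *\<^sub>R F z) \<in> borel_measurable (cube_measure \<Otimes>\<^sub>M count_space UNIV)"
    unfolding obs_space_def[symmetric] by measurable
  have [measurable]: "(\<lambda>x. F (x, b)) \<in> borel_measurable cube_measure" for b
    using int[of b] by (rule borel_measurable_integrable)
  have bd: "integrable cube_measure (\<lambda>x. g x * (s x * F (x, b)))"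
    if [measurable]: "s \<in> borel_measurable cube_measure" and s: "\<And>x. 0 \<le> s x" "\<And>x. s x \<le> 1"
    for s :: "real ^ 'n \<Rightarrow> real" and b
  proof (rule Bochner_Integration.integrable_bound)
    show "integrable cube_measure (\<lambda>x. C * F (x, b))" using int by simp
    have "g x * s x \<le> C * 1" for x
      using g_range s C_pos by (intro mult_mono) auto
    then show "AE x in cube_measure. norm (g x * (s x * F (x, b))) \<le> norm (C * F (x, b))"
      using C_pos s(1) by (intro AE_I2) (simp add: abs_mult mult.assoc[symmetric] mult_right_mono)
  qed measurable
  have sum2: "(\<integral>y. h y \<partial>count_space UNIV) = h True + h False" for h :: "bool \<Rightarrow> real"
    by (simp add: lebesgue_integral_count_space_finite UNIV_bool add.commute)
  have wF: "integrable obs_space (\<lambda>z. ?w z *\<^sub>R F z)"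
    unfolding obs_space_def
  proof (rule P.Fubini_integrable)
    show "(\<lambda>z. ?w z *\<^sub>R F z) \<in> borel_measurable (cube_measure \<Otimes>\<^sub>M count_space UNIV)" by measurable
    have "integrable cube_measure (\<lambda>x. \<bar>g x * (f x * F (x, True))\<bar> + \<bar>g x * ((1 - f x) * F (x, False))\<bar>)"
      using f_range by (intro Bochner_Integration.integrable_add integrable_abs bd) auto
    then show "integrable cube_measure (\<lambda>x. \<integral>y. norm (?w (x, y) *\<^sub>R F (x, y)) \<partial>count_space UNIV)"
      unfolding sum2 by (simp add: mult.assoc)
    show "AE x in cube_measure. integrable (count_space UNIV) (\<lambda>y. ?w (x, y) *\<^sub>R F (x, y))"
      by (intro AE_I2 integrable_count_space) simp
  qed
  show "integrable (obs_law f g) F"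
    unfolding obs_law_eq using wF w by (subst integrable_density) auto
  have "(\<integral>z. F z \<partial>obs_law f g) = (\<integral>z. ?w z *\<^sub>R F z \<partial>obs_space)"
    unfolding obs_law_eq using w by (subst integral_density) auto
  also have "\<dots> = (\<integral>x. (\<integral>y. ?w (x, y) *\<^sub>R F (x, y) \<partial>count_space UNIV) \<partial>cube_measure)"
    using P.integral_fst'[OF wF[unfolded obs_space_def]] unfolding obs_space_def by simp
  also have "\<dots> = (\<integral>x. g x * (f x * F (x, True) + (1 - f x) * F (x, False)) \<partial>cube_measure)"
    unfolding sum2 by (simp add: distrib_left mult.assoc)
  finally show "(\<integral>z. F z \<partial>obs_law f g) =
      (\<integral>x. g x * (f x * F (x, True) + (1 - f x) * F (x, False)) \<partial>cube_measure)" .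
qed

sublocale sample: product_prob_space "\<lambda>_. obs_law f g" "UNIV :: nat set"
  by (intro product_prob_spaceI prob_space_obs_law)

lemma prob_space_sample_law: "prob_space (sample_law n f g)"
  unfolding sample_law_def by (intro prob_space_PiM prob_space_obs_law)

lemma g_weight_bounds:
  assumes u: "u \<in> L2_space"
  shows "c * (L2_norm u)\<^sup>2 \<le> (\<integral>x. g x * (u x)\<^sup>2 \<partial>cube_measure)"
    and "(\<integral>x. g x * (u x)\<^sup>2 \<partial>cube_measure) \<le> C * (L2_norm u)\<^sup>2"
    and "integrable cube_measure (\<lambda>x. g x * (u x)\<^sup>2)"
proof -
  note [measurable] = L2_spaceD[OF u]
  have i: "integrable cube_measure (\<lambda>x. a * (u x)\<^sup>2)" for a
    using integrable_square[OF u] by simp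
  show ig: "integrable cube_measure (\<lambda>x. g x * (u x)\<^sup>2)"
    using g_abs C_pos
    by (intro Bochner_Integration.integrable_bound[OF i[of C]])
       (auto simp: abs_mult intro!: mult_right_mono AE_I2)
  have e: "(\<integral>x. a * (u x)\<^sup>2 \<partial>cube_measure) = a * (L2_norm u)\<^sup>2" for a
    unfolding L2_norm_square by (simp add: L2_inner_def power2_eq_square)
  show "c * (L2_norm u)\<^sup>2 \<le> (\<integral>x. g x * (u x)\<^sup>2 \<partial>cube_measure)"
    unfolding e[symmetric] using g_range by (intro integral_mono[OF i ig] mult_right_mono) auto
  show "(\<integral>x. g x * (u x)\<^sup>2 \<partial>cube_measure) \<le> C * (L2_norm u)\<^sup>2"
    unfolding e[symmetric] using g_range by (intro integral_mono[OF ig i] mult_right_mono) auto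
qed

end

subsection \<open>Removing the null sets on which the parameters leave their range\<close>

definition clip :: "real \<Rightarrow> real \<Rightarrow> ('a \<Rightarrow> real) \<Rightarrow> 'a \<Rightarrow> real" where
  "clip a b u = (\<lambda>x. max a (min b (u x)))"

lemma clip_measurable [measurable]:
  assumes [measurable]: "u \<in> borel_measurable M"
  shows "clip a b u \<in> borel_measurable M"
  unfolding clip_def by measurable

lemma clip_AE: "AE x in M. a \<le> u x \<and> u x \<le> b \<Longrightarrow> AE x in M. clip a b u x = u x"
  by (erule eventually_mono) (auto simp: clip_def)

lemma binary_regression_clip:
  fixes f g :: "real ^ 'n::finite \<Rightarrow> real"
  assumes f: "f \<in> borel_measurable cube_measure" and g: "g \<in> G_class c C"
    and c: "0 < c" "c \<le> C"
  shows "binary_regression (clip 0 1 f) (clip c C g) c C"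
proof -
  have gm: "g \<in> borel_measurable cube_measure" and gi: "(\<integral>x. g x \<partial>cube_measure) = 1"
    and gAE: "AE x in cube_measure. c \<le> g x \<and> g x \<le> C"
    using g by (auto simp: G_class_def)
  have "(\<integral>x. clip c C g x \<partial>cube_measure) = (\<integral>x. g x \<partial>cube_measure)"
    using gm clip_AE[OF gAE] by (intro integral_cong_AE) auto
  then show ?thesis
    using f gm gi c by unfold_locales (auto simp: clip_def)
qed

text \<open>
  Clipping \<open>f\<close> does not even change the Bernoulli parameter, which is truncated in the model; clipping
  \<open>g\<close> changes the density on a null set.
\<close>

lemma obs_law_clip:
  fixes f g :: "real ^ 'n::finite \<Rightarrow> real"
  assumes [measurable]: "f \<in> borel_measurable cube_measure" and g: "g \<in> G_class c C"
  shows "obs_law f g = obs_law (clip 0 1 f) (clip c C g)"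
proof -
  have [measurable]: "g \<in> borel_measurable cube_measure"
    and gAE: "AE x in cube_measure. c \<le> g x \<and> g x \<le> C"
    using g by (auto simp: G_class_def)
  interpret B: sigma_finite_measure "count_space (UNIV :: bool set)"
    by (rule sigma_finite_measure_count_space_finite) simp
  have b: "bernoulli_pmf (clip 0 1 f x) = bernoulli_pmf (f x)" for x
    by (rule pmf_eqI) (auto simp: pmf_bernoulli_clip clip_def)
  have [measurable]: "(\<lambda>z. pmf (bernoulli_pmf (f (fst z))) (snd z)) \<in> borel_measurable obs_space"
    using pmf_bernoulli_measurable[of f] by (simp add: case_prod_unfold)
  interpret P: pair_sigma_finite "cube_measure :: (real ^ 'n) measure" "count_space (UNIV :: bool set)" ..
  have "AE z in obs_space. clip c C g (fst z) = g (fst z)"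
    unfolding obs_space_def
    by (rule P.AE_pair_measure) (use clip_AE[OF gAE] in \<open>auto elim!: eventually_mono\<close>)
  then show ?thesis
    unfolding obs_law_def case_prod_unfold b
    by (intro density_cong) (auto elim!: eventually_mono)
qed

section \<open>Integration over independent blocks of the sample\<close>

text \<open>
  As the two arguments of \<open>H\<close> are read on disjoint blocks, the second copy of the sample may be
  replaced by an independent one.
\<close>

lemma (in product_prob_space) nn_integral_PiM_split:
  fixes H :: "('i \<Rightarrow> 'a) \<Rightarrow> ('i \<Rightarrow> 'a) \<Rightarrow> ennreal"
  assumes fin: "finite A" "finite B" "A \<inter> B = {}"
    and meas: "(\<lambda>(\<omega>, \<eta>). H \<omega> \<eta>) \<in> borel_measurable (PiM (A \<union> B) M \<Otimes>\<^sub>M PiM (A \<union> B) M)"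
    and depA: "\<And>\<omega> \<omega>' \<eta>. (\<And>i. i \<in> A \<Longrightarrow> \<omega> i = \<omega>' i) \<Longrightarrow> H \<omega> \<eta> = H \<omega>' \<eta>"
    and depB: "\<And>\<omega> \<eta> \<eta>'. (\<And>j. j \<in> B \<Longrightarrow> \<eta> j = \<eta>' j) \<Longrightarrow> H \<omega> \<eta> = H \<omega> \<eta>'"
  shows "(\<integral>\<^sup>+\<omega>. H \<omega> \<omega> \<partial>PiM (A \<union> B) M) = (\<integral>\<^sup>+\<omega>. (\<integral>\<^sup>+\<eta>. H \<omega> \<eta> \<partial>PiM (A \<union> B) M) \<partial>PiM (A \<union> B) M)"
proof -
  let ?P = "PiM (A \<union> B) M"
  interpret U: prob_space ?P by (intro prob_space_PiM prob_space)
  interpret PA: prob_space "PiM A M" by (intro prob_space_PiM prob_space)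
  interpret PB: prob_space "PiM B M" by (intro prob_space_PiM prob_space)
  have diag: "(\<lambda>\<omega>. H \<omega> \<omega>) \<in> borel_measurable ?P"
    using measurable_compose[OF _ meas, of "\<lambda>\<omega>. (\<omega>, \<omega>)"] by simp
  have sec: "(\<lambda>\<eta>. H \<omega> \<eta>) \<in> borel_measurable ?P" if "\<omega> \<in> space ?P" for \<omega>
    using measurable_compose[OF _ meas, of "\<lambda>\<eta>. (\<omega>, \<eta>)"] that by simp
  have outer: "(\<lambda>\<omega>. \<integral>\<^sup>+\<eta>. H \<omega> \<eta> \<partial>?P) \<in> borel_measurable ?P"
    using U.borel_measurable_nn_integral_fst[OF meas] by simp
  let ?m = "merge A B"
  have Hm: "H (?m (x, y)) (?m (x', y')) = H x y'" for x y x' y'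
  proof -
    have "H (?m (x, y)) (?m (x', y')) = H x (?m (x', y'))"
      by (rule depA) (simp add: merge_def)
    also have "\<dots> = H x y'"
      using fin(3) by (intro depB) (auto simp: merge_def)
    finally show ?thesis .
  qed
  have mspace: "?m (x, y) \<in> space ?P" if "x \<in> space (PiM A M)" "y \<in> space (PiM B M)" for x y
    using measurable_space[OF measurable_merge, of "(x, y)" A M B] that by (simp add: space_pair_measure)
  have L: "(\<integral>\<^sup>+\<omega>. H \<omega> \<omega> \<partial>?P) = (\<integral>\<^sup>+x. \<integral>\<^sup>+y. H x y \<partial>PiM B M \<partial>PiM A M)"
    by (subst product_nn_integral_fold[OF fin(3,1,2) diag]) (simp add: Hm)
  have "(\<integral>\<^sup>+\<omega>. (\<integral>\<^sup>+\<eta>. H \<omega> \<eta> \<partial>?P) \<partial>?P)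
      = (\<integral>\<^sup>+x. \<integral>\<^sup>+y'. (\<integral>\<^sup>+\<eta>. H (?m (x, y')) \<eta> \<partial>?P) \<partial>PiM B M \<partial>PiM A M)"
    by (rule product_nn_integral_fold[OF fin(3,1,2) outer])
  also have "\<dots> = (\<integral>\<^sup>+x. \<integral>\<^sup>+y'. (\<integral>\<^sup>+x'. \<integral>\<^sup>+y. H x y \<partial>PiM B M \<partial>PiM A M) \<partial>PiM B M \<partial>PiM A M)"
    by (intro nn_integral_cong)
       (subst product_nn_integral_fold[OF fin(3,1,2) sec], auto simp: mspace Hm)
  also have "\<dots> = (\<integral>\<^sup>+x. \<integral>\<^sup>+y. H x y \<partial>PiM B M \<partial>PiM A M)"
    by (simp add: PA.emeasure_space_1 PB.emeasure_space_1)
  finally show ?thesis using L by simp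
qed

text \<open>
  Independent centred summands are uncorrelated, so only the diagonal of the double sum survives.
\<close>

lemma (in product_prob_space) nn_integral_square_sum:
  assumes fin: "finite K" "A \<subseteq> K"
    and W [measurable]: "\<And>i. i \<in> A \<Longrightarrow> W \<in> borel_measurable (M i)"
    and int: "\<And>i. i \<in> A \<Longrightarrow> integrable (M i) (\<lambda>z. (W z)\<^sup>2)"
    and mean: "\<And>i. i \<in> A \<Longrightarrow> (\<integral>z. W z \<partial>M i) = 0"
    and var: "\<And>i. i \<in> A \<Longrightarrow> (\<integral>z. (W z)\<^sup>2 \<partial>M i) \<le> V"
  shows "(\<integral>\<^sup>+\<omega>. ennreal ((\<Sum>i\<in>A. W (\<omega> i))\<^sup>2) \<partial>PiM K M) \<le> ennreal (real (card A) * V)"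
proof -
  have finA: "finite A" using fin finite_subset by blast
  have W1: "integrable (M i) W" if "i \<in> A" for i
    by (rule M.square_integrable_imp_integrable[OF W[OF that] int[OF that]])
  (* F i j writes the product of the i-th and the j-th summand as a product over all coordinates. *)
  define F where "F i j = (\<lambda>k. if k = i then (if i = j then (\<lambda>z. (W z)\<^sup>2) else W) else if k = j then W else (\<lambda>_. 1 :: real))" for i j :: 'i
  have intF: "integrable (M k) (F i j k)" if "i \<in> A" "j \<in> A" for i j k
    using that int W1 by (auto simp: F_def)
  have prodF: "(\<Prod>k\<in>K. F i j k (\<omega> k)) = W (\<omega> i) * W (\<omega> j)" if ij: "i \<in> A" "j \<in> A" for i j \<omega>
  proof (cases "i = j")
    case True
    have "(\<Prod>k\<in>K. F i j k (\<omega> k)) = (\<Prod>k\<in>K. if k = i then (W (\<omega> k))\<^sup>2 else 1)"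
      using True by (intro prod.cong) (auto simp: F_def)
    also have "\<dots> = (W (\<omega> i))\<^sup>2"
      using ij fin by (subst prod.delta) auto
    finally show ?thesis using True by (simp add: power2_eq_square)
  next
    case False
    have "(\<Prod>k\<in>K. F i j k (\<omega> k)) = (\<Prod>k\<in>K. (if k = i then W (\<omega> k) else 1) * (if k = j then W (\<omega> k) else 1))"
      using False by (intro prod.cong) (auto simp: F_def)
    also have "\<dots> = W (\<omega> i) * W (\<omega> j)"
      unfolding prod.distrib using ij fin by (subst (1 2) prod.delta) auto
    finally show ?thesis .
  qed
  have pint: "integrable (PiM K M) (\<lambda>\<omega>. W (\<omega> i) * W (\<omega> j))" if "i \<in> A" "j \<in> A" for i j
    using product_integrable_prod[OF fin(1), of "F i j"] intF[OF that] prodF[OF that] by simp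
  have pval: "(\<integral>\<omega>. W (\<omega> i) * W (\<omega> j) \<partial>PiM K M) \<le> (if i = j then V else 0)"
    if ij: "i \<in> A" "j \<in> A" for i j
  proof -
    have eq: "(\<integral>\<omega>. W (\<omega> i) * W (\<omega> j) \<partial>PiM K M) = (\<Prod>k\<in>K. \<integral>z. F i j k z \<partial>M k)"
      using product_integral_prod[OF fin(1), of "F i j"] intF[OF ij] prodF[OF ij] by simp
    show ?thesis
    proof (cases "i = j")
      case True
      have "(\<Prod>k\<in>K. \<integral>z. F i j k z \<partial>M k) = (\<Prod>k\<in>K. if k = i then (\<integral>z. (W z)\<^sup>2 \<partial>M k) else 1)"
        using True by (intro prod.cong) (auto simp: F_def M.prob_space)
      also have "\<dots> = (\<integral>z. (W z)\<^sup>2 \<partial>M i)"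
        using ij fin by (subst prod.delta) auto
      finally show ?thesis using eq True var[OF ij(1)] by simp
    next
      case False
      have "(\<integral>z. F i j i z \<partial>M i) = 0"
        using False mean ij by (simp add: F_def)
      then have "(\<Prod>k\<in>K. \<integral>z. F i j k z \<partial>M k) = 0"
        using ij fin by (intro prod_zero) auto
      then show ?thesis using eq False by simp
    qed
  qed
  have sq: "(\<Sum>i\<in>A. W (\<omega> i))\<^sup>2 = (\<Sum>i\<in>A. \<Sum>j\<in>A. W (\<omega> i) * W (\<omega> j))" for \<omega>
    by (simp add: power2_eq_square sum_product)
  have "(\<integral>\<omega>. (\<Sum>i\<in>A. W (\<omega> i))\<^sup>2 \<partial>PiM K M) = (\<Sum>i\<in>A. \<Sum>j\<in>A. \<integral>\<omega>. W (\<omega> i) * W (\<omega> j) \<partial>PiM K M)"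
    unfolding sq using pint by (simp add: Bochner_Integration.integral_sum)
  also have "\<dots> \<le> (\<Sum>i\<in>A. \<Sum>j\<in>A. if i = j then V else 0)"
    using pval by (intro sum_mono) auto
  also have "\<dots> = real (card A) * V"
    using finA by simp
  finally have le: "(\<integral>\<omega>. (\<Sum>i\<in>A. W (\<omega> i))\<^sup>2 \<partial>PiM K M) \<le> real (card A) * V" .
  have "integrable (PiM K M) (\<lambda>\<omega>. (\<Sum>i\<in>A. W (\<omega> i))\<^sup>2)"
    unfolding sq using pint by auto
  then show ?thesis
    using le by (subst nn_integral_eq_integral) (auto intro!: ennreal_leI)
qed

section \<open>The cross-product statistic\<close>

definition empirical_coeff ::
  "nat set \<Rightarrow> ('k \<Rightarrow> 'a \<Rightarrow> real) \<Rightarrow> ('a \<Rightarrow> real) \<Rightarrow> (nat \<Rightarrow> 'a \<times> bool) \<Rightarrow> 'k \<Rightarrow> real" where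
  "empirical_coeff B e h \<omega> k = (\<Sum>i\<in>B. residual h (\<omega> i) * e k (fst (\<omega> i))) / real (card B)"

text \<open>
  The two factors come from disjoint blocks, which makes the statistic an unbiased estimator of the
  squared length of the coefficient vector: there is no diagonal term to be corrected.
\<close>

definition cross_stat ::
  "nat \<Rightarrow> 'k set \<Rightarrow> ('k \<Rightarrow> 'a \<Rightarrow> real) \<Rightarrow> ('a \<Rightarrow> real) \<Rightarrow> (nat \<Rightarrow> 'a \<times> bool) \<Rightarrow> real" where
  "cross_stat m \<Lambda> e h \<omega> =
     (\<Sum>k\<in>\<Lambda>. empirical_coeff {m..<2*m} e h \<omega> k * empirical_coeff {2*m..<3*m} e h \<omega> k)"

lemma empirical_coeff_cong:
  "(\<And>i. i \<in> B \<Longrightarrow> \<omega> i = \<omega>' i) \<Longrightarrow> empirical_coeff B e h \<omega> k = empirical_coeff B e h \<omega>' k"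
  unfolding empirical_coeff_def by (intro arg_cong2[where f = "(/)"] sum.cong) auto

lemma empirical_coeff_measurable [measurable]:
  assumes [measurable]: "h \<in> borel_measurable cube_measure" "e k \<in> borel_measurable cube_measure"
    and B: "B \<subseteq> {..<n}"
  shows "(\<lambda>\<omega>. empirical_coeff B e h \<omega> k) \<in> borel_measurable (sample_space n)"
proof -
  have [measurable]: "(\<lambda>\<omega>. \<omega> i) \<in> sample_space n \<rightarrow>\<^sub>M obs_space" if "i \<in> B" for i
    using B that by (intro sample_component_measurable) auto
  show ?thesis unfolding empirical_coeff_def by measurable
qed

lemma cross_stat_measurable [measurable]:
  assumes "h \<in> borel_measurable cube_measure" "\<And>k. k \<in> \<Lambda> \<Longrightarrow> e k \<in> borel_measurable cube_measure"
    and "3 * m \<le> n"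
  shows "cross_stat m \<Lambda> e h \<in> borel_measurable (sample_space n)"
  unfolding cross_stat_def[abs_def]
  by (intro borel_measurable_sum borel_measurable_times empirical_coeff_measurable assms)
     (use assms(3) in auto)

context binary_regression
begin

definition true_coeff :: "('k \<Rightarrow> real ^ 'n \<Rightarrow> real) \<Rightarrow> (real ^ 'n \<Rightarrow> real) \<Rightarrow> 'k \<Rightarrow> real" where
  "true_coeff e h k = L2_inner (\<lambda>x. (f x - h x) * g x) (e k)"

text \<open>
  Given \<open>X = x\<close> the residual has mean \<open>f x - h x\<close>, and \<open>X\<close> has density \<open>g\<close>; this is why the weighted
  difference \<open>(f - h) g\<close> and not \<open>f - h\<close> is observable.
\<close>

lemma residual_weighted:
  assumes [measurable]: "h \<in> borel_measurable cube_measure"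
    and h: "\<And>x. 0 \<le> h x" "\<And>x. h x \<le> 1"
    and u: "u \<in> L2_space"
  defines "F \<equiv> (\<lambda>z. residual h z * u (fst z))"
  shows "F \<in> borel_measurable obs_space"
    and "integrable (obs_law f g) F"
    and "integrable (obs_law f g) (\<lambda>z. (F z)\<^sup>2)"
    and "(\<integral>z. F z \<partial>obs_law f g) = L2_inner (\<lambda>x. (f x - h x) * g x) u"
    and "(\<integral>z. (F z)\<^sup>2 \<partial>obs_law f g) \<le> C * (L2_norm u)\<^sup>2"
proof -
  note [measurable] = L2_spaceD[OF u]
  show Fm [measurable]: "F \<in> borel_measurable obs_space"
    unfolding F_def by measurable
  have r: "\<bar>residual h (x, b)\<bar> \<le> 1" for x b
    using h[of x] by (cases b) (auto simp: residual_def)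
  have rm [measurable]: "(\<lambda>x. residual h (x, b)) \<in> borel_measurable cube_measure" for b
    unfolding residual_def by simp
  have FL2: "(\<lambda>x. F (x, b)) \<in> L2_space" for b
    using L2_space_mult_bounded[OF u rm r, of b] by (simp add: F_def mult.commute)
  have i1: "integrable cube_measure (\<lambda>x. F (x, b))" for b
    using integrable_mult[OF FL2 L2_space_const[of 1]] by simp
  note i2 = integrable_square[OF FL2]
  note I1 = integral_obs_law[OF Fm i1]
  have Fm2: "(\<lambda>z. (F z)\<^sup>2) \<in> borel_measurable obs_space" by measurable
  note I2 = integral_obs_law[OF Fm2 i2]
  show "integrable (obs_law f g) F" by (rule I1)
  show "integrable (obs_law f g) (\<lambda>z. (F z)\<^sup>2)" by (rule I2(1))
  show "(\<integral>z. F z \<partial>obs_law f g) = L2_inner (\<lambda>x. (f x - h x) * g x) u"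
    unfolding I1(2) L2_inner_def
    by (intro Bochner_Integration.integral_cong) (auto simp: F_def residual_def algebra_simps)
  have "(\<integral>z. (F z)\<^sup>2 \<partial>obs_law f g) \<le> (\<integral>x. g x * (u x)\<^sup>2 \<partial>cube_measure)"
    unfolding I2(2)
  proof (rule integral_mono')
    show "integrable cube_measure (\<lambda>x. g x * (u x)\<^sup>2)" by (rule g_weight_bounds(3)[OF u])
    fix x
    have sq: "(F (x, b))\<^sup>2 \<le> (u x)\<^sup>2" for b
      using power_mono[OF r[of x b], of 2]
      by (simp add: F_def power_mult_distrib mult_left_le_one_le)
    have "f x * (F (x, True))\<^sup>2 + (1 - f x) * (F (x, False))\<^sup>2 \<le> f x * (u x)\<^sup>2 + (1 - f x) * (u x)\<^sup>2"
      using f_range[of x] by (intro add_mono mult_left_mono sq) auto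
    then show "g x * (f x * (F (x, True))\<^sup>2 + (1 - f x) * (F (x, False))\<^sup>2) \<le> g x * (u x)\<^sup>2"
      by (intro mult_left_mono) (auto simp: algebra_simps)
    show "0 \<le> g x * (u x)\<^sup>2" by simp
  qed
  also have "\<dots> \<le> C * (L2_norm u)\<^sup>2" by (rule g_weight_bounds(2)[OF u])
  finally show "(\<integral>z. (F z)\<^sup>2 \<partial>obs_law f g) \<le> C * (L2_norm u)\<^sup>2" .
qed

text \<open>
  A fixed linear combination of the empirical coefficients is a mean of independent copies of the
  residual times \<open>u = (\<Sum>k\<in>\<Lambda>. v k * e k)\<close>, and orthonormality turns \<open>\<parallel>u\<parallel>\<^sup>2\<close> into the squared length of \<open>v\<close>.
\<close>

lemma linear_error_bound:
  fixes e :: "'k \<Rightarrow> real ^ 'n \<Rightarrow> real"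
  assumes os: "orthonormal_system \<Lambda> e"
    and hm: "h \<in> borel_measurable cube_measure"
    and h: "\<And>x. 0 \<le> h x" "\<And>x. h x \<le> 1"
    and B: "B \<subseteq> {..<n}" "B \<noteq> {}"
  shows "(\<integral>\<^sup>+\<omega>. ennreal ((\<Sum>k\<in>\<Lambda>. v k * (empirical_coeff B e h \<omega> k - true_coeff e h k))\<^sup>2) \<partial>sample_law n f g)
    \<le> ennreal (C / real (card B) * (\<Sum>k\<in>\<Lambda>. (v k)\<^sup>2))"
proof -
  have finB: "finite B" using B finite_subset by blast
  then have cB: "0 < real (card B)" using B by (simp add: card_gt_0_iff)
  define u where "u = lincomb \<Lambda> e v"
  have u: "u \<in> L2_space" unfolding u_def by (rule lincomb_L2[OF os])
  define F where "F = (\<lambda>z. residual h z * u (fst z))"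
  note RW = residual_weighted[OF hm h u, folded F_def]
  have F2: "integrable (obs_law f g) (\<lambda>z. (F z)\<^sup>2)"
    and F2_le: "(\<integral>z. (F z)\<^sup>2 \<partial>obs_law f g) \<le> C * (L2_norm u)\<^sup>2"
    using residual_weighted(3,5)[OF hm h u] by (simp_all add: F_def)
  note [measurable] = RW(1)
  define \<mu> where "\<mu> = (\<integral>z. F z \<partial>obs_law f g)"
  define W where "W = (\<lambda>z. F z - \<mu>)"
  have Wm: "W \<in> borel_measurable (obs_law f g)" unfolding W_def by simp
  have Wi: "integrable (obs_law f g) (\<lambda>z. (W z)\<^sup>2)"
    unfolding W_def power2_diff using RW(2) F2
    by (intro Bochner_Integration.integrable_add Bochner_Integration.integrable_diff) (auto simp: mult.assoc)
  have W0: "(\<integral>z. W z \<partial>obs_law f g) = 0"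
    unfolding W_def using RW(2) by (simp add: \<mu>_def sample.M.prob_space[simplified])
  have WV: "(\<integral>z. (W z)\<^sup>2 \<partial>obs_law f g) \<le> C * (L2_norm u)\<^sup>2"
  proof -
    have "(\<integral>z. (W z)\<^sup>2 \<partial>obs_law f g) = (\<integral>z. (F z)\<^sup>2 \<partial>obs_law f g) - \<mu>\<^sup>2"
      using sample.M.variance_eq[OF RW(2) F2] by (simp add: W_def \<mu>_def)
    then show ?thesis using F2_le by (smt (verit) zero_le_power2)
  qed
  have "\<mu> = (\<Sum>k\<in>\<Lambda>. v k * true_coeff e h k)"
    unfolding \<mu>_def RW(4) u_def true_coeff_def
    by (subst L2_inner_lincomb[OF os])
       (auto intro!: L2_space_mult_bounded[where B = C] L2_space_diff f_L2 g_abs L2_space_bounded[OF hm, of 1] simp: h abs_le_iff)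
  moreover have "(\<Sum>k\<in>\<Lambda>. v k * empirical_coeff B e h \<omega> k) = (\<Sum>i\<in>B. F (\<omega> i)) / real (card B)" for \<omega>
    unfolding empirical_coeff_def F_def u_def lincomb_def sum_divide_distrib sum_distrib_left
    by (subst sum.swap) (simp add: mult_ac)
  ultimately have eq: "(\<Sum>k\<in>\<Lambda>. v k * (empirical_coeff B e h \<omega> k - true_coeff e h k))
      = (\<Sum>i\<in>B. W (\<omega> i)) / real (card B)" for \<omega>
    using cB by (simp add: right_diff_distrib sum_subtractf W_def diff_divide_distrib)
  have [measurable]: "(\<lambda>\<omega>. \<omega> i) \<in> PiM {..<n} (\<lambda>_. obs_law f g) \<rightarrow>\<^sub>M obs_law f g" if "i \<in> B" for i
    using B that by (intro measurable_component_singleton) auto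
  note [measurable] = Wm
  have "(\<integral>\<^sup>+\<omega>. ennreal (((\<Sum>i\<in>B. W (\<omega> i)) / real (card B))\<^sup>2) \<partial>sample_law n f g)
     = (\<integral>\<^sup>+\<omega>. ennreal (1 / (real (card B))\<^sup>2) * ennreal ((\<Sum>i\<in>B. W (\<omega> i))\<^sup>2) \<partial>sample_law n f g)"
    by (intro nn_integral_cong) (simp add: ennreal_mult[symmetric] power_divide)
  also have "\<dots> = ennreal (1 / (real (card B))\<^sup>2) * (\<integral>\<^sup>+\<omega>. ennreal ((\<Sum>i\<in>B. W (\<omega> i))\<^sup>2) \<partial>sample_law n f g)"
    unfolding sample_law_def by (rule nn_integral_cmult) measurable
  also have "\<dots> \<le> ennreal (1 / (real (card B))\<^sup>2) * ennreal (real (card B) * (C * (L2_norm u)\<^sup>2))"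
    unfolding sample_law_def
    by (intro mult_left_mono sample.nn_integral_square_sum) (use B Wm Wi W0 WV in auto)
  also have "\<dots> = ennreal (C / real (card B) * (\<Sum>k\<in>\<Lambda>. (v k)\<^sup>2))"
  proof -
    have "(L2_norm u)\<^sup>2 = (\<Sum>k\<in>\<Lambda>. (v k)\<^sup>2)" unfolding u_def by (rule L2_norm_lincomb[OF os])
    then have "1 / (real (card B))\<^sup>2 * (real (card B) * (C * (L2_norm u)\<^sup>2)) = C / real (card B) * (\<Sum>k\<in>\<Lambda>. (v k)\<^sup>2)"
      using cB by (simp add: power2_eq_square)
    then show ?thesis using cB C_pos by (subst ennreal_mult[symmetric]) auto
  qed
  finally show ?thesis unfolding eq .
qed

lemma nn_integral_sample_split:
  fixes H :: "(nat \<Rightarrow> (real ^ 'n) \<times> bool) \<Rightarrow> (nat \<Rightarrow> (real ^ 'n) \<times> bool) \<Rightarrow> ennreal"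
  assumes d: "d \<le> n"
    and meas: "(\<lambda>z. H (fst z) (snd z)) \<in> borel_measurable (sample_space n \<Otimes>\<^sub>M sample_space n)"
    and dep1: "\<And>\<omega> \<omega>' \<eta>. (\<And>i. i < d \<Longrightarrow> \<omega> i = \<omega>' i) \<Longrightarrow> H \<omega> \<eta> = H \<omega>' \<eta>"
    and dep2: "\<And>\<omega> \<eta> \<eta>'. (\<And>j. d \<le> j \<Longrightarrow> j < n \<Longrightarrow> \<eta> j = \<eta>' j) \<Longrightarrow> H \<omega> \<eta> = H \<omega> \<eta>'"
  shows "(\<integral>\<^sup>+\<omega>. H \<omega> \<omega> \<partial>sample_law n f g) = (\<integral>\<^sup>+\<omega>. (\<integral>\<^sup>+\<eta>. H \<omega> \<eta> \<partial>sample_law n f g) \<partial>sample_law n f g)"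
proof -
  have un: "{..<d} \<union> {d..<n} = {..<n}" using d by auto
  have sets_eq: "sets (sample_law n f g \<Otimes>\<^sub>M sample_law n f g) = sets (sample_space n \<Otimes>\<^sub>M sample_space n)"
    by (intro sets_pair_measure_cong sets_sample_law)
  have "(\<lambda>(\<omega>, \<eta>). H \<omega> \<eta>) \<in> borel_measurable (sample_law n f g \<Otimes>\<^sub>M sample_law n f g)"
    using meas by (simp add: measurable_cong_sets[OF sets_eq refl] case_prod_unfold)
  then show ?thesis
    unfolding sample_law_def un[symmetric]
    by (intro sample.nn_integral_PiM_split) (auto intro: dep1 dep2)
qed

definition signal :: "'k set \<Rightarrow> ('k \<Rightarrow> real ^ 'n \<Rightarrow> real) \<Rightarrow> (real ^ 'n \<Rightarrow> real) \<Rightarrow> real" where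
  "signal \<Lambda> e h = (\<Sum>k\<in>\<Lambda>. (true_coeff e h k)\<^sup>2)"

lemma signal_nonneg [simp]: "0 \<le> signal \<Lambda> e h"
  by (simp add: signal_def sum_nonneg)

text \<open>
  With \<open>A\<close> and \<open>B\<close> the errors of the two coefficient vectors and \<open>t\<close> the true one, the deviation is
  \<open>t \<bullet> A + t \<bullet> B + A \<bullet> B\<close>.  The first two terms are linear.  For the third, \<open>A\<close> may be frozen by
  independence, so that it is linear in \<open>B\<close> as well, and the mean of \<open>A \<bullet> A\<close> is summed coordinatewise.
\<close>

lemma cross_stat_variance:
  fixes e :: "'k \<Rightarrow> real ^ 'n \<Rightarrow> real"
  assumes os: "orthonormal_system \<Lambda> e"
    and hm: "h \<in> borel_measurable cube_measure"
    and h: "\<And>x. 0 \<le> h x" "\<And>x. h x \<le> 1"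
    and m: "1 \<le> m" "3 * m \<le> n"
  shows "(\<integral>\<^sup>+\<omega>. ennreal ((cross_stat m \<Lambda> e h \<omega> - signal \<Lambda> e h)\<^sup>2) \<partial>sample_law n f g)
    \<le> ennreal (6 * C * signal \<Lambda> e h / real m + 3 * C\<^sup>2 * real (card \<Lambda>) / (real m)\<^sup>2)"
proof -
  let ?P = "sample_law n f g"
  define A where "A = (\<lambda>\<omega> k. empirical_coeff {m..<2*m} e h \<omega> k - true_coeff e h k)"
  define B where "B = (\<lambda>\<omega> k. empirical_coeff {2*m..<3*m} e h \<omega> k - true_coeff e h k)"
  have em: "k \<in> \<Lambda> \<Longrightarrow> e k \<in> borel_measurable cube_measure" for k
    using os_L2[OF os] by measurable
  have blk: "{m..<2*m} \<subseteq> {..<n}" "{m..<2*m} \<noteq> {}" "{2*m..<3*m} \<subseteq> {..<n}" "{2*m..<3*m} \<noteq> {}"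
    using m by auto
  have Am: "(\<lambda>\<omega>. A \<omega> k) \<in> borel_measurable (sample_space n)" if "k \<in> \<Lambda>" for k
    unfolding A_def using empirical_coeff_measurable[where e = e, OF hm em[OF that] blk(1)] by measurable
  have Bm: "(\<lambda>\<omega>. B \<omega> k) \<in> borel_measurable (sample_space n)" if "k \<in> \<Lambda>" for k
    unfolding B_def using empirical_coeff_measurable[where e = e, OF hm em[OF that] blk(3)] by measurable
  have boundA: "(\<integral>\<^sup>+\<omega>. ennreal ((\<Sum>k\<in>\<Lambda>. v k * A \<omega> k)\<^sup>2) \<partial>?P) \<le> ennreal (C / real m * (\<Sum>k\<in>\<Lambda>. (v k)\<^sup>2))" for v
    using linear_error_bound[OF os hm h blk(1,2), of v] by (simp add: A_def)
  have boundB: "(\<integral>\<^sup>+\<omega>. ennreal ((\<Sum>k\<in>\<Lambda>. v k * B \<omega> k)\<^sup>2) \<partial>?P) \<le> ennreal (C / real m * (\<Sum>k\<in>\<Lambda>. (v k)\<^sup>2))" for v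
    using linear_error_bound[OF os hm h blk(3,4), of v] by (simp add: B_def)
  have coordA: "(\<integral>\<^sup>+\<omega>. ennreal ((A \<omega> k)\<^sup>2) \<partial>?P) \<le> ennreal (C / real m)" if k: "k \<in> \<Lambda>" for k
    using boundA[of "\<lambda>l. if l = k then 1 else 0"] k os_finite[OF os]
    by (simp add: if_distrib[of "\<lambda>t. t * _"] if_distrib[of "\<lambda>t. t\<^sup>2"] cong: if_cong)
  have cross: "(\<integral>\<^sup>+\<omega>. ennreal ((\<Sum>k\<in>\<Lambda>. A \<omega> k * B \<omega> k)\<^sup>2) \<partial>?P) \<le> ennreal (C\<^sup>2 * real (card \<Lambda>) / (real m)\<^sup>2)"
  proof -
    let ?H = "\<lambda>\<omega> \<eta>. ennreal ((\<Sum>k\<in>\<Lambda>. A \<omega> k * B \<eta> k)\<^sup>2)"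
    have "(\<integral>\<^sup>+\<omega>. ?H \<omega> \<omega> \<partial>?P) = (\<integral>\<^sup>+\<omega>. (\<integral>\<^sup>+\<eta>. ?H \<omega> \<eta> \<partial>?P) \<partial>?P)"
    proof (rule nn_integral_sample_split[where d = "2 * m"])
      show "2 * m \<le> n" using m by simp
      show "(\<lambda>z. ?H (fst z) (snd z)) \<in> borel_measurable (sample_space n \<Otimes>\<^sub>M sample_space n)"
        by (intro measurable_compose[OF _ measurable_ennreal] borel_measurable_power borel_measurable_sum
            borel_measurable_times measurable_compose[OF measurable_fst Am] measurable_compose[OF measurable_snd Bm])
      show "?H \<omega> \<eta> = ?H \<omega>' \<eta>" if "\<And>i. i < 2*m \<Longrightarrow> \<omega> i = \<omega>' i" for \<omega> \<omega>' \<eta>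
      proof -
        have "A \<omega> k = A \<omega>' k" for k
          unfolding A_def using that by (subst empirical_coeff_cong[of _ \<omega> \<omega>']) auto
        then show ?thesis by simp
      qed
      show "?H \<omega> \<eta> = ?H \<omega> \<eta>'" if "\<And>i. 2*m \<le> i \<Longrightarrow> i < n \<Longrightarrow> \<eta> i = \<eta>' i" for \<omega> \<eta> \<eta>'
      proof -
        have "B \<eta> k = B \<eta>' k" for k
          unfolding B_def using that m by (subst empirical_coeff_cong[of _ \<eta> \<eta>']) auto
        then show ?thesis by simp
      qed
    qed
    also have "\<dots> \<le> (\<integral>\<^sup>+\<omega>. ennreal (C / real m * (\<Sum>k\<in>\<Lambda>. (A \<omega> k)\<^sup>2)) \<partial>?P)"
      by (intro nn_integral_mono boundB)
    also have "\<dots> = (\<integral>\<^sup>+\<omega>. (\<Sum>k\<in>\<Lambda>. ennreal (C / real m) * ennreal ((A \<omega> k)\<^sup>2)) \<partial>?P)"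
      using C_pos
      by (intro nn_integral_cong) (simp add: ennreal_mult[symmetric] sum_ennreal sum_distrib_left)
    also have "\<dots> = (\<Sum>k\<in>\<Lambda>. ennreal (C / real m) * (\<integral>\<^sup>+\<omega>. ennreal ((A \<omega> k)\<^sup>2) \<partial>?P))"
    proof -
      have *: "(\<lambda>\<omega>. ennreal ((A \<omega> k)\<^sup>2)) \<in> borel_measurable ?P" if "k \<in> \<Lambda>" for k
        using Am[OF that] by simp
      then show ?thesis
        by (subst nn_integral_sum) (auto simp: nn_integral_cmult intro!: borel_measurable_times)
    qed
    also have "\<dots> \<le> (\<Sum>k\<in>\<Lambda>. ennreal (C / real m) * ennreal (C / real m))"
      by (intro sum_mono mult_left_mono coordA) auto
    also have "\<dots> = ennreal (C\<^sup>2 * real (card \<Lambda>) / (real m)\<^sup>2)"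
      using C_pos by (simp add: ennreal_mult[symmetric] ennreal_of_nat_eq_real_of_nat power2_eq_square field_simps)
    finally show ?thesis .
  qed
  let ?t = "true_coeff e h"
  have split: "(cross_stat m \<Lambda> e h \<omega> - signal \<Lambda> e h)\<^sup>2 \<le>
     3 * ((\<Sum>k\<in>\<Lambda>. ?t k * A \<omega> k)\<^sup>2 + (\<Sum>k\<in>\<Lambda>. ?t k * B \<omega> k)\<^sup>2 + (\<Sum>k\<in>\<Lambda>. A \<omega> k * B \<omega> k)\<^sup>2)" for \<omega>
  proof -
    have "cross_stat m \<Lambda> e h \<omega> - signal \<Lambda> e h
        = (\<Sum>k\<in>\<Lambda>. ?t k * A \<omega> k) + (\<Sum>k\<in>\<Lambda>. ?t k * B \<omega> k) + (\<Sum>k\<in>\<Lambda>. A \<omega> k * B \<omega> k)"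
      unfolding cross_stat_def signal_def A_def B_def sum.distrib[symmetric] sum_subtractf[symmetric]
      by (intro sum.cong) (auto simp: algebra_simps power2_eq_square)
    moreover have "(a + b + d)\<^sup>2 \<le> 3 * (a\<^sup>2 + b\<^sup>2 + d\<^sup>2)" for a b d :: real
    proof -
      have "0 \<le> (a - b)\<^sup>2 + (b - d)\<^sup>2 + (a - d)\<^sup>2" by simp
      then show ?thesis by (simp add: power2_eq_square algebra_simps)
    qed
    ultimately show ?thesis by simp
  qed
  have "(\<integral>\<^sup>+\<omega>. ennreal ((cross_stat m \<Lambda> e h \<omega> - signal \<Lambda> e h)\<^sup>2) \<partial>?P)
     \<le> (\<integral>\<^sup>+\<omega>. ennreal (3 * ((\<Sum>k\<in>\<Lambda>. ?t k * A \<omega> k)\<^sup>2 + (\<Sum>k\<in>\<Lambda>. ?t k * B \<omega> k)\<^sup>2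
          + (\<Sum>k\<in>\<Lambda>. A \<omega> k * B \<omega> k)\<^sup>2)) \<partial>?P)"
    by (intro nn_integral_mono ennreal_leI split)
  also have "\<dots> = (\<integral>\<^sup>+\<omega>. ennreal 3 * (ennreal ((\<Sum>k\<in>\<Lambda>. ?t k * A \<omega> k)\<^sup>2) + ennreal ((\<Sum>k\<in>\<Lambda>. ?t k * B \<omega> k)\<^sup>2)
          + ennreal ((\<Sum>k\<in>\<Lambda>. A \<omega> k * B \<omega> k)\<^sup>2)) \<partial>?P)"
    by (intro nn_integral_cong) (simp add: ennreal_mult)
  also have "\<dots> = ennreal 3 * ((\<integral>\<^sup>+\<omega>. ennreal ((\<Sum>k\<in>\<Lambda>. ?t k * A \<omega> k)\<^sup>2) \<partial>?P)
      + (\<integral>\<^sup>+\<omega>. ennreal ((\<Sum>k\<in>\<Lambda>. ?t k * B \<omega> k)\<^sup>2) \<partial>?P) + (\<integral>\<^sup>+\<omega>. ennreal ((\<Sum>k\<in>\<Lambda>. A \<omega> k * B \<omega> k)\<^sup>2) \<partial>?P))"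
    using Am Bm by (simp add: nn_integral_cmult nn_integral_add)
  also have "\<dots> \<le> ennreal 3 * (ennreal (C / real m * signal \<Lambda> e h) + ennreal (C / real m * signal \<Lambda> e h)
      + ennreal (C\<^sup>2 * real (card \<Lambda>) / (real m)\<^sup>2))"
    using boundA[of ?t] boundB[of ?t] cross
    by (intro mult_left_mono add_mono) (auto simp: signal_def)
  also have "\<dots> = ennreal (6 * C * signal \<Lambda> e h / real m + 3 * C\<^sup>2 * real (card \<Lambda>) / (real m)\<^sup>2)"
  proof -
    have "ennreal 3 * (ennreal a + ennreal a + ennreal b) = ennreal (3 * (a + a + b))"
      if "0 \<le> a" "0 \<le> b" for a b
      using that by (subst ennreal_mult, simp, simp) (simp only: ennreal_plus add_nonneg_nonneg)
    moreover have "3 * (C / real m * signal \<Lambda> e h + C / real m * signal \<Lambda> e h + C\<^sup>2 * real (card \<Lambda>) / (real m)\<^sup>2)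
       = 6 * C * signal \<Lambda> e h / real m + 3 * C\<^sup>2 * real (card \<Lambda>) / (real m)\<^sup>2"
      by simp
    ultimately show ?thesis
      using C_pos by (metis divide_nonneg_nonneg less_imp_le mult_nonneg_nonneg of_nat_0_le_iff signal_nonneg zero_le_power2)
  qed
  finally show ?thesis .
qed

text \<open>
  Chebyshev's inequality at the threshold \<open>t = (T + s) / 2\<close>.  Writing \<open>r = sqrt D / m\<close> and \<open>s = \<kappa> r\<close>,
  the square \<open>\<delta> t\<^sup>2\<close> contains \<open>\<delta> \<kappa> T r / 2\<close> and \<open>\<delta> \<kappa>\<^sup>2 r\<^sup>2 / 4\<close>; these dominate the two parts of the
  variance because \<open>\<delta> \<kappa> = 36 C\<^sup>2\<close>.
\<close>

lemma cross_stat_deviation: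
  fixes e :: "'k \<Rightarrow> real ^ 'n \<Rightarrow> real"
  assumes os: "orthonormal_system \<Lambda> e" and ne: "\<Lambda> \<noteq> {}"
    and hm: "h \<in> borel_measurable cube_measure"
    and h: "\<And>x. 0 \<le> h x" "\<And>x. h x \<le> 1"
    and m: "1 \<le> m" "3 * m \<le> n"
    and \<delta>: "0 < \<delta>" "\<delta> \<le> 1" and C: "1 \<le> C"
    and s_def: "s = 36 * C\<^sup>2 / \<delta> * (sqrt (real (card \<Lambda>)) / real m)"
  shows "emeasure (sample_law n f g) {\<omega> \<in> space (sample_space n).
       signal \<Lambda> e h > 2 * cross_stat m \<Lambda> e h \<omega> + s \<or> cross_stat m \<Lambda> e h \<omega> > 2 * signal \<Lambda> e h + s} \<le> ennreal \<delta>"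
    (is "emeasure ?P ?Bad \<le> _")
proof -
  let ?T = "signal \<Lambda> e h" and ?U = "cross_stat m \<Lambda> e h"
  have em: "k \<in> \<Lambda> \<Longrightarrow> e k \<in> borel_measurable cube_measure" for k
    using os_L2[OF os] by measurable
  have Um: "?U \<in> borel_measurable (sample_space n)"
    using hm em m by (intro cross_stat_measurable) auto
  define r where "r = sqrt (real (card \<Lambda>)) / real m"
  define \<kappa> where "\<kappa> = 36 * C\<^sup>2 / \<delta>"
  have D: "1 \<le> real (card \<Lambda>)" using ne os_finite[OF os] by (simp add: Suc_le_eq card_gt_0_iff)
  have r_pos: "0 < r" and m_r: "1 / real m \<le> r"
    unfolding r_def using D m by (auto intro!: divide_right_mono)
  have r2: "real (card \<Lambda>) / (real m)\<^sup>2 = r\<^sup>2" unfolding r_def by (simp add: power_divide)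
  have \<kappa>1: "1 \<le> \<kappa>" and \<kappa>C: "\<kappa> * \<delta> = 36 * C\<^sup>2"
  proof -
    have "1 \<le> C\<^sup>2" using power_mono[OF C, of 2] by simp
    then show "1 \<le> \<kappa>" "\<kappa> * \<delta> = 36 * C\<^sup>2" unfolding \<kappa>_def using \<delta> by (auto simp: field_simps)
  qed
  have s: "s = \<kappa> * r" by (simp add: s_def \<kappa>_def r_def)
  define t where "t = (?T + s) / 2"
  have t_pos: "0 < t" unfolding t_def s using r_pos \<kappa>1 by (intro divide_pos_pos add_nonneg_pos) auto
  have var: "6 * C * ?T / real m + 3 * C\<^sup>2 * real (card \<Lambda>) / (real m)\<^sup>2 \<le> \<delta> * t\<^sup>2"
  proof -
    have "6 * C * ?T / real m \<le> 6 * C * ?T * r"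
      using mult_left_mono[OF m_r, of "6 * C * ?T"] C by simp
    also have "\<dots> \<le> 6 * C\<^sup>2 * ?T * r"
      using C r_pos by (intro mult_right_mono) (auto simp: power2_eq_square)
    finally have 1: "6 * C * ?T / real m \<le> 6 * C\<^sup>2 * ?T * r" .
    have "1 * (C\<^sup>2 * r\<^sup>2) \<le> \<kappa> * (C\<^sup>2 * r\<^sup>2)" using \<kappa>1 by (intro mult_right_mono) auto
    moreover have "0 \<le> \<kappa> * (C\<^sup>2 * r\<^sup>2)" using \<kappa>1 by simp
    moreover have "3 * C\<^sup>2 * real (card \<Lambda>) / (real m)\<^sup>2 = 3 * (C\<^sup>2 * r\<^sup>2)"
      using r2 by (metis mult.assoc times_divide_eq_right)
    moreover have "9 * C\<^sup>2 * \<kappa> * r\<^sup>2 = 9 * (\<kappa> * (C\<^sup>2 * r\<^sup>2))" by simp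
    ultimately have 2: "3 * C\<^sup>2 * real (card \<Lambda>) / (real m)\<^sup>2 \<le> 9 * C\<^sup>2 * \<kappa> * r\<^sup>2"
      by linarith
    have "\<delta> * t\<^sup>2 = \<delta> * (?T\<^sup>2 + 2 * ?T * (\<kappa> * r) + \<kappa>\<^sup>2 * r\<^sup>2) / 4"
      unfolding t_def s by (simp add: power2_eq_square algebra_simps)
    also have "\<dots> = \<delta> * ?T\<^sup>2 / 4 + (\<kappa> * \<delta>) * ?T * r / 2 + (\<kappa> * \<delta>) * \<kappa> * r\<^sup>2 / 4"
      by (simp add: power2_eq_square distrib_left add_divide_distrib mult_ac)
    also have "\<dots> = \<delta> * ?T\<^sup>2 / 4 + 18 * C\<^sup>2 * ?T * r + 9 * C\<^sup>2 * \<kappa> * r\<^sup>2"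
      unfolding \<kappa>C by simp
    finally have "\<delta> * t\<^sup>2 = \<delta> * ?T\<^sup>2 / 4 + 18 * C\<^sup>2 * ?T * r + 9 * C\<^sup>2 * \<kappa> * r\<^sup>2" .
    moreover have "0 \<le> \<delta> * ?T\<^sup>2 / 4" "0 \<le> 12 * C\<^sup>2 * ?T * r"
      using \<delta> r_pos by auto
    ultimately show ?thesis using 1 2 by linarith
  qed
  have "emeasure ?P ?Bad = (\<integral>\<^sup>+\<omega>. indicator ?Bad \<omega> \<partial>?P)"
    using Um by (intro nn_integral_indicator[symmetric]) simp
  also have "\<dots> \<le> (\<integral>\<^sup>+\<omega>. ennreal (1 / t\<^sup>2) * ennreal ((?U \<omega> - ?T)\<^sup>2) \<partial>?P)"
  proof (rule nn_integral_mono)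
    fix \<omega>
    show "indicator ?Bad \<omega> \<le> ennreal (1 / t\<^sup>2) * ennreal ((?U \<omega> - ?T)\<^sup>2)"
    proof (cases "\<omega> \<in> ?Bad")
      case True
      then have "t \<le> \<bar>?U \<omega> - ?T\<bar>"
        using t_pos signal_nonneg[of \<Lambda> e h] unfolding t_def by (auto simp: abs_le_iff)
      then have "t\<^sup>2 \<le> (?U \<omega> - ?T)\<^sup>2"
        using t_pos power_mono[of t "\<bar>?U \<omega> - ?T\<bar>" 2] by simp
      then have "1 \<le> 1 / t\<^sup>2 * (?U \<omega> - ?T)\<^sup>2"
        using t_pos by simp
      then show ?thesis
        using True by (simp add: ennreal_mult[symmetric] ennreal_ge_1 del: times_divide_eq_left)
    qed simp
  qed
  also have "\<dots> = ennreal (1 / t\<^sup>2) * (\<integral>\<^sup>+\<omega>. ennreal ((?U \<omega> - ?T)\<^sup>2) \<partial>?P)"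
    using Um by (intro nn_integral_cmult) simp
  also have "\<dots> \<le> ennreal (1 / t\<^sup>2) * ennreal (\<delta> * t\<^sup>2)"
    using order.trans[OF cross_stat_variance[OF os hm h m] ennreal_leI[OF var]]
    by (intro mult_left_mono) auto
  also have "\<dots> = ennreal \<delta>"
    using t_pos by (subst ennreal_mult[symmetric]) (auto simp: \<delta> less_imp_le)
  finally show ?thesis .
qed

text \<open>
  A choice made from the first block of the sample is harmless for events that concern the
  remaining blocks: conditionally on the first block the choice is fixed.
\<close>

lemma emeasure_selected_event_le:
  assumes d: "d \<le> n"
    and idx: "idx \<in> sample_space n \<rightarrow>\<^sub>M count_space (UNIV :: nat set)"
    and idx_dep: "\<And>\<omega> \<omega>'. (\<And>i. i < d \<Longrightarrow> \<omega> i = \<omega>' i) \<Longrightarrow> idx \<omega> = idx \<omega>'"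
    and Q: "\<And>i. Measurable.pred (sample_space n) (Q i)"
    and Q_dep: "\<And>i \<omega> \<omega>'. (\<And>j. d \<le> j \<Longrightarrow> j < n \<Longrightarrow> \<omega> j = \<omega>' j) \<Longrightarrow> Q i \<omega> = Q i \<omega>'"
    and bound: "\<And>i. emeasure (sample_law n f g) {\<omega> \<in> space (sample_space n). Q i \<omega>} \<le> ennreal \<delta>"
  shows "{\<omega> \<in> space (sample_space n). Q (idx \<omega>) \<omega>} \<in> sets (sample_space n)"
    and "emeasure (sample_law n f g) {\<omega> \<in> space (sample_space n). Q (idx \<omega>) \<omega>} \<le> ennreal \<delta>"
proof -
  let ?P = "sample_law n f g" and ?S = "sample_space n"
  interpret P: prob_space ?P by (rule prob_space_sample_law)
  let ?H = "\<lambda>\<omega> \<eta>. indicator {\<eta>. Q (idx \<omega>) \<eta>} \<eta> :: ennreal"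
  show sets: "{\<omega> \<in> space ?S. Q (idx \<omega>) \<omega>} \<in> sets ?S"
    using measurable_compose_countable[OF Q idx] by simp
  have [measurable]: "(\<lambda>z. idx (fst z)) \<in> ?S \<Otimes>\<^sub>M ?S \<rightarrow>\<^sub>M count_space UNIV"
    "\<And>i. Measurable.pred (?S \<Otimes>\<^sub>M ?S) (\<lambda>z. Q i (snd z))"
    by (rule measurable_compose[OF measurable_fst idx], rule measurable_compose[OF measurable_snd Q])
  have "Measurable.pred (?S \<Otimes>\<^sub>M ?S) (\<lambda>z. Q (idx (fst z)) (snd z))"
    by (rule measurable_compose_countable[where f = "\<lambda>i z. Q i (snd z)" and g = "\<lambda>z. idx (fst z)"]) measurable
  then have Hm: "(\<lambda>z. ?H (fst z) (snd z)) \<in> borel_measurable (?S \<Otimes>\<^sub>M ?S)"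
    by simp
  have sec: "(\<integral>\<^sup>+\<eta>. indicator {\<eta>. Q i \<eta>} \<eta> \<partial>?P) \<le> ennreal \<delta>" for i
  proof -
    have "(\<integral>\<^sup>+\<eta>. indicator {\<eta>. Q i \<eta>} \<eta> \<partial>?P) = (\<integral>\<^sup>+\<eta>. indicator {\<eta> \<in> space ?S. Q i \<eta>} \<eta> \<partial>?P)"
      by (intro nn_integral_cong) (simp add: indicator_def)
    also have "\<dots> = emeasure ?P {\<eta> \<in> space ?S. Q i \<eta>}"
      using Q[of i] by (intro nn_integral_indicator) simp
    finally show ?thesis using bound by simp
  qed
  have "emeasure ?P {\<omega> \<in> space ?S. Q (idx \<omega>) \<omega>} = (\<integral>\<^sup>+\<omega>. indicator {\<omega> \<in> space ?S. Q (idx \<omega>) \<omega>} \<omega> \<partial>?P)"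
    using sets by (intro nn_integral_indicator[symmetric]) simp
  also have "\<dots> = (\<integral>\<^sup>+\<omega>. ?H \<omega> \<omega> \<partial>?P)"
    by (intro nn_integral_cong) (simp add: indicator_def)
  also have "\<dots> = (\<integral>\<^sup>+\<omega>. (\<integral>\<^sup>+\<eta>. ?H \<omega> \<eta> \<partial>?P) \<partial>?P)"
  proof (rule nn_integral_sample_split[OF d Hm])
    show "?H \<omega> \<eta> = ?H \<omega>' \<eta>" if "\<And>i. i < d \<Longrightarrow> \<omega> i = \<omega>' i" for \<omega> \<omega>' \<eta>
      using idx_dep[of \<omega> \<omega>', OF that] by simp
    show "?H \<omega> \<eta> = ?H \<omega> \<eta>'" if "\<And>j. d \<le> j \<Longrightarrow> j < n \<Longrightarrow> \<eta> j = \<eta>' j" for \<omega> \<eta> \<eta>'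
      using Q_dep[of \<eta> \<eta>' "idx \<omega>", OF that] by (simp add: indicator_def)
  qed
  also have "\<dots> \<le> (\<integral>\<^sup>+\<omega>. ennreal \<delta> \<partial>?P)"
    by (intro nn_integral_mono sec)
  also have "\<dots> = ennreal \<delta>"
    using P.emeasure_space_1 by simp
  finally show "emeasure ?P {\<omega> \<in> space ?S. Q (idx \<omega>) \<omega>} \<le> ennreal \<delta>" .
qed

end

section \<open>From the signal to the distance\<close>

context binary_regression
begin

lemma L2_norm_weighted_le:
  assumes u: "u \<in> L2_space"
  shows "L2_norm (\<lambda>x. u x * g x) \<le> C * L2_norm u" and "(\<lambda>x. u x * g x) \<in> L2_space"
proof -
  show ug: "(\<lambda>x. u x * g x) \<in> L2_space"
    by (rule L2_space_mult_bounded[OF u g_measurable g_abs])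
  have "(L2_norm (\<lambda>x. u x * g x))\<^sup>2 \<le> C\<^sup>2 * (L2_norm u)\<^sup>2"
    unfolding L2_norm_square L2_inner_def integral_mult_right_zero[symmetric]
  proof (rule integral_mono)
    show "integrable cube_measure (\<lambda>x. u x * g x * (u x * g x))"
      by (rule integrable_mult[OF ug ug])
    show "integrable cube_measure (\<lambda>x. C\<^sup>2 * (u x * u x))"
      using integrable_mult[OF u u] by simp
    fix x
    have "(g x)\<^sup>2 \<le> C\<^sup>2" using power_mono[OF g_abs[of x], of 2] by simp
    from mult_left_mono[OF this, of "(u x)\<^sup>2"]
    show "u x * g x * (u x * g x) \<le> C\<^sup>2 * (u x * u x)"
      by (simp add: power2_eq_square mult_ac)
  qed
  then have "(L2_norm (\<lambda>x. u x * g x))\<^sup>2 \<le> (C * L2_norm u)\<^sup>2"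
    by (simp only: power_mult_distrib)
  then show "L2_norm (\<lambda>x. u x * g x) \<le> C * L2_norm u"
    by (rule power2_le_imp_le) (use C_pos in simp)
qed

text \<open>
  Bessel's inequality for \<open>(f - h) g\<close>.
\<close>

lemma sqrt_signal_le:
  assumes os: "orthonormal_system \<Lambda> e" and h: "h \<in> L2_space"
  shows "sqrt (signal \<Lambda> e h) \<le> C * L2_dist f h"
proof (rule real_le_lsqrt)
  note fh = L2_space_diff[OF f_L2 h]
  have "signal \<Lambda> e h \<le> (L2_norm (\<lambda>x. (f x - h x) * g x))\<^sup>2"
    unfolding signal_def true_coeff_def by (rule bessel[OF os L2_norm_weighted_le(2)[OF fh]])
  also have "\<dots> \<le> (C * L2_dist f h)\<^sup>2"
    unfolding L2_dist_def by (intro power_mono L2_norm_weighted_le(1)[OF fh]) simp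
  finally show "signal \<Lambda> e h \<le> (C * L2_dist f h)\<^sup>2" .
qed (use C_pos in auto)

text \<open>
  Let \<open>w\<close> be the projection of \<open>u = f - h\<close>.  Pairing \<open>u g\<close> with \<open>w\<close> gives at most
  \<open>\<parallel>w\<parallel> sqrt T\<close> by the Cauchy-Schwarz inequality for the coefficients, and at least
  \<open>c \<parallel>w\<parallel>\<^sup>2 - C \<parallel>u - w\<parallel> \<parallel>w\<parallel>\<close>, whatever the regularity of \<open>g\<close>.
\<close>

lemma dist_le_signal:
  assumes os: "orthonormal_system \<Lambda> e" and h: "h \<in> L2_space" and c1: "c \<le> 1" and C1: "1 \<le> C"
  shows "L2_dist f h \<le> 1 / c * (sqrt (signal \<Lambda> e h) +
    2 * C * (L2_dist f (os_proj \<Lambda> e f) + L2_dist h (os_proj \<Lambda> e h)))"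
proof -
  define u where "u = (\<lambda>x. f x - h x)"
  have u: "u \<in> L2_space" unfolding u_def by (rule L2_space_diff[OF f_L2 h])
  define w where "w = os_proj \<Lambda> e u"
  have w: "w \<in> L2_space" unfolding w_def by (rule os_proj_L2[OF os])
  have w_diff: "w x = os_proj \<Lambda> e f x - os_proj \<Lambda> e h x" for x
    unfolding w_def os_proj_def lincomb_def u_def sum_subtractf[symmetric]
    by (intro sum.cong refl) (simp add: L2_inner_diff_left f_L2 h os_L2[OF os] left_diff_distrib)
  define b where "b = L2_dist f (os_proj \<Lambda> e f) + L2_dist h (os_proj \<Lambda> e h)"
  have uw: "L2_norm (\<lambda>x. u x - w x) \<le> b"
  proof -
    have "(\<lambda>x. u x - w x) = (\<lambda>x. (f x - os_proj \<Lambda> e f x) + (os_proj \<Lambda> e h x - h x))"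
      by (simp add: u_def w_diff fun_eq_iff)
    then show ?thesis
      using L2_norm_triangle[OF L2_space_diff[OF f_L2 os_proj_L2[OF os, of f]] L2_space_diff[OF os_proj_L2[OF os, of h] h]]
      by (simp add: b_def L2_dist_def[symmetric] L2_dist_commute[of h])
  qed
  have main: "c * L2_norm w \<le> sqrt (signal \<Lambda> e h) + C * b"
  proof (cases "L2_norm w = 0")
    case True
    then show ?thesis using C_pos by (simp add: b_def)
  next
    case False
    then have wpos: "0 < L2_norm w" using L2_norm_nonneg[of w] by linarith
    have ug: "(\<lambda>x. u x * g x) \<in> L2_space" by (rule L2_norm_weighted_le(2)[OF u])
    have uwL: "(\<lambda>x. u x - w x) \<in> L2_space" by (rule L2_space_diff[OF u w])
    have wnorm: "(L2_norm w)\<^sup>2 = (\<Sum>k\<in>\<Lambda>. (L2_inner u (e k))\<^sup>2)"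
      unfolding w_def os_proj_def by (rule L2_norm_lincomb[OF os])
    have wg: "(\<lambda>x. w x * g x) \<in> L2_space" by (rule L2_norm_weighted_le(2)[OF w])
    have "L2_inner (\<lambda>x. u x * g x) w = (\<Sum>k\<in>\<Lambda>. L2_inner u (e k) * true_coeff e h k)"
      unfolding w_def os_proj_def by (subst L2_inner_lincomb[OF os ug]) (simp add: true_coeff_def u_def)
    also have "\<dots> \<le> sqrt (\<Sum>k\<in>\<Lambda>. (L2_inner u (e k))\<^sup>2) * sqrt (\<Sum>k\<in>\<Lambda>. (true_coeff e h k)\<^sup>2)"
      unfolding real_sqrt_mult[symmetric] by (rule real_le_rsqrt[OF Cauchy_Schwarz_ineq_sum])
    also have "\<dots> = L2_norm w * sqrt (signal \<Lambda> e h)"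
      unfolding wnorm[symmetric] signal_def by simp
    finally have up: "L2_inner (\<lambda>x. u x * g x) w \<le> L2_norm w * sqrt (signal \<Lambda> e h)" .
    have "L2_inner (\<lambda>x. u x * g x) w = (\<integral>x. g x * (w x)\<^sup>2 + (u x - w x) * (w x * g x) \<partial>cube_measure)"
      unfolding L2_inner_def by (intro Bochner_Integration.integral_cong) (auto simp: power2_eq_square algebra_simps)
    also have "\<dots> = (\<integral>x. g x * (w x)\<^sup>2 \<partial>cube_measure) + L2_inner (\<lambda>x. u x - w x) (\<lambda>x. w x * g x)"
      unfolding L2_inner_def
      by (rule Bochner_Integration.integral_add[OF g_weight_bounds(3)[OF w] integrable_mult[OF uwL wg]])
    also have "\<dots> \<ge> c * (L2_norm w)\<^sup>2 - b * (C * L2_norm w)"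
    proof -
      have "- L2_inner (\<lambda>x. u x - w x) (\<lambda>x. w x * g x) = L2_inner (\<lambda>x. w x * g x) (\<lambda>x. - 1 * (u x - w x))"
        unfolding L2_inner_scale by (simp add: L2_inner_commute)
      also have "\<dots> \<le> L2_norm (\<lambda>x. w x * g x) * L2_norm (\<lambda>x. - 1 * (u x - w x))"
        by (intro L2_Cauchy_Schwarz[OF wg] L2_space_scale uwL)
      also have "\<dots> \<le> (C * L2_norm w) * b"
        unfolding L2_norm_scale using uw C_pos by (intro mult_mono L2_norm_weighted_le(1)[OF w]) auto
      finally show ?thesis using g_weight_bounds(1)[OF w] by (simp add: mult_ac)
    qed
    finally have "c * (L2_norm w)\<^sup>2 - b * (C * L2_norm w) \<le> L2_norm w * sqrt (signal \<Lambda> e h)"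
      using up by simp
    then have "L2_norm w * (c * L2_norm w) \<le> L2_norm w * (sqrt (signal \<Lambda> e h) + C * b)"
      by (simp add: power2_eq_square algebra_simps)
    then show ?thesis using wpos by simp
  qed
  have "L2_dist f h = L2_norm (\<lambda>x. w x + (u x - w x))"
    by (simp add: L2_dist_def u_def)
  also have "\<dots> \<le> L2_norm w + L2_norm (\<lambda>x. u x - w x)"
    by (rule L2_norm_triangle[OF w L2_space_diff[OF u w]])
  also have "\<dots> \<le> L2_norm w + b" using uw by simp
  finally have "c * L2_dist f h \<le> c * L2_norm w + c * b"
    using c_pos by (simp add: distrib_left[symmetric])
  also have "c * b \<le> C * b"
    using c1 C1 by (intro mult_right_mono) (auto simp: b_def)
  finally have "c * L2_dist f h \<le> sqrt (signal \<Lambda> e h) + 2 * C * b"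
    using main by simp
  then show ?thesis
    using c_pos unfolding b_def by (simp add: field_simps)
qed

end

section \<open>Penalised least squares over a finite net\<close>

definition crit :: "nat \<Rightarrow> ('a \<Rightarrow> real) \<Rightarrow> real \<Rightarrow> (nat \<Rightarrow> 'a \<times> bool) \<Rightarrow> real" where
  "crit m h p \<omega> = (\<Sum>i<m. (residual h (\<omega> i))\<^sup>2) + p"

text \<open>
  Ties are broken by the index, which makes the minimiser measurable.
\<close>

definition selected ::
  "nat \<Rightarrow> nat \<Rightarrow> (nat \<Rightarrow> 'a \<Rightarrow> real) \<Rightarrow> (nat \<Rightarrow> real) \<Rightarrow> (nat \<Rightarrow> 'a \<times> bool) \<Rightarrow> nat" where
  "selected m K hs P \<omega> =
     (LEAST i. i < K \<and> (\<forall>j<K. crit m (hs i) (P i) \<omega> \<le> crit m (hs j) (P j) \<omega>))"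

lemma selected_minimal:
  assumes "0 < K"
  shows "selected m K hs P \<omega> < K"
    and "j < K \<Longrightarrow> crit m (hs (selected m K hs P \<omega>)) (P (selected m K hs P \<omega>)) \<omega> \<le> crit m (hs j) (P j) \<omega>"
proof -
  let ?c = "\<lambda>i. crit m (hs i) (P i) \<omega>"
  have "\<exists>i. i < K \<and> (\<forall>j<K. ?c i \<le> ?c j)"
    using arg_min_if_finite[of "{..<K}" ?c] assms by (auto simp: not_less intro!: exI[of _ "arg_min_on ?c {..<K}"])
  from LeastI_ex[OF this]
  show "selected m K hs P \<omega> < K" "j < K \<Longrightarrow> ?c (selected m K hs P \<omega>) \<le> ?c j"
    unfolding selected_def by blast+
qed

lemma selected_cong:
  assumes "\<And>i. i < m \<Longrightarrow> \<omega> i = \<omega>' i"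
  shows "selected m K hs P \<omega> = selected m K hs P \<omega>'"
proof -
  have "crit m h p \<omega> = crit m h p \<omega>'" for h p
    unfolding crit_def using assms by simp
  then show ?thesis unfolding selected_def by simp
qed

lemma crit_measurable:
  assumes [measurable]: "h \<in> borel_measurable cube_measure" and m: "m \<le> n"
  shows "crit m h p \<in> borel_measurable (sample_space n)"
proof -
  have [measurable]: "(\<lambda>\<omega>. \<omega> i) \<in> sample_space n \<rightarrow>\<^sub>M obs_space" if "i \<in> {..<m}" for i
    using m that by (intro sample_component_measurable) auto
  show ?thesis unfolding crit_def[abs_def] by measurable
qed

lemma selected_measurable:
  assumes hs: "\<And>i. i < K \<Longrightarrow> hs i \<in> borel_measurable cube_measure" and m: "m \<le> n"
  shows "selected m K hs P \<in> sample_space n \<rightarrow>\<^sub>M count_space UNIV"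
  unfolding selected_def[abs_def]
proof (rule measurable_Least)
  fix i
  show "(\<lambda>\<omega>. i < K \<and> (\<forall>j<K. crit m (hs i) (P i) \<omega> \<le> crit m (hs j) (P j) \<omega>)) \<in> sample_space n \<rightarrow>\<^sub>M count_space UNIV"
  proof (cases "i < K")
    case True
    have cm: "crit m (hs j) (P j) \<in> borel_measurable (sample_space n)" if "j < K" for j
      using hs[OF that] m by (rule crit_measurable)
    have "(\<lambda>\<omega>. \<forall>j\<in>{..<K}. crit m (hs i) (P i) \<omega> \<le> crit m (hs j) (P j) \<omega>) \<in> sample_space n \<rightarrow>\<^sub>M count_space UNIV"
    proof (rule pred_intros_finite(3))
      fix j assume "j \<in> {..<K}"
      then have "{\<omega> \<in> space (sample_space n). crit m (hs i) (P i) \<omega> \<le> crit m (hs j) (P j) \<omega>} \<in> sets (sample_space n)"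
        using borel_measurable_le[OF cm[OF True] cm[of j]] by simp
      then show "(\<lambda>\<omega>. crit m (hs i) (P i) \<omega> \<le> crit m (hs j) (P j) \<omega>) \<in> sample_space n \<rightarrow>\<^sub>M count_space UNIV"
        by (simp only: pred_def)
    qed simp
    moreover have "(\<lambda>\<omega>. i < K \<and> (\<forall>j<K. crit m (hs i) (P i) \<omega> \<le> crit m (hs j) (P j) \<omega>))
        = (\<lambda>\<omega>. \<forall>j\<in>{..<K}. crit m (hs i) (P i) \<omega> \<le> crit m (hs j) (P j) \<omega>)"
      using True by (intro ext) blast
    ultimately show ?thesis by (simp only:)
  qed simp
qed

lemma exp_le_quadratic:
  fixes x :: real
  assumes "\<bar>x\<bar> \<le> 1"
  shows "exp x \<le> 1 + x + x\<^sup>2"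
proof (cases "0 \<le> x")
  case True
  then show ?thesis using exp_bound[of x] assms by simp
next
  case False
  define y where "y = - x"
  have y: "0 \<le> y" "y \<le> 1" using False assms by (auto simp: y_def)
  have "1 + y + y\<^sup>2 / 2 \<le> exp y" using exp_lower_Taylor_quadratic[OF y(1)] by simp
  moreover have "0 \<le> 1 - y + y\<^sup>2" using y by simp
  ultimately have "(1 - y + y\<^sup>2) * (1 + y + y\<^sup>2 / 2) \<le> (1 - y + y\<^sup>2) * exp y"
    by (rule mult_left_mono)
  moreover have "(1 - y + y\<^sup>2) * (1 + y + y\<^sup>2 / 2) = 1 + y\<^sup>2 / 2 + y^3 / 2 + y^4 / 2"
    by (simp add: power2_eq_square power3_eq_cube power4_eq_xxxx field_simps)
  moreover have "0 \<le> y\<^sup>2 / 2 + y^3 / 2 + y^4 / 2" using y by simp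
  ultimately have "1 \<le> (1 - y + y\<^sup>2) * exp y" by linarith
  then have "exp (- y) \<le> 1 - y + y\<^sup>2"
    by (simp add: exp_minus divide_simps mult.commute)
  then show ?thesis by (simp add: y_def)
qed

text \<open>
  Here \<open>a\<close> is the success probability and \<open>p\<close>, \<open>q\<close> are two predictions.  The difference of their
  squared losses has mean \<open>(a - p)\<^sup>2 - (a - q)\<^sup>2\<close> and second moment at most \<open>4 (p - q)\<^sup>2\<close>.  At the
  exponent \<open>1 / 16\<close> the quadratic term of the exponential costs only half of the linear gain.
\<close>

lemma loss_exponential_moment:
  fixes a p q :: real
  assumes "0 \<le> a" "a \<le> 1" "0 \<le> p" "p \<le> 1" "0 \<le> q" "q \<le> 1"
  shows "a * exp (((1 - q)\<^sup>2 - (1 - p)\<^sup>2) / 16) + (1 - a) * exp ((q\<^sup>2 - p\<^sup>2) / 16)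
    \<le> 1 - (a - p)\<^sup>2 / 32 + 3 * (a - q)\<^sup>2 / 32"
proof -
  define s where "s = (p - q) / 16"
  define x1 x0 where "x1 = s * (2 - p - q)" and "x0 = - (s * (p + q))"
  have s: "\<bar>s\<bar> \<le> 1 / 16" using assms by (auto simp: s_def abs_le_iff)
  have b: "\<bar>2 - p - q\<bar> \<le> 2" "\<bar>p + q\<bar> \<le> 2" using assms by auto
  have "\<bar>x1\<bar> \<le> 1/16 * 2" "\<bar>x0\<bar> \<le> 1/16 * 2"
    unfolding x1_def x0_def abs_minus_cancel abs_mult by (intro mult_mono s b; simp)+
  then have e: "exp x1 \<le> 1 + x1 + x1\<^sup>2" "exp x0 \<le> 1 + x0 + x0\<^sup>2"
    by (intro exp_le_quadratic; simp)+
  have "(2 - p - q)\<^sup>2 \<le> 2\<^sup>2" "(p + q)\<^sup>2 \<le> 2\<^sup>2"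
    using b by (simp_all only: abs_le_square_iff[symmetric] abs_numeral)
  then have q2: "x1\<^sup>2 \<le> 4 * s\<^sup>2" "x0\<^sup>2 \<le> 4 * s\<^sup>2"
    unfolding x1_def x0_def power2_minus power_mult_distrib
    by (simp_all add: mult.commute[of 4] mult_left_mono)
  have "a * exp x1 + (1 - a) * exp x0 \<le> a * (1 + x1 + 4 * s\<^sup>2) + (1 - a) * (1 + x0 + 4 * s\<^sup>2)"
    using e q2 assms by (intro add_mono mult_left_mono) auto
  also have "\<dots> = 1 - ((a - p)\<^sup>2 - (a - q)\<^sup>2) / 16 + (p - q)\<^sup>2 / 64"
    unfolding x1_def x0_def s_def by (simp add: power2_eq_square field_simps)
  also have "(p - q)\<^sup>2 \<le> 2 * ((a - p)\<^sup>2 + (a - q)\<^sup>2)"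
    using zero_le_power2[of "(a - p) + (a - q)"] by (simp add: power2_eq_square algebra_simps)
  finally have "a * exp x1 + (1 - a) * exp x0 \<le> 1 - (a - p)\<^sup>2 / 32 + 3 * (a - q)\<^sup>2 / 32"
    by (simp add: field_simps)
  moreover have "x1 = ((1 - q)\<^sup>2 - (1 - p)\<^sup>2) / 16" "x0 = (q\<^sup>2 - p\<^sup>2) / 16"
    unfolding x1_def x0_def s_def by (simp_all add: power2_eq_square field_simps)
  ultimately show ?thesis by simp
qed

context binary_regression
begin

lemma chernoff_single:
  assumes [measurable]: "h \<in> borel_measurable cube_measure" "h' \<in> borel_measurable cube_measure"
    and h: "\<And>x. 0 \<le> h x" "\<And>x. h x \<le> 1" and h': "\<And>x. 0 \<le> h' x" "\<And>x. h' x \<le> 1"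
  shows "(\<integral>\<^sup>+z. ennreal (exp (((residual h' z)\<^sup>2 - (residual h z)\<^sup>2) / 16)) \<partial>obs_law f g)
    \<le> ennreal (exp (- (c / 32) * (L2_dist f h)\<^sup>2 + 3 * C / 32 * (L2_dist f h')\<^sup>2))"
proof -
  have hL: "h \<in> L2_space" "h' \<in> L2_space"
    using h h' by (auto intro!: L2_space_bounded[where B = 1])
  note d = L2_space_diff[OF f_L2 hL(1)] L2_space_diff[OF f_L2 hL(2)]
  let ?r = "\<lambda>x. g x * (1 - (f x - h x)\<^sup>2 / 32 + 3 * (f x - h' x)\<^sup>2 / 32)"
  have pw: "f x * exp (((1 - h' x)\<^sup>2 - (1 - h x)\<^sup>2) / 16) + (1 - f x) * exp (((h' x)\<^sup>2 - (h x)\<^sup>2) / 16)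
      \<le> 1 - (f x - h x)\<^sup>2 / 32 + 3 * (f x - h' x)\<^sup>2 / 32" for x
    using f_range h h' by (intro loss_exponential_moment) auto
  have r_eq: "?r x = g x - 1 / 32 * (g x * (f x - h x)\<^sup>2) + 3 / 32 * (g x * (f x - h' x)\<^sup>2)" for x
    by (simp add: algebra_simps)
  note gi = g_weight_bounds[OF d(1)] g_weight_bounds[OF d(2)]
  have r_int: "integrable cube_measure ?r"
    unfolding r_eq using g_integrable gi(3,6)
    by (intro Bochner_Integration.integrable_add Bochner_Integration.integrable_diff integrable_mult_right) auto
  have r_nn: "0 \<le> ?r x" for x
  proof -
    have "0 \<le> f x * exp (((1 - h' x)\<^sup>2 - (1 - h x)\<^sup>2) / 16) + (1 - f x) * exp (((h' x)\<^sup>2 - (h x)\<^sup>2) / 16)"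
      using f_range[of x] by auto
    then show ?thesis using pw[of x] by (intro mult_nonneg_nonneg) auto
  qed
  have "(\<integral>\<^sup>+z. ennreal (exp (((residual h' z)\<^sup>2 - (residual h z)\<^sup>2) / 16)) \<partial>obs_law f g)
      = (\<integral>\<^sup>+x. ennreal (g x * (f x * exp (((1 - h' x)\<^sup>2 - (1 - h x)\<^sup>2) / 16)
           + (1 - f x) * exp (((h' x)\<^sup>2 - (h x)\<^sup>2) / 16))) \<partial>cube_measure)"
    using f_range
    by (subst nn_integral_obs_law, measurable)
       (intro nn_integral_cong, simp add: residual_def ennreal_mult)
  also have "\<dots> \<le> (\<integral>\<^sup>+x. ennreal (?r x) \<partial>cube_measure)"
    using pw by (intro nn_integral_mono ennreal_leI mult_left_mono) auto
  also have "\<dots> = ennreal (\<integral>x. ?r x \<partial>cube_measure)"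
    using r_int r_nn by (intro nn_integral_eq_integral) auto
  also have "(\<integral>x. ?r x \<partial>cube_measure) = 1 - 1 / 32 * (\<integral>x. g x * (f x - h x)\<^sup>2 \<partial>cube_measure)
      + 3 / 32 * (\<integral>x. g x * (f x - h' x)\<^sup>2 \<partial>cube_measure)"
    unfolding r_eq using g_integrable gi(3,6) g_integral by simp
  also have "\<dots> \<le> 1 + (- (c / 32) * (L2_dist f h)\<^sup>2 + 3 * C / 32 * (L2_dist f h')\<^sup>2)"
    using gi(1,5) by (simp add: L2_dist_def)
  also have "\<dots> \<le> exp (- (c / 32) * (L2_dist f h)\<^sup>2 + 3 * C / 32 * (L2_dist f h')\<^sup>2)"
    by (rule exp_ge_add_one_self)
  finally show ?thesis by (simp add: ennreal_leI)
qed

text \<open>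
  The probability that \<open>h\<close> beats a reference \<open>h'\<close> decays exponentially in \<open>m \<parallel>f - h\<parallel>\<^sup>2\<close>; the variance of
  the loss difference is itself controlled by the squared distances, so the decay is not slowed down
  when the distances are small.
\<close>

lemma chernoff_sample:
  assumes hm [measurable]: "h \<in> borel_measurable cube_measure" "h' \<in> borel_measurable cube_measure"
    and h: "\<And>x. 0 \<le> h x" "\<And>x. h x \<le> 1" and h': "\<And>x. 0 \<le> h' x" "\<And>x. h' x \<le> 1" and m: "m \<le> n"
  shows "emeasure (sample_law n f g) {\<omega> \<in> space (sample_space n). crit m h p \<omega> \<le> crit m h' p' \<omega>}
    \<le> ennreal (exp ((p' - p) / 16 + real m * (- (c / 32) * (L2_dist f h)\<^sup>2 + 3 * C / 32 * (L2_dist f h')\<^sup>2)))"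
    (is "emeasure ?P ?E \<le> _")
proof -
  let ?F = "\<lambda>z. ennreal (exp (((residual h' z)\<^sup>2 - (residual h z)\<^sup>2) / 16))"
  let ?b = "- (c / 32) * (L2_dist f h)\<^sup>2 + 3 * C / 32 * (L2_dist f h')\<^sup>2"
  have [measurable]: "crit m h p \<in> borel_measurable (sample_space n)" "crit m h' p' \<in> borel_measurable (sample_space n)"
    by (intro crit_measurable hm m)+
  have prod_eq: "ennreal (exp ((crit m h' p' \<omega> - crit m h p \<omega>) / 16))
      = ennreal (exp ((p' - p) / 16)) * (\<Prod>i\<in>{..<n}. if i < m then ?F (\<omega> i) else 1)" for \<omega>
  proof -
    have "(crit m h' p' \<omega> - crit m h p \<omega>) / 16
        = (p' - p) / 16 + (\<Sum>i<m. ((residual h' (\<omega> i))\<^sup>2 - (residual h (\<omega> i))\<^sup>2) / 16)"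
      by (simp add: crit_def sum_subtractf sum_divide_distrib[symmetric] diff_divide_distrib add_divide_distrib)
    then have "ennreal (exp ((crit m h' p' \<omega> - crit m h p \<omega>) / 16))
        = ennreal (exp ((p' - p) / 16)) * (\<Prod>i<m. ?F (\<omega> i))"
      by (simp only: exp_add exp_sum[OF finite_lessThan]) (simp add: ennreal_mult prod_ennreal prod_nonneg)
    also have "(\<Prod>i<m. ?F (\<omega> i)) = (\<Prod>i\<in>{..<n}. if i < m then ?F (\<omega> i) else 1)"
      using m by (intro prod.mono_neutral_cong_left) auto
    finally show ?thesis .
  qed
  have [measurable]: "(\<lambda>\<omega>. \<Prod>i\<in>{..<n}. if i < m then ?F (\<omega> i) else 1) \<in> borel_measurable (sample_space n)"
  proof (rule borel_measurable_prod_ennreal)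
    fix i assume "i \<in> {..<n}"
    then have [measurable]: "(\<lambda>\<omega>. \<omega> i) \<in> sample_space n \<rightarrow>\<^sub>M obs_space"
      by (intro sample_component_measurable) auto
    show "(\<lambda>\<omega>. if i < m then ?F (\<omega> i) else 1) \<in> borel_measurable (sample_space n)"
      by measurable
  qed
  have "emeasure ?P ?E = (\<integral>\<^sup>+\<omega>. indicator ?E \<omega> \<partial>?P)"
    by (intro nn_integral_indicator[symmetric]) simp
  also have "\<dots> \<le> (\<integral>\<^sup>+\<omega>. ennreal (exp ((crit m h' p' \<omega> - crit m h p \<omega>) / 16)) \<partial>?P)"
    by (intro nn_integral_mono) (auto simp: indicator_def ennreal_ge_1)
  also have "\<dots> = ennreal (exp ((p' - p) / 16)) * (\<integral>\<^sup>+\<omega>. (\<Prod>i\<in>{..<n}. if i < m then ?F (\<omega> i) else 1) \<partial>?P)"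
    unfolding prod_eq by (rule nn_integral_cmult) simp
  also have "(\<integral>\<^sup>+\<omega>. (\<Prod>i\<in>{..<n}. if i < m then ?F (\<omega> i) else 1) \<partial>?P)
      = (\<Prod>i\<in>{..<n}. \<integral>\<^sup>+z. (if i < m then ?F z else 1) \<partial>obs_law f g)"
    unfolding sample_law_def by (rule sample.product_nn_integral_prod) (auto, measurable)
  also have "\<dots> = (\<Prod>i\<in>{..<n}. if i < m then (\<integral>\<^sup>+z. ?F z \<partial>obs_law f g) else 1)"
    using sample.M.emeasure_space_1 by (intro prod.cong) auto
  also have "\<dots> = (\<Prod>i<m. \<integral>\<^sup>+z. ?F z \<partial>obs_law f g)"
    using m by (intro prod.mono_neutral_cong_right) auto
  also have "\<dots> \<le> (\<Prod>i<m. ennreal (exp ?b))"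
    using chernoff_single[OF hm h h'] by (intro prod_mono_ennreal) auto
  also have "\<dots> = ennreal (exp (real m * ?b))"
    by (simp add: ennreal_power exp_of_nat_mult)
  finally show ?thesis
    by (simp add: exp_add ennreal_mult mult_left_mono)
qed

lemma selection_tail:
  assumes hs: "\<And>i. i < K \<Longrightarrow> hs i \<in> borel_measurable cube_measure"
      "\<And>i x. i < K \<Longrightarrow> 0 \<le> hs i x" "\<And>i x. i < K \<Longrightarrow> hs i x \<le> 1"
    and m: "m \<le> n" and j: "j < K"
  shows "emeasure (sample_law n f g)
       {\<omega> \<in> space (sample_space n). R < (L2_dist f (hs (selected m K hs P \<omega>)))\<^sup>2}
    \<le> (\<Sum>i\<in>{i\<in>{..<K}. R < (L2_dist f (hs i))\<^sup>2}. ennreal (exp ((P j - P i) / 16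
         + real m * (- (c / 32) * (L2_dist f (hs i))\<^sup>2 + 3 * C / 32 * (L2_dist f (hs j))\<^sup>2))))"
    (is "emeasure ?P ?E \<le> (\<Sum>i\<in>?I. ?b i)")
proof -
  let ?A = "\<lambda>i. {\<omega> \<in> space (sample_space n). crit m (hs i) (P i) \<omega> \<le> crit m (hs j) (P j) \<omega>}"
  have Ameas: "?A i \<in> sets (sample_space n)" if "i < K" for i
  proof -
    have [measurable]: "crit m (hs i) (P i) \<in> borel_measurable (sample_space n)"
        "crit m (hs j) (P j) \<in> borel_measurable (sample_space n)"
      using hs(1) j that m by (auto intro!: crit_measurable)
    show ?thesis by measurable
  qed
  have K: "0 < K" using j by simp
  have "?E \<subseteq> (\<Union>i\<in>?I. ?A i)"
    using selected_minimal[OF K, where m = m and hs = hs and P = P] j by auto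
  then have "emeasure ?P ?E \<le> emeasure ?P (\<Union>i\<in>?I. ?A i)"
    using Ameas by (intro emeasure_mono) auto
  also have "\<dots> \<le> (\<Sum>i\<in>?I. emeasure ?P (?A i))"
    using Ameas by (intro emeasure_subadditive_finite) auto
  also have "\<dots> \<le> (\<Sum>i\<in>?I. ?b i)"
    using hs j m by (intro sum_mono chernoff_sample) auto
  finally show ?thesis .
qed

end

section \<open>The net\<close>

text \<open>
  Uniformity in the centre \<open>x\<close> is the point: in several dimensions the bound becomes a power of
  \<open>exp \<tau>\<close>, which takes the place of a covering number in \<open>net_estimator\<close>.
\<close>

lemma gaussian_lattice_sum:
  fixes a :: real
  assumes a: "0 < a"
  shows "\<exists>\<tau>\<ge>0. \<forall>F :: int set. \<forall>x. finite F \<longrightarrow> (\<Sum>p\<in>F. exp (- a * (of_int p - x)\<^sup>2)) \<le> exp \<tau>"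
proof -
  define q where "q = exp (- a)"
  have q: "0 < q" "q < 1" using a by (auto simp: q_def)
  have geo: "(\<Sum>n\<in>N. q ^ n) \<le> 1 / (1 - q)" if "finite N" for N
    using sum_le_suminf[of "\<lambda>n. q ^ n" N] that q by (simp add: suminf_geometric)
  define B where "B = exp (2 * a) * (2 / (1 - q))"
  have B1: "1 \<le> B"
  proof -
    have "1 * 1 \<le> B" unfolding B_def using a q by (intro mult_mono) (auto simp: field_simps)
    then show ?thesis by simp
  qed
  have main: "(\<Sum>p\<in>F. exp (- a * (of_int p - x)\<^sup>2)) \<le> B" if F: "finite F" for F :: "int set" and x
  proof -
    define k where "k = \<lfloor>x\<rfloor>"
    have x: "of_int k \<le> x" "x < of_int k + 1" unfolding k_def by linarith+
    have summand: "exp (- a * (of_int p - x)\<^sup>2) \<le> exp (2 * a) * q ^ nat \<bar>p - k\<bar>" for p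
    proof -
      define y where "y = real_of_int \<bar>p - k\<bar>"
      have y0: "0 \<le> y" by (simp add: y_def)
      have yx: "y - 1 \<le> \<bar>of_int p - x\<bar>" unfolding y_def using x by (auto simp: abs_if)
      have "y - 2 \<le> (of_int p - x)\<^sup>2"
      proof (cases "y \<le> 1")
        case True
        then show ?thesis using zero_le_power2[of "of_int p - x"] by linarith
      next
        case False
        then have "(y - 1)\<^sup>2 \<le> (of_int p - x)\<^sup>2"
          using power_mono[OF yx, of 2] by simp
        moreover have "y - 2 \<le> (y - 1)\<^sup>2"
          using zero_le_power2[of "y - 3/2"] by (simp add: power2_eq_square field_simps)
        ultimately show ?thesis by linarith
      qed
      then have "- a * (of_int p - x)\<^sup>2 \<le> 2 * a + y * (- a)"
        using mult_left_mono[of "y - 2" "(of_int p - x)\<^sup>2" a] a by (simp add: algebra_simps)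
      then have "exp (- a * (of_int p - x)\<^sup>2) \<le> exp (2 * a) * exp (y * (- a))"
        by (simp only: exp_add[symmetric] exp_le_cancel_iff)
      also have "y = real (nat \<bar>p - k\<bar>)" by (simp add: y_def)
      also have "exp (real (nat \<bar>p - k\<bar>) * (- a)) = q ^ nat \<bar>p - k\<bar>"
        unfolding q_def by (rule exp_of_nat_mult)
      finally show ?thesis .
    qed
    have half: "(\<Sum>p\<in>G. q ^ nat \<bar>p - k\<bar>) \<le> 1 / (1 - q)"
      if "finite G" "inj_on (\<lambda>p. nat \<bar>p - k\<bar>) G" for G
      using geo[OF finite_imageI[OF that(1)], of "\<lambda>p. nat \<bar>p - k\<bar>"] by (simp add: sum.reindex[OF that(2)])
    have "(\<Sum>p\<in>F. exp (- a * (of_int p - x)\<^sup>2)) \<le> (\<Sum>p\<in>F. exp (2 * a) * q ^ nat \<bar>p - k\<bar>)"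
      by (intro sum_mono summand)
    also have "\<dots> = exp (2 * a) * (\<Sum>p\<in>{p\<in>F. k \<le> p} \<union> {p\<in>F. p < k}. q ^ nat \<bar>p - k\<bar>)"
      unfolding sum_distrib_left by (intro sum.cong) auto
    also have "\<dots> = exp (2 * a) * ((\<Sum>p\<in>{p\<in>F. k \<le> p}. q ^ nat \<bar>p - k\<bar>) + (\<Sum>p\<in>{p\<in>F. p < k}. q ^ nat \<bar>p - k\<bar>))"
      using F by (subst sum.union_disjoint) auto
    also have "\<dots> \<le> exp (2 * a) * (1 / (1 - q) + 1 / (1 - q))"
      using F by (intro mult_left_mono add_mono half) (auto simp: inj_on_def)
    finally show ?thesis by (simp add: B_def)
  qed
  show ?thesis
    using main B1 by (intro exI[of _ "ln B"]) auto
qed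

text \<open>
  At mesh \<open>1 / sqrt m\<close> rounding costs at most \<open>card \<Lambda> / m\<close> in squared distance, the order of the
  variance of a least squares fit with \<open>card \<Lambda>\<close> coefficients.
\<close>

definition grid_point :: "nat \<Rightarrow> 'k set \<Rightarrow> ('k \<Rightarrow> 'a \<Rightarrow> real) \<Rightarrow> ('k \<Rightarrow> int) \<Rightarrow> 'a \<Rightarrow> real" where
  "grid_point m \<Lambda> e p = lincomb \<Lambda> e (\<lambda>k. of_int (p k) / sqrt (real m))"

lemma grid_point_near_projection:
  assumes os: "orthonormal_system \<Lambda> e" and f: "f \<in> L2_space" and f1: "L2_norm f \<le> 1" and m: "1 \<le> m"
  obtains p where "p \<in> PiE \<Lambda> (\<lambda>_. {- int (m + 1)..int (m + 1)})"
    and "(L2_dist f (grid_point m \<Lambda> e p))\<^sup>2 \<le> (L2_dist f (os_proj \<Lambda> e f))\<^sup>2 + real (card \<Lambda>) / real m"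
proof
  let ?x = "\<lambda>k. sqrt (real m) * L2_inner f (e k)"
  define p where "p = restrict (\<lambda>k. \<lfloor>?x k\<rfloor>) \<Lambda>"
  have sm: "0 < sqrt (real m)" "sqrt (real m) \<le> real m"
    using m by (auto intro!: real_le_lsqrt simp: power2_eq_square)
  have ek: "L2_norm (e k) = 1" if "k \<in> \<Lambda>" for k
    using os that L2_norm_square[of "e k"] unfolding orthonormal_system_def
    by (metis L2_norm_nonneg power2_eq_1_iff zero_le_one neg_0_le_iff_le not_one_le_zero)
  have coef: "\<bar>L2_inner f (e k)\<bar> \<le> 1" if k: "k \<in> \<Lambda>" for k
  proof -
    have "L2_inner f (e k) \<le> 1"
      using L2_Cauchy_Schwarz[OF f os_L2[OF os k]] ek[OF k] f1 by simp
    moreover have "- L2_inner f (e k) \<le> 1"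
      using L2_Cauchy_Schwarz[OF f L2_space_scale[OF os_L2[OF os k], of "-1"]] ek[OF k] f1
      by (simp only: L2_inner_scale L2_norm_scale)
    ultimately show ?thesis by linarith
  qed
  have "\<bar>?x k\<bar> \<le> real m" if "k \<in> \<Lambda>" for k
    using mult_mono[OF sm(2) coef[OF that]] by (simp add: abs_mult)
  then show "p \<in> PiE \<Lambda> (\<lambda>_. {- int (m + 1)..int (m + 1)})"
    unfolding p_def by (auto simp: abs_le_iff le_floor_iff floor_le_iff; smt (verit) of_int_of_nat_eq)
  have "(L2_dist f (grid_point m \<Lambda> e p))\<^sup>2
      = (L2_dist f (os_proj \<Lambda> e f))\<^sup>2 + (\<Sum>k\<in>\<Lambda>. (of_int (p k) / sqrt (real m) - L2_inner f (e k))\<^sup>2)"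
    unfolding grid_point_def by (rule pythagoras[OF os f])
  also have "(\<Sum>k\<in>\<Lambda>. (of_int (p k) / sqrt (real m) - L2_inner f (e k))\<^sup>2) \<le> (\<Sum>k\<in>\<Lambda>. 1 / real m)"
  proof (rule sum_mono)
    fix k assume k: "k \<in> \<Lambda>"
    have "of_int (p k) / sqrt (real m) - L2_inner f (e k) = (of_int \<lfloor>?x k\<rfloor> - ?x k) / sqrt (real m)"
      using k sm by (simp add: p_def field_simps)
    moreover have "(of_int \<lfloor>?x k\<rfloor> - ?x k)\<^sup>2 \<le> 1\<^sup>2"
      by (simp only: abs_le_square_iff[symmetric]) linarith
    ultimately show "(of_int (p k) / sqrt (real m) - L2_inner f (e k))\<^sup>2 \<le> 1 / real m"
      using m by (simp add: power_divide divide_right_mono)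
  qed
  finally show "(L2_dist f (grid_point m \<Lambda> e p))\<^sup>2 \<le> (L2_dist f (os_proj \<Lambda> e f))\<^sup>2 + real (card \<Lambda>) / real m"
    by simp
qed

text \<open>
  One choice of candidates \<open>hs\<close> and penalties \<open>P\<close> serves every model \<open>k\<close> whose squared bias is at most
  \<open>b\<close> times its variance \<open>card (\<Lambda> k) / m\<close>; this is adaptation to the unknown best model.
\<close>

definition net_risk_bound ::
  "nat \<Rightarrow> nat set \<Rightarrow> (nat \<Rightarrow> 'k set) \<Rightarrow> (nat \<Rightarrow> 'k \<Rightarrow> real ^ 'n::finite \<Rightarrow> real) \<Rightarrow> (real ^ 'n \<Rightarrow> real) set \<Rightarrow>
   real \<Rightarrow> real \<Rightarrow> real \<Rightarrow> real \<Rightarrow> real \<Rightarrow> nat \<Rightarrow> (nat \<Rightarrow> real ^ 'n \<Rightarrow> real) \<Rightarrow> (nat \<Rightarrow> real) \<Rightarrow> bool" where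
  "net_risk_bound m Mods \<Lambda> e H c C b \<delta> A K hs P \<longleftrightarrow>
     (\<forall>f g n k. binary_regression f g c C \<longrightarrow> m \<le> n \<longrightarrow> f \<in> H \<longrightarrow> k \<in> Mods \<longrightarrow>
        (L2_dist f (os_proj (\<Lambda> k) (e k) f))\<^sup>2 \<le> b * real (card (\<Lambda> k)) / real m \<longrightarrow>
        emeasure (sample_law n f g) {\<omega> \<in> space (sample_space n).
          A * real (card (\<Lambda> k)) / real m < (L2_dist f (hs (selected m K hs P \<omega>)))\<^sup>2} \<le> ennreal \<delta>)"

text \<open>
  The candidates are elements of \<open>H\<close> close to grid points of the models, and the penalty of a candidate
  is proportional to the dimension \<open>D\<^sub>k\<close> of its model.  By \<open>selection_tail\<close> the probability of a wrong choice is
  bounded by a sum of terms that are Gaussian in the distance from \<open>f\<close> to the grid point.  Along each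
  coordinate the grid sum is at most \<open>exp \<tau>\<close>, so a whole model contributes at most \<open>exp (\<tau> D\<^sub>k)\<close>
  times the penalty factor, and the penalty is chosen to turn this into \<open>exp (- D\<^sub>k)\<close>.  Summing
  Gaussian weights instead of counting candidates avoids a logarithmic loss.
\<close>

theorem net_estimator:
  fixes c C b \<delta> :: real
  assumes c: "0 < c" and C: "1 \<le> C" and b: "0 \<le> b" and \<delta>: "0 < \<delta>"
  shows "\<exists>A>0. \<forall>m\<ge>1. \<forall>(Mods :: nat set) (\<Lambda> :: nat \<Rightarrow> 'k set) (e :: nat \<Rightarrow> 'k \<Rightarrow> real ^ 'n::finite \<Rightarrow> real) H.
    finite Mods \<longrightarrow> Mods \<noteq> {} \<longrightarrow>
    (\<forall>k\<in>Mods. orthonormal_system (\<Lambda> k) (e k) \<and> \<Lambda> k \<noteq> {}) \<longrightarrow>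
    (\<Sum>k\<in>Mods. exp (- real (card (\<Lambda> k)))) \<le> 1 \<longrightarrow>
    (\<forall>h\<in>H. h \<in> borel_measurable cube_measure \<and> (\<forall>x. 0 \<le> h x \<and> h x \<le> 1)) \<longrightarrow> (\<lambda>_. 0) \<in> H \<longrightarrow>
    (\<exists>K hs P. 0 < K \<and> (\<forall>i. hs i \<in> H) \<and> net_risk_bound m Mods \<Lambda> e H c C b \<delta> A K hs P)"
proof -
  obtain \<tau> where \<tau>: "0 \<le> \<tau>" "\<And>(F :: int set) x. finite F \<Longrightarrow> (\<Sum>p\<in>F. exp (- (c / 128) * (of_int p - x)\<^sup>2)) \<le> exp \<tau>"
    using gaussian_lattice_sum[of "c / 128"] c by auto
  (* a bounds the squared distance, in units of D_k / m, from f to the nearest grid point; pen is the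
     penalty per dimension and A the risk constant that absorbs all terms linear in D_k. *)
  define a where "a = b + 1"
  define pen where "pen = 16 * (c * a / 64 + \<tau> + 1)"
  define A where "A = 64 / c * (pen / 16 + 3 * C * a / 8 + \<bar>ln \<delta>\<bar>)"
  have a1: "1 \<le> a" using b by (simp add: a_def)
  have pen0: "0 < pen" unfolding pen_def using c a1 \<tau>(1) by (simp add: add_nonneg_pos)
  have A0: "0 < A" unfolding A_def using c C a1 pen0
    by (intro mult_pos_pos divide_pos_pos add_pos_nonneg) auto
  show ?thesis
  proof (intro exI[of _ A] conjI A0 allI impI)
    fix m :: nat and Mods :: "nat set" and \<Lambda> :: "nat \<Rightarrow> 'k set" and e :: "nat \<Rightarrow> 'k \<Rightarrow> real ^ 'n \<Rightarrow> real"
      and H :: "(real ^ 'n \<Rightarrow> real) set"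
    assume m: "1 \<le> m" and Mods: "finite Mods" "Mods \<noteq> {}"
      and os: "\<forall>k\<in>Mods. orthonormal_system (\<Lambda> k) (e k) \<and> \<Lambda> k \<noteq> {}"
      and sumD: "(\<Sum>k\<in>Mods. exp (- real (card (\<Lambda> k)))) \<le> 1"
      and H: "\<forall>h\<in>H. h \<in> borel_measurable cube_measure \<and> (\<forall>x. 0 \<le> h x \<and> h x \<le> 1)"
      and H0: "(\<lambda>_. 0) \<in> H"
    have fin: "finite (\<Lambda> k)" if "k \<in> Mods" for k using os that os_finite by blast
    have m0: "0 < real m" using m by simp
    define box where "box k = PiE (\<Lambda> k) (\<lambda>_. {- int (m + 1)..int (m + 1)})" for k
    define D where "D k = real (card (\<Lambda> k))" for k
    define u where "u kp = grid_point m (\<Lambda> (fst kp)) (e (fst kp)) (snd kp)" for kp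
    (* Candidates have to lie in H, so each grid point is represented by a nearby element of H, if any. *)
    define near where "near kp h \<longleftrightarrow> h \<in> H \<and> (L2_dist h (u kp))\<^sup>2 \<le> a * D (fst kp) / real m" for kp h
    define Net where "Net = {kp \<in> Sigma Mods box. \<exists>h. near kp h}"
    define sel where "sel kp = (SOME h. near kp h)" for kp
    have fin_box: "finite (box k)" if "k \<in> Mods" for k
      unfolding box_def using fin[OF that] by (intro finite_PiE) auto
    have fin_Sig: "finite (Sigma Mods box)" using Mods fin_box by (intro finite_SigmaI) auto
    then have fin_Net: "finite Net" unfolding Net_def by auto
    have sel: "near kp (sel kp)" if "kp \<in> Net" for kp
    proof -
      have "\<exists>h. near kp h" using that by (simp add: Net_def)
      then obtain h where "near kp h" by blast
      then show ?thesis unfolding sel_def by (rule someI[of "near kp"])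
    qed
    have HL: "h \<in> L2_space" "L2_norm h \<le> 1" if "h \<in> H" for h
    proof -
      show 1: "h \<in> L2_space" using H that by (intro L2_space_bounded[where B = 1]) auto
      have "L2_dist h (\<lambda>_. 0) \<le> 1"
        using H that by (intro L2_dist_le_const 1) auto
      then show "L2_norm h \<le> 1" by (simp add: L2_dist_def)
    qed
    have uL: "u kp \<in> L2_space" if "fst kp \<in> Mods" for kp
      unfolding u_def grid_point_def using os that by (intro lincomb_L2) auto
    have good: "\<exists>p. (k, p) \<in> Net \<and> (L2_dist f (u (k, p)))\<^sup>2 \<le> a * D k / real m"
      if k: "k \<in> Mods" and f: "f \<in> H" and bias: "(L2_dist f (os_proj (\<Lambda> k) (e k) f))\<^sup>2 \<le> b * D k / real m" for k f
    proof -
      obtain p where p: "p \<in> box k"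
        "(L2_dist f (u (k, p)))\<^sup>2 \<le> (L2_dist f (os_proj (\<Lambda> k) (e k) f))\<^sup>2 + real (card (\<Lambda> k)) / real m"
        using grid_point_near_projection[of "\<Lambda> k" "e k" f m] os k HL[OF f] m
        unfolding box_def u_def by auto
      then have le: "(L2_dist f (u (k, p)))\<^sup>2 \<le> a * D k / real m"
        using bias by (simp add: a_def D_def add_divide_distrib distrib_right)
      then have "near (k, p) f" using f by (simp add: near_def)
      then show ?thesis using p k le unfolding Net_def by auto
    qed
    obtain en where en: "bij_betw en {..<card Net} Net"
      using ex_bij_betw_nat_finite[OF fin_Net] by (auto simp: atLeast0LessThan)
    define hs where "hs i = (if i < card Net then sel (en i) else (\<lambda>_. 0))" for i
    define P where "P i = pen * D (fst (en i))" for i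
    have enN: "en i \<in> Net" if "i < card Net" for i using en that by (auto dest: bij_betwE)
    have hsH: "hs i \<in> H" for i
      using sel[OF enN] H0 by (simp add: hs_def near_def)
    have K0: "0 < card Net"
    proof -
      obtain k where k: "k \<in> Mods" using Mods by auto
      have "os_proj (\<Lambda> k) (e k) (\<lambda>_. 0) = (\<lambda>_. 0)"
        by (simp add: os_proj_def lincomb_def L2_inner_def fun_eq_iff)
      then have "(L2_dist (\<lambda>_. 0) (os_proj (\<Lambda> k) (e k) (\<lambda>_. 0)))\<^sup>2 \<le> b * D k / real m"
        using b by (simp add: D_def)
      then have "Net \<noteq> {}" using good[OF k H0] by auto
      then show ?thesis using fin_Net by (simp add: card_gt_0_iff)
    qed
    show "\<exists>K hs P. 0 < K \<and> (\<forall>i. hs i \<in> H) \<and> net_risk_bound m Mods \<Lambda> e H c C b \<delta> A K hs P"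
      unfolding net_risk_bound_def
    proof (intro exI[of _ "card Net"] exI[of _ hs] exI[of _ P] conjI K0 allI impI hsH)
      fix f g n k0
      assume "binary_regression f g c C" and mn: "m \<le> n" and fH: "f \<in> H" and k0: "k0 \<in> Mods"
        and bias: "(L2_dist f (os_proj (\<Lambda> k0) (e k0) f))\<^sup>2 \<le> b * real (card (\<Lambda> k0)) / real m"
      then interpret binary_regression f g c C by simp
      define R where "R = A * D k0 / real m"
      obtain p0 where p0: "(k0, p0) \<in> Net" "(L2_dist f (u (k0, p0)))\<^sup>2 \<le> a * D k0 / real m"
        using good[OF k0 fH] bias by (auto simp: D_def)
      obtain j where j: "j < card Net" "en j = (k0, p0)"
        using en p0(1) by (metis (no_types, lifting) bij_betw_iff_bijections lessThan_iff)
      have D1: "1 \<le> D k" if "k \<in> Mods" for k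
        using os that fin[OF that] by (auto simp: D_def Suc_le_eq card_gt_0_iff)
      \<comment> \<open>The reference candidate is within twice the mesh of \<open>f\<close>.\<close>
      have dj: "(L2_dist f (hs j))\<^sup>2 \<le> 4 * a * D k0 / real m"
      proof -
        have near_j: "(L2_dist (hs j) (u (k0, p0)))\<^sup>2 \<le> a * D k0 / real m"
          using sel[OF p0(1)] j by (simp add: hs_def near_def)
        have "L2_dist f (hs j) \<le> L2_dist f (u (k0, p0)) + L2_dist (u (k0, p0)) (hs j)"
          using HL(1)[OF fH] HL(1)[OF hsH] uL[of "(k0, p0)"] k0 by (intro L2_dist_triangle) auto
        then have "(L2_dist f (hs j))\<^sup>2 \<le> (L2_dist f (u (k0, p0)) + L2_dist (hs j) (u (k0, p0)))\<^sup>2"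
          by (intro power_mono) (auto simp: L2_dist_commute)
        also have "\<dots> \<le> 2 * ((L2_dist f (u (k0, p0)))\<^sup>2 + (L2_dist (hs j) (u (k0, p0)))\<^sup>2)"
          using zero_le_power2[of "L2_dist f (u (k0, p0)) - L2_dist (hs j) (u (k0, p0))"]
          by (simp add: power2_eq_square algebra_simps)
        finally show ?thesis using p0(2) near_j by simp
      qed
      (* Q collects the exponents that do not depend on the candidate; w is the weight of a candidate. *)
      define Q where "Q = D k0 * (pen / 16 + 3 * C * a / 8 - c * A / 64)"
      define x where "x k \<kappa> = sqrt (real m) * L2_inner f (e k \<kappa>)" for k \<kappa>
      define w where "w kp = exp Q * (exp (- D (fst kp)) *
          (\<Prod>\<kappa>\<in>\<Lambda> (fst kp). exp (- \<tau>) * exp (- (c / 128) * (of_int (snd kp \<kappa>) - x (fst kp) \<kappa>)\<^sup>2)))" for kp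
      have exponent: "exp ((P j - P i) / 16 + real m * (- (c / 32) * (L2_dist f (hs i))\<^sup>2 + 3 * C / 32 * (L2_dist f (hs j))\<^sup>2))
          \<le> w (en i)" if i: "i < card Net" and far: "R < (L2_dist f (hs i))\<^sup>2" for i
      proof -
        obtain k p where kp: "en i = (k, p)" by (cases "en i")
        have N: "(k, p) \<in> Net" using enN[OF i] kp by simp
        then have k: "k \<in> Mods" by (auto simp: Net_def)
        define d where "d = (L2_dist f (hs i))\<^sup>2"
        define G where "G = (\<Sum>\<kappa>\<in>\<Lambda> k. (of_int (p \<kappa>) - x k \<kappa>)\<^sup>2)"
        have near_i: "(L2_dist (hs i) (u (k, p)))\<^sup>2 \<le> a * D k / real m"
          using sel[OF N] kp i by (simp add: hs_def near_def)
        have G_eq: "(\<Sum>\<kappa>\<in>\<Lambda> k. (of_int (p \<kappa>) / sqrt (real m) - L2_inner f (e k \<kappa>))\<^sup>2) = G / real m"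
          unfolding G_def sum_divide_distrib
        proof (rule sum.cong[OF refl])
          fix \<kappa>
          have "of_int (p \<kappa>) / sqrt (real m) - L2_inner f (e k \<kappa>) = (of_int (p \<kappa>) - x k \<kappa>) / sqrt (real m)"
            using m0 by (simp add: x_def field_simps)
          then show "(of_int (p \<kappa>) / sqrt (real m) - L2_inner f (e k \<kappa>))\<^sup>2 = (of_int (p \<kappa>) - x k \<kappa>)\<^sup>2 / real m"
            by (simp add: power_divide)
        qed
        have "G / real m \<le> (L2_dist f (u (k, p)))\<^sup>2"
        proof -
          have osk: "orthonormal_system (\<Lambda> k) (e k)" using os k by simp
          show ?thesis
            unfolding u_def grid_point_def fst_conv snd_conv pythagoras[OF osk f_L2] G_eq by simp
        qed
        also have "\<dots> \<le> 2 * d + 2 * (a * D k / real m)"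
        proof -
          have "L2_dist f (u (k, p)) \<le> L2_dist f (hs i) + L2_dist (hs i) (u (k, p))"
            using HL(1)[OF hsH] uL[of "(k, p)"] k by (intro L2_dist_triangle f_L2) auto
          then have "(L2_dist f (u (k, p)))\<^sup>2 \<le> (L2_dist f (hs i) + L2_dist (hs i) (u (k, p)))\<^sup>2"
            by (intro power_mono) auto
          also have "\<dots> \<le> 2 * ((L2_dist f (hs i))\<^sup>2 + (L2_dist (hs i) (u (k, p)))\<^sup>2)"
            using zero_le_power2[of "L2_dist f (hs i) - L2_dist (hs i) (u (k, p))"]
            by (simp add: power2_eq_square algebra_simps)
          finally show ?thesis using near_i by (simp add: d_def)
        qed
        finally have Gd: "G \<le> 2 * (real m * d) + 2 * a * D k"
          using m0 by (simp add: field_simps)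
        have md: "A * D k0 \<le> real m * d" using far m0 by (simp add: R_def d_def field_simps)
        have mj: "real m * (L2_dist f (hs j))\<^sup>2 \<le> 4 * a * D k0" using dj m0 by (simp add: field_simps)
        have "(P j - P i) / 16 + real m * (- (c / 32) * d + 3 * C / 32 * (L2_dist f (hs j))\<^sup>2)
            = pen / 16 * D k0 - pen / 16 * D k - c / 64 * (real m * d) - c / 64 * (real m * d)
               + 3 * C / 32 * (real m * (L2_dist f (hs j))\<^sup>2)"
          unfolding P_def j(2) kp by (simp add: algebra_simps diff_divide_distrib)
        also have "\<dots> \<le> pen / 16 * D k0 - pen / 16 * D k - c / 64 * (A * D k0) - c / 64 * ((G - 2 * a * D k) / 2)
               + 3 * C / 32 * (4 * a * D k0)"
          using Gd md mj c C by (intro add_mono diff_mono mult_left_mono order.refl) auto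
        also have "\<dots> = Q - D k - (\<tau> * D k + c / 128 * G)"
          unfolding Q_def pen_def by (simp add: field_simps)
        also have "\<tau> * D k + c / 128 * G = - (\<Sum>\<kappa>\<in>\<Lambda> k. - \<tau> + - (c / 128) * (of_int (p \<kappa>) - x k \<kappa>)\<^sup>2)"
          by (simp add: G_def D_def sum.distrib sum_negf sum_distrib_left sum_subtractf)
        finally have "(P j - P i) / 16 + real m * (- (c / 32) * d + 3 * C / 32 * (L2_dist f (hs j))\<^sup>2)
            \<le> Q + (- D k + (\<Sum>\<kappa>\<in>\<Lambda> k. - \<tau> + - (c / 128) * (of_int (p \<kappa>) - x k \<kappa>)\<^sup>2))"
          by simp
        then have "exp ((P j - P i) / 16 + real m * (- (c / 32) * d + 3 * C / 32 * (L2_dist f (hs j))\<^sup>2))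
            \<le> exp (Q + (- D k + (\<Sum>\<kappa>\<in>\<Lambda> k. - \<tau> + - (c / 128) * (of_int (p \<kappa>) - x k \<kappa>)\<^sup>2)))"
          by (simp only: exp_le_cancel_iff)
        also have "\<dots> = w (en i)"
          unfolding kp w_def fst_conv snd_conv exp_add exp_sum[OF fin[OF k]] by simp
        finally show ?thesis by (simp only: d_def)
      qed
      have w_nn: "0 \<le> w kp" for kp unfolding w_def by (intro mult_nonneg_nonneg prod_nonneg) auto
      have "emeasure (sample_law n f g) {\<omega> \<in> space (sample_space n).
           R < (L2_dist f (hs (selected m (card Net) hs P \<omega>)))\<^sup>2}
         \<le> (\<Sum>i\<in>{i\<in>{..<card Net}. R < (L2_dist f (hs i))\<^sup>2}. ennreal (exp ((P j - P i) / 16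
         + real m * (- (c / 32) * (L2_dist f (hs i))\<^sup>2 + 3 * C / 32 * (L2_dist f (hs j))\<^sup>2))))"
        using hsH H by (intro selection_tail mn j) auto
      also have "\<dots> \<le> (\<Sum>i\<in>{i\<in>{..<card Net}. R < (L2_dist f (hs i))\<^sup>2}. ennreal (w (en i)))"
        by (intro sum_mono ennreal_leI exponent) auto
      also have "\<dots> = ennreal (\<Sum>i\<in>{i\<in>{..<card Net}. R < (L2_dist f (hs i))\<^sup>2}. w (en i))"
        using w_nn by (intro sum_ennreal) auto
      also have "(\<Sum>i\<in>{i\<in>{..<card Net}. R < (L2_dist f (hs i))\<^sup>2}. w (en i)) \<le> (\<Sum>i<card Net. w (en i))"
        using w_nn by (intro sum_mono2) auto
      also have "\<dots> = (\<Sum>kp\<in>Net. w kp)" using sum.reindex_bij_betw[OF en] .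
      also have "\<dots> \<le> (\<Sum>kp\<in>Sigma Mods box. w kp)"
        using w_nn fin_Sig by (intro sum_mono2) (auto simp: Net_def)
      also have "\<dots> = (\<Sum>k\<in>Mods. \<Sum>p\<in>box k. w (k, p))"
        using Mods fin_box by (subst sum.Sigma) auto
      also have "\<dots> = (\<Sum>k\<in>Mods. exp Q * (exp (- D k) *
          (\<Prod>\<kappa>\<in>\<Lambda> k. exp (- \<tau>) * (\<Sum>p\<in>{- int (m + 1)..int (m + 1)}. exp (- (c / 128) * (of_int p - x k \<kappa>)\<^sup>2)))))"
      proof (rule sum.cong[OF refl])
        fix k assume k: "k \<in> Mods"
        have "(\<Sum>p\<in>box k. \<Prod>\<kappa>\<in>\<Lambda> k. exp (- \<tau>) * exp (- (c / 128) * (of_int (p \<kappa>) - x k \<kappa>)\<^sup>2))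
            = (\<Prod>\<kappa>\<in>\<Lambda> k. \<Sum>p\<in>{- int (m + 1)..int (m + 1)}. exp (- \<tau>) * exp (- (c / 128) * (of_int p - x k \<kappa>)\<^sup>2))"
          unfolding box_def using fin[OF k] by (intro prod_sum_PiE[symmetric]) auto
        then show "(\<Sum>p\<in>box k. w (k, p)) = exp Q * (exp (- D k) *
          (\<Prod>\<kappa>\<in>\<Lambda> k. exp (- \<tau>) * (\<Sum>p\<in>{- int (m + 1)..int (m + 1)}. exp (- (c / 128) * (of_int p - x k \<kappa>)\<^sup>2))))"
          unfolding w_def fst_conv snd_conv sum_distrib_left[symmetric] by simp
      qed
      also have "\<dots> \<le> (\<Sum>k\<in>Mods. exp Q * (exp (- D k) * 1))"
      proof (intro sum_mono mult_left_mono)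
        fix k
        have "exp (- \<tau>) * (\<Sum>p\<in>{- int (m + 1)..int (m + 1)}. exp (- (c / 128) * (of_int p - x k \<kappa>)\<^sup>2)) \<le> exp (- \<tau>) * exp \<tau>" for \<kappa>
          by (intro mult_left_mono \<tau>) auto
        then show "(\<Prod>\<kappa>\<in>\<Lambda> k. exp (- \<tau>) * (\<Sum>p\<in>{- int (m + 1)..int (m + 1)}. exp (- (c / 128) * (of_int p - x k \<kappa>)\<^sup>2))) \<le> 1"
          by (intro prod_le_1) (auto simp: exp_minus sum_nonneg)
      qed auto
      also have "\<dots> = exp Q * (\<Sum>k\<in>Mods. exp (- D k))" by (simp add: sum_distrib_left)
      also have "\<dots> \<le> exp Q * 1" using sumD by (intro mult_left_mono) (auto simp: D_def)
      also have "\<dots> \<le> \<delta>"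
      proof -
        have "Q = - (D k0 * \<bar>ln \<delta>\<bar>)" unfolding Q_def A_def using c by (simp add: field_simps)
        also have "\<dots> \<le> - (1 * \<bar>ln \<delta>\<bar>)" using D1[OF k0] by (intro le_imp_neg_le mult_right_mono) auto
        also have "\<dots> \<le> ln \<delta>" by simp
        finally have "exp Q \<le> exp (ln \<delta>)" by (simp only: exp_le_cancel_iff)
        then show ?thesis using \<delta> by simp
      qed
      finally show "emeasure (sample_law n f g) {\<omega> \<in> space (sample_space n).
           A * real (card (\<Lambda> k0)) / real m < (L2_dist f (hs (selected m (card Net) hs P \<omega>)))\<^sup>2} \<le> ennreal \<delta>"
        unfolding R_def D_def by (simp add: ennreal_leI)
    qed
  qed
qed

section \<open>Integrals of tensor products over the cube\<close>

lemma Basis_vec_eq: "(Basis :: (real ^ 'n::finite) set) = (\<lambda>i. axis i 1) ` UNIV"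
  by (auto simp: Basis_vec_def)

lemma inj_axis_one: "inj (\<lambda>i::'n::finite. axis i (1::real))"
  by (auto simp: inj_def axis_eq_axis)

text \<open>
  Indexing the product by coordinates instead of basis vectors is what matches tensor products.
\<close>

lemma lborel_vec_eq:
  "(lborel :: (real ^ 'n::finite) measure) = distr (PiM UNIV (\<lambda>_. lborel)) borel (\<lambda>w. \<chi> l. w l)"
proof (rule lborel_eqI)
  have meas: "(\<lambda>w. (\<chi> l. w l) :: real ^ 'n) \<in> PiM UNIV (\<lambda>_. lborel) \<rightarrow>\<^sub>M borel"
    by (subst borel_measurable_euclidean_space) (auto simp: Basis_vec_eq inner_axis)
  interpret P: product_sigma_finite "\<lambda>_::'n. lborel :: real measure" ..
  fix l u :: "real ^ 'n"
  assume le: "\<And>b. b \<in> Basis \<Longrightarrow> l \<bullet> b \<le> u \<bullet> b"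
  have le': "l $ i \<le> u $ i" for i
    using le[of "axis i 1"] by (simp add: Basis_vec_eq inner_axis)
  have "emeasure (distr (PiM UNIV (\<lambda>_. lborel)) borel (\<lambda>w. (\<chi> l. w l) :: real ^ 'n)) (box l u)
      = emeasure (PiM UNIV (\<lambda>_. lborel)) (PiE UNIV (\<lambda>i::'n. {l $ i<..<u $ i}))"
  proof -
    have "(\<lambda>w. (\<chi> l. w l) :: real ^ 'n) -` box l u \<inter> space (PiM UNIV (\<lambda>_::'n. lborel :: real measure))
        = PiE UNIV (\<lambda>i. {l $ i<..<u $ i})"
      by (auto simp: mem_box Basis_vec_eq inner_axis space_PiM PiE_iff)
    then show ?thesis by (simp add: emeasure_distr[OF meas])
  qed
  also have "\<dots> = (\<Prod>i\<in>UNIV. emeasure lborel {l $ i<..<u $ i})"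
    by (rule P.emeasure_PiM) auto
  also have "\<dots> = ennreal (\<Prod>i\<in>UNIV. u $ i - l $ i)"
    using le' by (simp add: prod_ennreal)
  also have "(\<Prod>i\<in>UNIV. u $ i - l $ i) = (\<Prod>b\<in>Basis. (u - l) \<bullet> b)"
    unfolding Basis_vec_eq by (subst prod.reindex[OF inj_axis_one]) (simp add: inner_axis)
  finally show "emeasure (distr (PiM UNIV (\<lambda>_. lborel)) borel (\<lambda>w. (\<chi> l. w l) :: real ^ 'n)) (box l u)
      = ennreal (\<Prod>b\<in>Basis. (u - l) \<bullet> b)" .
qed simp

lemma mem_cube_vec: "x \<in> cbox 0 (One :: real ^ 'n::finite) \<longleftrightarrow> (\<forall>l. x $ l \<in> {0..1})"
proof -
  have "(One :: real ^ 'n) \<bullet> b = 1" if "b \<in> Basis" for b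
    using that by (simp add: inner_sum_left inner_Basis if_distrib cong: if_cong)
  then have "(One :: real ^ 'n) $ l = 1" for l
    by (subst cart_eq_inner_axis) (simp add: Basis_vec_eq del: inner_sum_left)
  then show ?thesis by (simp add: mem_box_cart)
qed

lemma cube_integral_prod:
  fixes h :: "'n::finite \<Rightarrow> real \<Rightarrow> real"
  assumes h: "\<And>l. integrable cube_measure (h l)"
  shows "integrable cube_measure (\<lambda>x :: real ^ 'n. \<Prod>l\<in>UNIV. h l (x $ l))"
    and "(\<integral>x. (\<Prod>l\<in>UNIV. h l (x $ l)) \<partial>(cube_measure :: (real ^ 'n) measure)) = (\<Prod>l\<in>UNIV. \<integral>y. h l y \<partial>cube_measure)"
proof -
  interpret P: product_sigma_finite "\<lambda>_::'n. lborel :: real measure" ..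
  define k where "k l y = indicator {0..1} y *\<^sub>R h l y" for l y
  have k_int: "integrable lborel (k l)" and k_val: "(\<integral>y. h l y \<partial>cube_measure) = (\<integral>y. k l y \<partial>lborel)" for l
    using h[of l] unfolding cube_measure_def k_def
    by (simp_all add: integrable_restrict_space integral_restrict_space cbox_interval)
  have ind: "indicator (cbox 0 One) x *\<^sub>R (\<Prod>l\<in>UNIV. h l (x $ l)) = (\<Prod>l\<in>UNIV. k l (x $ l))" for x :: "real ^ 'n"
  proof (cases "x \<in> cbox 0 One")
    case True
    then show ?thesis by (simp add: k_def mem_cube_vec)
  next
    case False
    then obtain l where "x $ l \<notin> {0..1}" by (auto simp: mem_cube_vec)
    then have "k l (x $ l) = 0" by (simp add: k_def indicator_def)
    then have "(\<Prod>l\<in>UNIV. k l (x $ l)) = 0" by (intro prod_zero) auto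
    then show ?thesis using False by simp
  qed
  have meas: "(\<lambda>w. (\<chi> l. w l) :: real ^ 'n) \<in> PiM UNIV (\<lambda>_. lborel) \<rightarrow>\<^sub>M borel"
    by (subst borel_measurable_euclidean_space) (auto simp: Basis_vec_eq inner_axis)
  have km: "(\<lambda>x :: real ^ 'n. \<Prod>l\<in>UNIV. k l (x $ l)) \<in> borel_measurable borel"
  proof (rule borel_measurable_prod)
    fix l
    have "k l \<in> borel_measurable borel" using k_int[of l] by auto
    then show "(\<lambda>x :: real ^ 'n. k l (x $ l)) \<in> borel_measurable borel"
      by (rule measurable_compose[rotated]) (simp add: borel_measurable_continuous_onI)
  qed
  have "integrable (PiM UNIV (\<lambda>_::'n. lborel :: real measure)) (\<lambda>w. \<Prod>l\<in>UNIV. k l (w l))"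
    by (rule P.product_integrable_prod) (auto simp: k_int)
  then have i1: "integrable lborel (\<lambda>x :: real ^ 'n. \<Prod>l\<in>UNIV. k l (x $ l))"
    unfolding lborel_vec_eq by (subst integrable_distr_eq[OF meas km]) simp
  have i2: "(\<integral>x. (\<Prod>l\<in>UNIV. k l (x $ l)) \<partial>(lborel :: (real ^ 'n) measure)) = (\<Prod>l\<in>UNIV. \<integral>y. k l y \<partial>lborel)"
    unfolding lborel_vec_eq using P.product_integral_prod[of UNIV k] k_int
    by (subst integral_distr[OF meas km]) simp
  show "integrable cube_measure (\<lambda>x :: real ^ 'n. \<Prod>l\<in>UNIV. h l (x $ l))"
    unfolding cube_measure_def using i1 by (subst integrable_restrict_space) (simp_all add: ind del: real_scaleR_def)
  show "(\<integral>x. (\<Prod>l\<in>UNIV. h l (x $ l)) \<partial>(cube_measure :: (real ^ 'n) measure)) = (\<Prod>l\<in>UNIV. \<integral>y. h l y \<partial>cube_measure)"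
    unfolding k_val i2[symmetric] unfolding cube_measure_def
    by (subst integral_restrict_space) (simp_all add: ind del: real_scaleR_def)
qed

lemma tensor_L2:
  fixes u :: "'n::finite \<Rightarrow> real \<Rightarrow> real"
  assumes u: "\<And>l. u l \<in> L2_space"
  shows "(\<lambda>x :: real ^ 'n. \<Prod>l\<in>UNIV. u l (x $ l)) \<in> L2_space"
proof -
  have "integrable cube_measure (u l)" for l
    using integrable_mult[OF u[of l] L2_space_const[of 1]] by simp
  from cube_integral_prod(1)[OF this] have "(\<lambda>x :: real ^ 'n. \<Prod>l\<in>UNIV. u l (x $ l)) \<in> borel_measurable cube_measure"
    by (rule borel_measurable_integrable)
  moreover have "integrable cube_measure (\<lambda>x :: real ^ 'n. (\<Prod>l\<in>UNIV. u l (x $ l))\<^sup>2)"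
    unfolding prod_power_distrib by (rule cube_integral_prod(1)) (rule integrable_square[OF u])
  ultimately show ?thesis by (simp add: L2_space_def)
qed

lemma tensor_inner:
  fixes u v :: "'n::finite \<Rightarrow> real \<Rightarrow> real"
  assumes u: "\<And>l. u l \<in> L2_space" and v: "\<And>l. v l \<in> L2_space"
  shows "L2_inner (\<lambda>x :: real ^ 'n. \<Prod>l\<in>UNIV. u l (x $ l)) (\<lambda>x. \<Prod>l\<in>UNIV. v l (x $ l)) = (\<Prod>l\<in>UNIV. L2_inner (u l) (v l))"
  unfolding L2_inner_def prod.distrib[symmetric]
  by (rule cube_integral_prod(2)) (rule integrable_mult[OF u v])

section \<open>Approximation by a sequence of orthonormal systems\<close>

text \<open>
  Formulated with the projections themselves, so that sums and limits of approximable functions need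
  no choice of approximants.
\<close>

definition approximable ::
  "(nat \<Rightarrow> 'k set) \<Rightarrow> (nat \<Rightarrow> 'k \<Rightarrow> 'a::euclidean_space \<Rightarrow> real) \<Rightarrow> ('a \<Rightarrow> real) \<Rightarrow> bool" where
  "approximable \<Lambda> e h \<longleftrightarrow> h \<in> L2_space \<and> (\<lambda>J. L2_dist h (os_proj (\<Lambda> J) (e J) h)) \<longlonglongrightarrow> 0"

context
  fixes \<Lambda> :: "nat \<Rightarrow> 'k set" and e :: "nat \<Rightarrow> 'k \<Rightarrow> 'a::euclidean_space \<Rightarrow> real" and start :: nat
  assumes os: "\<And>J. start \<le> J \<Longrightarrow> orthonormal_system (\<Lambda> J) (e J)"
begin

lemma approximableI:
  assumes h: "h \<in> L2_space" and lim: "(\<lambda>J. L2_dist h (lincomb (\<Lambda> J) (e J) (a J))) \<longlonglongrightarrow> 0"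
  shows "approximable \<Lambda> e h"
  unfolding approximable_def
proof (intro conjI h tendsto_sandwich[OF _ _ tendsto_const lim])
  show "\<forall>\<^sub>F J in sequentially. L2_dist h (os_proj (\<Lambda> J) (e J) h) \<le> L2_dist h (lincomb (\<Lambda> J) (e J) (a J))"
    using eventually_ge_at_top[of start] by eventually_elim (rule os_proj_nearest[OF os h])
qed simp

lemma approximable_closed:
  assumes h: "h \<in> L2_space" and appr: "\<And>\<epsilon>. 0 < \<epsilon> \<Longrightarrow> \<exists>h'. approximable \<Lambda> e h' \<and> L2_dist h h' < \<epsilon>"
  shows "approximable \<Lambda> e h"
  unfolding approximable_def
proof (intro conjI h LIMSEQ_I)
  fix \<epsilon> :: real assume "0 < \<epsilon>"
  then obtain h' where h': "approximable \<Lambda> e h'" "L2_dist h h' < \<epsilon> / 2" using appr[of "\<epsilon> / 2"] by auto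
  then have h'L: "h' \<in> L2_space" by (simp add: approximable_def)
  obtain N where N: "\<And>J. N \<le> J \<Longrightarrow> L2_dist h' (os_proj (\<Lambda> J) (e J) h') < \<epsilon> / 2"
    using h'(1) \<open>0 < \<epsilon>\<close> unfolding approximable_def LIMSEQ_def dist_real_def
    by (metis L2_dist_nonneg abs_of_nonneg diff_zero half_gt_zero)
  show "\<exists>N. \<forall>J\<ge>N. norm (L2_dist h (os_proj (\<Lambda> J) (e J) h) - 0) < \<epsilon>"
  proof (intro exI[of _ "max N start"] allI impI)
    fix J assume "max N start \<le> J"
    then have J: "N \<le> J" "start \<le> J" by auto
    have "L2_dist h (os_proj (\<Lambda> J) (e J) h) \<le> L2_dist h (os_proj (\<Lambda> J) (e J) h')"
      unfolding os_proj_def[of _ _ h'] by (rule os_proj_nearest[OF os[OF J(2)] h])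
    also have "\<dots> \<le> L2_dist h h' + L2_dist h' (os_proj (\<Lambda> J) (e J) h')"
      by (rule L2_dist_triangle[OF h h'L os_proj_L2[OF os[OF J(2)]]])
    also have "\<dots> < \<epsilon>" using h'(2) N[OF J(1)] by linarith
    finally show "norm (L2_dist h (os_proj (\<Lambda> J) (e J) h) - 0) < \<epsilon>" by simp
  qed
qed

lemma approximable_add:
  assumes u: "approximable \<Lambda> e u" and v: "approximable \<Lambda> e v"
  shows "approximable \<Lambda> e (\<lambda>x. u x + v x)"
proof (rule approximableI)
  have uL: "u \<in> L2_space" and vL: "v \<in> L2_space" using u v by (auto simp: approximable_def)
  then show "(\<lambda>x. u x + v x) \<in> L2_space" by (rule L2_space_add)
  have lim: "(\<lambda>J. L2_dist u (os_proj (\<Lambda> J) (e J) u) + L2_dist v (os_proj (\<Lambda> J) (e J) v)) \<longlonglongrightarrow> 0"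
    using tendsto_add[of _ 0 _ _ 0] u v by (auto simp: approximable_def)
  show "(\<lambda>J. L2_dist (\<lambda>x. u x + v x) (lincomb (\<Lambda> J) (e J) (\<lambda>k. L2_inner u (e J k) + L2_inner v (e J k)))) \<longlonglongrightarrow> 0"
  proof (rule tendsto_sandwich[OF _ _ tendsto_const lim])
    show "\<forall>\<^sub>F J in sequentially. L2_dist (\<lambda>x. u x + v x) (lincomb (\<Lambda> J) (e J) (\<lambda>k. L2_inner u (e J k) + L2_inner v (e J k)))
       \<le> L2_dist u (os_proj (\<Lambda> J) (e J) u) + L2_dist v (os_proj (\<Lambda> J) (e J) v)"
      using eventually_ge_at_top[of start]
    proof eventually_elim
      case (elim J)
      have "(\<lambda>x. u x + v x - lincomb (\<Lambda> J) (e J) (\<lambda>k. L2_inner u (e J k) + L2_inner v (e J k)) x)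
          = (\<lambda>x. (u x - os_proj (\<Lambda> J) (e J) u x) + (v x - os_proj (\<Lambda> J) (e J) v x))"
        by (simp add: fun_eq_iff os_proj_def lincomb_def distrib_right sum.distrib)
      then show ?case
        using L2_norm_triangle[OF L2_space_diff[OF uL os_proj_L2[OF os[OF elim]]] L2_space_diff[OF vL os_proj_L2[OF os[OF elim]]]]
        by (simp add: L2_dist_def)
    qed
  qed simp
qed

lemma approximable_scale:
  assumes u: "approximable \<Lambda> e u"
  shows "approximable \<Lambda> e (\<lambda>x. a * u x)"
proof (rule approximableI)
  have uL: "u \<in> L2_space" using u by (auto simp: approximable_def)
  then show "(\<lambda>x. a * u x) \<in> L2_space" by (rule L2_space_scale)
  have "L2_dist (\<lambda>x. a * u x) (lincomb (\<Lambda> J) (e J) (\<lambda>k. a * L2_inner u (e J k)))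
      = \<bar>a\<bar> * L2_dist u (os_proj (\<Lambda> J) (e J) u)" for J
    unfolding L2_dist_def L2_norm_scale[symmetric]
    by (simp add: os_proj_def lincomb_def sum_distrib_left mult.assoc right_diff_distrib)
  then show "(\<lambda>J. L2_dist (\<lambda>x. a * u x) (lincomb (\<Lambda> J) (e J) (\<lambda>k. a * L2_inner u (e J k)))) \<longlonglongrightarrow> 0"
    using u by (auto simp: approximable_def intro: tendsto_mult_right_zero)
qed

lemma approximable_sum:
  assumes "finite I" "\<And>i. i \<in> I \<Longrightarrow> approximable \<Lambda> e (u i)"
  shows "approximable \<Lambda> e (\<lambda>x. \<Sum>i\<in>I. u i x)"
  using assms
proof (induction I rule: finite_induct)
  case empty
  have "os_proj (\<Lambda> J) (e J) (\<lambda>_. 0) = (\<lambda>_. 0)" for J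
    by (simp add: os_proj_def lincomb_def L2_inner_def fun_eq_iff)
  then show ?case by (simp add: approximable_def)
next
  case (insert i I)
  then show ?case using approximable_add[of "u i" "\<lambda>x. \<Sum>i\<in>I. u i x"] by simp
qed

text \<open>
  Dynkin's argument: approximability passes from the indicators of a \<open>\<pi>\<close>-system to those of all
  Borel sets because it is stable under complements and, by continuity of the measure, under
  countable disjoint unions.
\<close>

lemma approximable_indicator:
  assumes G: "Int_stable G" "borel = sigma UNIV G"
    and G_appr: "\<And>A. A \<in> G \<Longrightarrow> approximable \<Lambda> e (indicator A)"
    and one: "approximable \<Lambda> e (\<lambda>_. 1)"
    and A: "A \<in> sets (borel :: 'a measure)"
  shows "approximable \<Lambda> e (indicator A)"
proof -
  have sb: "sets (borel :: 'a measure) = sigma_sets UNIV G"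
    unfolding G(2) by (rule sets_measure_of) simp
  have indL: "indicator B \<in> L2_space" if "B \<in> sigma_sets UNIV G" for B :: "'a set"
  proof (rule L2_space_bounded[where B = 1])
    have "B \<in> sets borel" using that sb by simp
    then show "indicator B \<in> borel_measurable cube_measure" by (intro borel_measurable_cubeI) simp
  qed (simp add: indicator_def)
  have GP: "G \<subseteq> Pow UNIV" by simp
  have "A \<in> sigma_sets UNIV G" using A sb by simp
  from G(1) GP this show ?thesis
  proof (induction rule: sigma_sets_induct_disjoint)
    case (basic A) then show ?case by (rule G_appr)
  next
    case empty
    show ?case using approximable_scale[OF one, of 0] by (simp add: indicator_def[abs_def])
  next
    case (compl A)
    have "(\<lambda>x. 1 + (- 1) * indicator A x) = (indicator (UNIV - A) :: 'a \<Rightarrow> real)"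
      by (auto simp: indicator_def)
    then show ?case using approximable_add[OF one approximable_scale[OF compl(2), of "-1"]] by simp
  next
    case (union A)
    show ?case
    proof (rule approximable_closed)
      show UL: "indicator (\<Union>i. A i) \<in> L2_space"
        using union(2) by (intro indL sigma_sets.Union) auto
      fix \<epsilon> :: real assume \<epsilon>: "0 < \<epsilon>"
      define B where "B i = A i \<inter> cbox 0 One" for i
      have Bs: "range B \<subseteq> sets cube_measure"
        unfolding B_def cube_measure_def using union(2) sb by (auto simp: sets_restrict_space Int_commute)
      have "B i \<inter> B j = {}" if "i \<noteq> j" for i j
        using union(1) that by (auto simp: B_def disjoint_family_on_def)
      then have "disjoint_family B" by (simp add: disjoint_family_on_def)
      then have sums: "(\<lambda>i. measure cube_measure (B i)) sums measure cube_measure (\<Union>i. B i)"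
        using Bs by (intro cube.finite_measure_UNION) auto
      then have "(\<lambda>n. measure cube_measure (\<Union>i. B i) - (\<Sum>i<n. measure cube_measure (B i))) \<longlonglongrightarrow> 0"
        unfolding sums_def
        using tendsto_diff[OF tendsto_const, of _ "measure cube_measure (\<Union>i. B i)" sequentially
            "measure cube_measure (\<Union>i. B i)"] by simp
      then obtain n where n: "\<bar>measure cube_measure (\<Union>i. B i) - (\<Sum>i<n. measure cube_measure (B i))\<bar> < \<epsilon>\<^sup>2"
        using \<epsilon> unfolding LIMSEQ_def dist_real_def by (metis diff_zero order_refl zero_less_power)
      let ?S = "\<lambda>x. \<Sum>i<n. indicator (A i) x :: real"
      have appS: "approximable \<Lambda> e ?S"
        by (intro approximable_sum union(3)) auto
      have eq: "indicator (\<Union>i. A i) x - ?S x = indicator (\<Union>i\<in>{n..}. A i) x" for x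
      proof -
        have fin: "(\<Sum>i<n. indicator (A i) x :: real) = indicator (\<Union>i<n. A i) x"
          using union(1) by (intro indicator_UN_disjoint[symmetric]) (auto simp: disjoint_family_on_def)
        have "x \<in> (\<Union>i<n. A i) \<Longrightarrow> x \<notin> (\<Union>i\<in>{n..}. A i)"
          using union(1) unfolding disjoint_family_on_def by (metis (no_types, lifting) IntI UNIV_I UN_E atLeast_iff empty_iff lessThan_iff not_le)
        moreover have "(\<Union>i. A i) = (\<Union>i<n. A i) \<union> (\<Union>i\<in>{n..}. A i)"
          by auto (meson atLeast_iff lessThan_iff not_less)
        ultimately show ?thesis unfolding fin by (auto simp: indicator_def)
      qed
      have "(L2_dist (indicator (\<Union>i. A i)) ?S)\<^sup>2 = (\<integral>x. (indicator (\<Union>i. A i) x - ?S x) \<partial>cube_measure)"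
        unfolding L2_dist_def L2_norm_square L2_inner_def eq
        by (intro Bochner_Integration.integral_cong) (auto simp: indicator_def)
      also have "\<dots> = measure cube_measure (\<Union>i. B i) - (\<Sum>i<n. measure cube_measure (B i))"
      proof -
        have int: "integrable cube_measure (indicator C :: 'a \<Rightarrow> real)" if "indicator C \<in> (L2_space :: ('a \<Rightarrow> real) set)" for C
          using integrable_mult[OF that L2_space_const[of 1]] by simp
        have val: "(\<integral>x. indicator C x \<partial>cube_measure) = measure cube_measure (C \<inter> cbox 0 One)" for C :: "'a set"
          by simp
        have AL: "indicator (A i) \<in> L2_space" for i using union(2) by (intro indL) auto
        have "(\<integral>x. (indicator (\<Union>i. A i) x - ?S x) \<partial>cube_measure)
            = (\<integral>x. indicator (\<Union>i. A i) x \<partial>cube_measure) - (\<Sum>i<n. \<integral>x. indicator (A i) x \<partial>cube_measure)"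
          using int[OF UL] int[OF AL] by (subst Bochner_Integration.integral_diff) (auto simp: Bochner_Integration.integral_sum)
        then show ?thesis unfolding val by (simp add: B_def)
      qed
      finally have "(L2_dist (indicator (\<Union>i. A i)) ?S)\<^sup>2 < \<epsilon>\<^sup>2" using n by linarith
      then have "L2_dist (indicator (\<Union>i. A i)) ?S < \<epsilon>"
        using \<epsilon> by (auto intro: power2_less_imp_less)
      then show "\<exists>h'. approximable \<Lambda> e h' \<and> L2_dist (indicator (\<Union>i. A i)) h' < \<epsilon>"
        using appS by blast
    qed
  qed
qed

text \<open>
  The staircase with \<open>k\<close> steps built from the level sets of \<open>f\<close> is uniformly within \<open>1 / k\<close> of \<open>f\<close>.
\<close>

lemma approximable_unit_valued:
  assumes ind: "\<And>A. A \<in> sets (borel :: 'a measure) \<Longrightarrow> approximable \<Lambda> e (indicator A)"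
    and fm: "f \<in> borel_measurable cube_measure" and f: "\<And>x. 0 \<le> f x" "\<And>x. f x \<le> 1"
  shows "approximable \<Lambda> e f"
proof (rule approximable_closed)
  show fL: "f \<in> L2_space" using fm f by (intro L2_space_bounded[where B = 1]) auto
  fix \<epsilon> :: real assume "0 < \<epsilon>"
  obtain k :: nat where k: "0 < k" "1 / real k < \<epsilon>"
    using reals_Archimedean[OF \<open>0 < \<epsilon>\<close>] by (metis inverse_eq_divide zero_less_Suc)
  have "\<exists>A. A \<in> sets borel \<and> {x \<in> cbox 0 One. real i / real k \<le> f x} = A \<inter> cbox 0 One" for i
  proof -
    have "{x \<in> space cube_measure. real i / real k \<le> f x} \<in> sets cube_measure" using fm by measurable
    then show ?thesis unfolding cube_measure_def by (auto simp: sets_restrict_space space_restrict_space)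
  qed
  then obtain A where A: "\<And>i. A i \<in> sets borel" "\<And>i. {x \<in> cbox 0 One. real i / real k \<le> f x} = A i \<inter> cbox 0 One"
    by metis
  define s where "s x = (\<Sum>i\<in>{1..k}. 1 / real k * indicator (A i) x)" for x
  have s: "approximable \<Lambda> e s"
    unfolding s_def[abs_def] by (intro approximable_sum approximable_scale ind A) auto
  have close: "\<bar>f x - s x\<bar> \<le> 1 / real k" if x: "x \<in> cbox 0 One" for x
  proof -
    define j where "j = nat \<lfloor>real k * f x\<rfloor>"
    have j: "real j \<le> real k * f x" "real k * f x < real j + 1"
      using f(1)[of x] unfolding j_def by auto
    have "real k * f x \<le> real k" using f(2)[of x] by (simp add: mult_left_le)
    then have jk: "j \<le> k" using j(1) by linarith
    have mem: "x \<in> A i \<longleftrightarrow> i \<le> j" for i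
    proof -
      have "x \<in> A i \<longleftrightarrow> real i / real k \<le> f x" using A(2)[of i] x by blast
      also have "\<dots> \<longleftrightarrow> real i \<le> real k * f x" using k by (simp add: field_simps)
      also have "\<dots> \<longleftrightarrow> i \<le> j" using j by linarith
      finally show ?thesis .
    qed
    have "s x = (\<Sum>i\<in>{1..j}. 1 / real k)"
      unfolding s_def by (rule sum.mono_neutral_cong_right) (use jk in \<open>auto simp: mem indicator_def\<close>)
    then have "s x = real j / real k" by simp
    then show ?thesis using j k by (auto simp: field_simps abs_le_iff)
  qed
  have sL: "s \<in> L2_space" using s by (simp add: approximable_def)
  have "L2_dist f s \<le> 1 / real k" using close by (intro L2_dist_le_const fL sL) auto
  then show "\<exists>h'. approximable \<Lambda> e h' \<and> L2_dist f h' < \<epsilon>" using s k by (intro exI[of _ s]) auto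
qed

end

section \<open>Boundary-corrected wavelets\<close>

lemma L2_space_cong_bounded:
  fixes u G :: "real \<Rightarrow> real"
  assumes G: "G \<in> borel_measurable borel" "bounded (range G)" and eq: "\<And>x. x \<in> {0..1} \<Longrightarrow> u x = G x"
  shows "u \<in> L2_space"
proof -
  obtain B where B: "\<And>x. \<bar>G x\<bar> \<le> B" using G(2) by (auto simp: bounded_iff)
  show ?thesis
  proof (rule L2_space_bounded[where B = B])
    have "u \<in> borel_measurable cube_measure \<longleftrightarrow> G \<in> borel_measurable cube_measure"
      by (intro measurable_cong) (simp add: eq cbox_interval)
    then show "u \<in> borel_measurable cube_measure" using borel_measurable_cubeI[OF G(1)] by simp
  qed (simp add: eq cbox_interval B)
qed

lemma L2_space_dilate:
  fixes \<theta> u :: "real \<Rightarrow> real"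
  assumes m: "\<theta> \<in> borel_measurable borel" and b: "bounded (range \<theta>)"
    and eq: "\<And>x. x \<in> {0..1} \<Longrightarrow> u x = r * \<theta> (s * x - t)"
  shows "u \<in> L2_space"
proof (rule L2_space_cong_bounded[OF _ _ eq])
  show "(\<lambda>x. r * \<theta> (s * x - t)) \<in> borel_measurable borel"
    using m by measurable
  obtain B where B: "\<And>x. \<bar>\<theta> x\<bar> \<le> B" using b by (auto simp: bounded_iff)
  have "norm (r * \<theta> (s * x - t)) \<le> \<bar>r\<bar> * B" for x
    unfolding real_norm_def abs_mult by (intro mult_left_mono B) simp
  then show "bounded (range (\<lambda>x. r * \<theta> (s * x - t)))"
    unfolding bounded_iff by blast
qed

lemma boundary_family_L2:
  assumes fam: "boundary_corrected_family J0 \<theta> nl nr F"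
    and \<theta>: "\<theta> \<in> borel_measurable borel" "bounded (range \<theta>)"
    and j: "J0 \<le> j" and k: "k < 2 ^ j"
  shows "F j k \<in> L2_space"
proof -
  obtain L R t where
    L: "\<forall>i<nl. L i \<in> borel_measurable borel \<and> bounded (range (L i)) \<and> compactly_supported (L i)" and
    R: "\<forall>i<nr. R i \<in> borel_measurable borel \<and> bounded (range (R i)) \<and> compactly_supported (R i)" and
    F: "\<forall>j\<ge>J0. nl + nr \<le> 2 ^ j \<and>
           (\<lambda>k. int k + t) ` {nl..<2 ^ j - nr} =
             {l::int. closure {x. \<theta> (2 ^ j * x - of_int l) \<noteq> 0} \<subseteq> {0<..<1}} \<and>
           (\<forall>x\<in>{0..1}.
              (\<forall>k<nl. F j k x = 2 powr (real j / 2) * L k (2 ^ j * x)) \<and>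
              (\<forall>k\<in>{nl..<2 ^ j - nr}.
                 F j k x = 2 powr (real j / 2) * \<theta> (2 ^ j * x - of_int (int k + t))) \<and>
              (\<forall>i<nr. F j (2 ^ j - nr + i) x = 2 powr (real j / 2) * R i (2 ^ j * (x - 1))))"
    using fam unfolding boundary_corrected_family_def by (elim exE conjE) (rule that)
  have Fj: "nl + nr \<le> 2 ^ j"
    "\<And>x k. x \<in> {0..1} \<Longrightarrow> k < nl \<Longrightarrow> F j k x = 2 powr (real j / 2) * L k (2 ^ j * x)"
    "\<And>x k. x \<in> {0..1} \<Longrightarrow> k \<in> {nl..<2 ^ j - nr} \<Longrightarrow> F j k x = 2 powr (real j / 2) * \<theta> (2 ^ j * x - of_int (int k + t))"
    "\<And>x i. x \<in> {0..1} \<Longrightarrow> i < nr \<Longrightarrow> F j (2 ^ j - nr + i) x = 2 powr (real j / 2) * R i (2 ^ j * (x - 1))"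
    using F j by blast+
  consider "k < nl" | "k \<in> {nl..<2 ^ j - nr}" | "2 ^ j - nr \<le> k" using k by force
  then show ?thesis
  proof cases
    case 1
    show ?thesis by (rule L2_space_dilate[of "L k" _ "2 powr (real j / 2)" "2 ^ j" 0]) (use 1 L Fj in auto)
  next
    case 2
    show ?thesis by (rule L2_space_dilate[OF \<theta>]) (use 2 Fj(3) in blast)
  next
    case 3
    define i where "i = k - (2 ^ j - nr)"
    have i: "i < nr" "k = 2 ^ j - nr + i" unfolding i_def using 3 k Fj(1) by auto
    show ?thesis
    proof (rule L2_space_dilate[of "R i" _ "2 powr (real j / 2)" "2 ^ j" "2 ^ j"])
      fix x :: real assume "x \<in> {0..1}"
      then have "F j k x = 2 powr (real j / 2) * R i (2 ^ j * (x - 1))"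
        unfolding i(2) by (rule Fj(4)) (rule i(1))
      then show "F j k x = 2 powr (real j / 2) * R i (2 ^ j * x - 2 ^ j)" by (simp add: right_diff_distrib)
    qed (use R i(1) in auto)
  qed
qed

text \<open>
  Boundedness, together with measurability, puts the basis functions into \<open>L\<^sup>2\<close>.
\<close>

lemma holder_zygmund_bounded: "holder_zygmund r \<theta> \<Longrightarrow> bounded (range \<theta>)"
  unfolding holder_zygmund_def by (metis le0)

lemma level_span_eq: "level_span F j = range (lincomb {..<2 ^ j} (F j))"
  by (auto simp: level_span_def lincomb_def)

lemma cdv_basis_generators:
  assumes "cdv_basis S J0 phiI psiI"
  shows "\<exists>\<phi> \<psi> Nw Rw nl nr ml mr. daubechies_system Nw \<phi> \<psi> \<and> holder_zygmund Rw \<phi> \<and> holder_zygmund Rw \<psi> \<and>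
      boundary_corrected_family J0 \<phi> nl nr phiI \<and> boundary_corrected_family J0 \<psi> ml mr psiI"
  using assms unfolding cdv_basis_def
proof (elim exE conjE, goal_cases)
  case (1 \<phi> \<psi> Nw Rw nl nr ml mr)
  show ?case by (intro exI conjI) (rule 1(3-7))+
qed

lemma cdv_basis_level:
  assumes "cdv_basis S J0 phiI psiI" and j: "J0 \<le> j"
  shows "(\<forall>k<2 ^ j. \<forall>l<2 ^ j. L2_inner (phiI j k) (phiI j l) = (if k = l then 1 else 0)) \<and>
    ae_equal_sets (level_span phiI (Suc j))
             {v. \<exists>u\<in>level_span phiI j. \<exists>w\<in>level_span psiI j. v = (\<lambda>x. u x + w x)}"
  using assms(1) unfolding cdv_basis_def
proof (elim exE conjE, goal_cases)
  case (1 \<phi> \<psi> Nw Rw nl nr ml mr)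
  show ?case using 1(8)[rule_format, OF j] by (elim conjE) (intro conjI)
qed

lemma cdv_basis_dense:
  assumes "cdv_basis S J0 phiI psiI"
  shows "\<forall>h\<in>L2_space. \<forall>e>0. \<exists>J\<ge>J0. \<exists>u\<in>level_span phiI J0. \<exists>w :: nat \<Rightarrow> real \<Rightarrow> real.
           (\<forall>j\<in>{J0..<J}. w j \<in> level_span psiI j) \<and>
           L2_dist h (\<lambda>x. u x + (\<Sum>j\<in>{J0..<J}. w j x)) < e"
  using assms unfolding cdv_basis_def
proof (elim exE conjE, goal_cases)
  case (1 \<phi> \<psi> Nw Rw nl nr ml mr)
  show ?case by (rule 1(9))
qed

locale cdv_wavelets =
  fixes S :: real and J0 :: nat and phiI psiI :: "nat \<Rightarrow> nat \<Rightarrow> real \<Rightarrow> real"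
  assumes cdv: "cdv_basis S J0 phiI psiI"
begin

lemma phi_L2: "J0 \<le> j \<Longrightarrow> k < 2 ^ j \<Longrightarrow> phiI j k \<in> L2_space"
  and psi_L2: "J0 \<le> j \<Longrightarrow> k < 2 ^ j \<Longrightarrow> psiI j k \<in> L2_space"
proof -
  obtain \<phi> \<psi> Nw Rw nl nr ml mr where
    d: "daubechies_system Nw \<phi> \<psi>" "holder_zygmund Rw \<phi>" "holder_zygmund Rw \<psi>"
      "boundary_corrected_family J0 \<phi> nl nr phiI" "boundary_corrected_family J0 \<psi> ml mr psiI"
    using cdv_basis_generators[OF cdv] by blast
  have \<phi>m: "\<phi> \<in> borel_measurable borel" using d(1) unfolding daubechies_system_def by blast
  have \<psi>m: "\<psi> \<in> borel_measurable borel"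
  proof -
    obtain h :: "int \<Rightarrow> real" and a q :: int and \<sigma> :: real where
      "\<forall>x. \<psi> x = sqrt 2 * (\<Sum>k\<in>{a..<a + 2 * int Nw}.
            \<sigma> * (-1) powi (2 * q + 1 - k) * h k * \<phi> (2 * x - of_int (2 * q + 1 - k)))"
      using d(1) unfolding daubechies_system_def by blast
    then have "\<psi> = (\<lambda>x. sqrt 2 * (\<Sum>k\<in>{a..<a + 2 * int Nw}.
            \<sigma> * (-1) powi (2 * q + 1 - k) * h k * \<phi> (2 * x - of_int (2 * q + 1 - k))))" by blast
    also have "\<dots> \<in> borel_measurable borel" using \<phi>m by measurable
    finally show ?thesis .
  qed
  show "J0 \<le> j \<Longrightarrow> k < 2 ^ j \<Longrightarrow> phiI j k \<in> L2_space"
    by (rule boundary_family_L2[OF d(4) \<phi>m holder_zygmund_bounded[OF d(2)]])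
  show "J0 \<le> j \<Longrightarrow> k < 2 ^ j \<Longrightarrow> psiI j k \<in> L2_space"
    by (rule boundary_family_L2[OF d(5) \<psi>m holder_zygmund_bounded[OF d(3)]])
qed

lemma phi_orthonormal: "J0 \<le> j \<Longrightarrow> orthonormal_system {..<2 ^ j} (phiI j)"
proof -
  assume j: "J0 \<le> j"
  from cdv_basis_level[OF cdv j] show ?thesis
    using j phi_L2[OF j] unfolding orthonormal_system_def by auto
qed

lemma span_L2:
  assumes "J0 \<le> j" shows "level_span phiI j \<subseteq> L2_space" "level_span psiI j \<subseteq> L2_space"
  unfolding level_span_def using phi_L2[OF assms] psi_L2[OF assms] by (auto intro!: L2_space_sum L2_space_scale)

lemma span_step:
  assumes j: "J0 \<le> j" and u: "u \<in> level_span phiI j" and w: "w \<in> level_span psiI j"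
  shows "\<exists>v\<in>level_span phiI (Suc j). L2_dist (\<lambda>x. u x + w x) v = 0"
proof -
  have "(\<lambda>x. u x + w x) \<in> {v. \<exists>u\<in>level_span phiI j. \<exists>w\<in>level_span psiI j. v = (\<lambda>x. u x + w x)}"
    using u w by blast
  then have "\<exists>v\<in>level_span phiI (Suc j). AE x in cube_measure. v x = u x + w x"
    using cdv_basis_level[OF cdv j, THEN conjunct2] unfolding ae_equal_sets_def by (elim conjE) (drule (1) bspec)
  then obtain v where v: "v \<in> level_span phiI (Suc j)" "AE x in cube_measure. v x = u x + w x"
    by blast
  have uw: "(\<lambda>x. u x + w x) \<in> L2_space" using u w span_L2[OF j] by (intro L2_space_add) auto
  have "v \<in> L2_space" using v(1) span_L2(1)[of "Suc j"] j by auto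
  then have "L2_dist (\<lambda>x. u x + w x) v = L2_dist (\<lambda>x. u x + w x) (\<lambda>x. u x + w x)"
    using uw v(2) by (intro L2_dist_cong_AE) (auto dest: L2_spaceD)
  then show ?thesis using v(1) by auto
qed

text \<open>
  The identities \<open>V\<^sub>j\<^sub>+\<^sub>1 = V\<^sub>j + W\<^sub>j\<close> hold up to null sets only, so a multiscale sum is represented in
  \<open>V\<^sub>J\<close> by a function at distance \<open>0\<close> rather than by itself.
\<close>

lemma multiscale_span:
  assumes u: "u \<in> level_span phiI J0" and J: "J0 \<le> J" and w: "\<And>j. j \<in> {J0..<J} \<Longrightarrow> w j \<in> level_span psiI j"
  shows "(\<lambda>x. u x + (\<Sum>j\<in>{J0..<J}. w j x)) \<in> L2_space \<and>
    (\<exists>v\<in>level_span phiI J. L2_dist (\<lambda>x. u x + (\<Sum>j\<in>{J0..<J}. w j x)) v = 0)"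
  using J w
proof (induction J rule: dec_induct)
  case base
  then show ?case using u span_L2[of J0] by (auto intro!: bexI[of _ u])
next
  case (step J)
  let ?s = "\<lambda>x. u x + (\<Sum>j\<in>{J0..<J}. w j x)"
  have sL: "?s \<in> L2_space" and "\<exists>v\<in>level_span phiI J. L2_dist ?s v = 0"
    using step by auto
  then obtain v where v: "v \<in> level_span phiI J" "L2_dist ?s v = 0" by blast
  have wJ: "w J \<in> level_span psiI J" using step by auto
  obtain v' where v': "v' \<in> level_span phiI (Suc J)" "L2_dist (\<lambda>x. v x + w J x) v' = 0"
    using span_step[OF step(1) v(1) wJ] by blast
  have eq: "(\<lambda>x. u x + (\<Sum>j\<in>{J0..<Suc J}. w j x)) = (\<lambda>x. ?s x + w J x)"
    using step(1) by (simp add: add.assoc)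
  have L: "v \<in> L2_space" "w J \<in> L2_space" "v' \<in> L2_space"
    using v v' wJ span_L2[OF step(1)] span_L2[of "Suc J"] step(1) by auto
  have "L2_dist (\<lambda>x. ?s x + w J x) v' \<le> L2_dist (\<lambda>x. ?s x + w J x) (\<lambda>x. v x + w J x) + L2_dist (\<lambda>x. v x + w J x) v'"
    using sL L by (intro L2_dist_triangle) auto
  also have "\<dots> = 0" using v(2) v'(2) by (simp add: L2_dist_def)
  finally have "L2_dist (\<lambda>x. ?s x + w J x) v' = 0" using L2_dist_nonneg by (simp add: order.antisym)
  then show ?case unfolding eq using v'(1) sL L by auto
qed

lemma approximable_line:
  assumes h: "h \<in> L2_space"
  shows "approximable (\<lambda>J. {..<2 ^ J}) phiI h"
  unfolding approximable_def
proof (intro conjI h LIMSEQ_I)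
  fix \<epsilon> :: real assume "0 < \<epsilon>"
  from cdv_basis_dense[OF cdv, THEN bspec, OF h, THEN spec, THEN mp, OF \<open>0 < \<epsilon>\<close>]
  obtain J u w where J: "J0 \<le> J" and u: "u \<in> level_span phiI J0"
    and wB: "\<forall>j\<in>{J0..<J}. w j \<in> level_span psiI j"
    and close: "L2_dist h (\<lambda>x. u x + (\<Sum>j\<in>{J0..<J}. w j x)) < \<epsilon>"
    by (elim exE conjE bexE) (rule that)
  have w: "w j \<in> level_span psiI j" if "j \<in> {J0..<J}" for j using wB that by (rule bspec)
  let ?s = "\<lambda>x. u x + (\<Sum>j\<in>{J0..<J}. w j x)"
  show "\<exists>N. \<forall>j\<ge>N. norm (L2_dist h (os_proj {..<2 ^ j} (phiI j) h) - 0) < \<epsilon>"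
  proof (intro exI[of _ J] allI impI)
    fix j assume j: "J \<le> j"
    define w' where "w' i = (if i < J then w i else (\<lambda>_. 0))" for i
    have zero: "(\<lambda>_. 0) \<in> level_span psiI i" for i
      unfolding level_span_def by (intro CollectI exI[of _ "\<lambda>_. 0"]) simp
    have eq: "(\<lambda>x. u x + (\<Sum>i\<in>{J0..<j}. w' i x)) = ?s"
    proof -
      have "(\<Sum>i\<in>{J0..<j}. w' i x) = (\<Sum>i\<in>{J0..<J}. w i x)" for x
        by (rule sum.mono_neutral_cong_right) (use j in \<open>auto simp: w'_def\<close>)
      then show ?thesis by simp
    qed
    have "w' i \<in> level_span psiI i" if "i \<in> {J0..<j}" for i
      using w[of i] zero that by (auto simp: w'_def)
    then have sL: "?s \<in> L2_space" and "\<exists>v\<in>level_span phiI j. L2_dist ?s v = 0"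
      using multiscale_span[OF u, of j w'] J j unfolding eq by auto
    then obtain v where v: "v \<in> level_span phiI j" "L2_dist ?s v = 0" by blast
    have J0j: "J0 \<le> j" using J j by simp
    obtain a where a: "v = lincomb {..<2 ^ j} (phiI j) a" using v(1) unfolding level_span_eq by auto
    have "L2_dist h (os_proj {..<2 ^ j} (phiI j) h) \<le> L2_dist h v"
      unfolding a by (rule os_proj_nearest[OF phi_orthonormal[OF J0j] h])
    also have "\<dots> \<le> L2_dist h ?s + L2_dist ?s v"
      using v(1) span_L2[OF J0j] by (intro L2_dist_triangle h sL) auto
    finally show "norm (L2_dist h (os_proj {..<2 ^ j} (phiI j) h) - 0) < \<epsilon>"
      using close v(2) by simp
  qed
qed

definition index_set :: "nat \<Rightarrow> ('n::finite \<Rightarrow> nat) set" where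
  "index_set J = {\<kappa>. \<forall>l. \<kappa> l < 2 ^ J}"

lemma index_set_eq: "index_set J = PiE UNIV (\<lambda>_. {..<2 ^ J})"
  by (auto simp: index_set_def PiE_iff)

lemma finite_index_set: "finite (index_set J :: ('n::finite \<Rightarrow> nat) set)"
  unfolding index_set_eq by (intro finite_PiE) auto

lemma card_index_set: "card (index_set J :: ('n::finite \<Rightarrow> nat) set) = 2 ^ (J * CARD('n))"
  unfolding index_set_eq by (subst card_PiE) (auto simp: power_mult)

lemma tensor_orthonormal:
  assumes J: "J0 \<le> J"
  shows "orthonormal_system (index_set J) (tensor_scaling phiI J :: ('n::finite \<Rightarrow> nat) \<Rightarrow> real ^ 'n \<Rightarrow> real)"
  unfolding orthonormal_system_def
proof (intro conjI ballI finite_index_set)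
  fix \<kappa> :: "'n \<Rightarrow> nat" assume k: "\<kappa> \<in> index_set J"
  then have L: "phiI J (\<kappa> l) \<in> L2_space" for l using phi_L2[OF J] by (auto simp: index_set_def)
  then show "tensor_scaling phiI J \<kappa> \<in> L2_space"
    unfolding tensor_scaling_def[abs_def] by (rule tensor_L2)
  fix \<kappa>' :: "'n \<Rightarrow> nat" assume k': "\<kappa>' \<in> index_set J"
  then have L': "phiI J (\<kappa>' l) \<in> L2_space" for l using phi_L2[OF J] by (auto simp: index_set_def)
  have "L2_inner (tensor_scaling phiI J \<kappa>) (tensor_scaling phiI J \<kappa>')
      = (\<Prod>l\<in>UNIV. L2_inner (phiI J (\<kappa> l)) (phiI J (\<kappa>' l)))"
    unfolding tensor_scaling_def[abs_def] by (rule tensor_inner[OF L L'])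
  also have "\<dots> = (\<Prod>l\<in>UNIV. if \<kappa> l = \<kappa>' l then 1 else 0)"
    using phi_orthonormal[OF J] k k' by (intro prod.cong) (auto simp: orthonormal_system_def index_set_def)
  also have "\<dots> = (if \<kappa> = \<kappa>' then 1 else 0)"
  proof (cases "\<kappa> = \<kappa>'")
    case False
    then obtain l where "\<kappa> l \<noteq> \<kappa>' l" by (auto simp: fun_eq_iff)
    then show ?thesis using False by (auto intro!: prod_zero)
  qed simp
  finally show "L2_inner (tensor_scaling phiI J \<kappa>) (tensor_scaling phiI J \<kappa>') = (if \<kappa> = \<kappa>' then 1 else 0)" .
qed

text \<open>
  Let \<open>p\<^sub>l\<close> be the projection of \<open>u\<^sub>l\<close>.  As \<open>\<langle>u\<^sub>l, p\<^sub>l\<rangle> = \<parallel>p\<^sub>l\<parallel>\<^sup>2\<close>, the squared distance of the two tensor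
  products is the product of the \<open>\<parallel>u\<^sub>l\<parallel>\<^sup>2\<close> minus the product of the \<open>\<parallel>p\<^sub>l\<parallel>\<^sup>2\<close>, which tends to \<open>0\<close> factor
  by factor.
\<close>

lemma approximable_tensor:
  fixes u :: "'n::finite \<Rightarrow> real \<Rightarrow> real"
  assumes u: "\<And>l. u l \<in> L2_space"
  shows "approximable index_set (tensor_scaling phiI) (\<lambda>x :: real ^ 'n. \<Prod>l\<in>UNIV. u l (x $ l))"
proof (rule approximableI[where start = J0, OF tensor_orthonormal])
  show uL: "(\<lambda>x :: real ^ 'n. \<Prod>l\<in>UNIV. u l (x $ l)) \<in> L2_space" by (rule tensor_L2[OF u])
  define p where "p J l = os_proj {..<2 ^ J} (phiI J) (u l)" for J l
  define a where "a J \<kappa> = (\<Prod>l\<in>UNIV. L2_inner (u l) (phiI J (\<kappa> l)))" for J and \<kappa> :: "'n \<Rightarrow> nat"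
  have lin: "lincomb (index_set J) (tensor_scaling phiI J) (a J) = (\<lambda>x :: real ^ 'n. \<Prod>l\<in>UNIV. p J l (x $ l))" for J
  proof
    fix x :: "real ^ 'n"
    have "lincomb (index_set J) (tensor_scaling phiI J) (a J) x
        = (\<Sum>\<kappa>\<in>PiE UNIV (\<lambda>_. {..<2 ^ J}). \<Prod>l\<in>UNIV. L2_inner (u l) (phiI J (\<kappa> l)) * phiI J (\<kappa> l) (x $ l))"
      unfolding lincomb_def index_set_eq a_def tensor_scaling_def prod.distrib ..
    also have "\<dots> = (\<Prod>l\<in>UNIV. p J l (x $ l))"
      unfolding p_def os_proj_def lincomb_def by (rule prod_sum_PiE[symmetric]) auto
    finally show "lincomb (index_set J) (tensor_scaling phiI J) (a J) x = (\<Prod>l\<in>UNIV. p J l (x $ l))" .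
  qed
  let ?N = "\<lambda>l. (L2_norm (u l))\<^sup>2"
  let ?q = "\<lambda>J. \<Prod>l\<in>UNIV. ?N l - (L2_dist (u l) (p J l))\<^sup>2"
  have sq: "(L2_dist (\<lambda>x :: real ^ 'n. \<Prod>l\<in>UNIV. u l (x $ l)) (lincomb (index_set J) (tensor_scaling phiI J) (a J)))\<^sup>2
      = (\<Prod>l\<in>UNIV. ?N l) - ?q J" if J: "J0 \<le> J" for J
  proof -
    have pL: "p J l \<in> L2_space" for l unfolding p_def by (rule os_proj_L2[OF phi_orthonormal[OF J]])
    have up: "L2_inner (u l) (p J l) = ?N l - (L2_dist (u l) (p J l))\<^sup>2"
      and pp: "L2_inner (p J l) (p J l) = ?N l - (L2_dist (u l) (p J l))\<^sup>2" for l
    proof -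
      have 1: "L2_inner (u l) (p J l) = (\<Sum>k\<in>{..<2 ^ J}. (L2_inner (u l) (phiI J k))\<^sup>2)"
        unfolding p_def os_proj_def by (subst L2_inner_lincomb[OF phi_orthonormal[OF J] u]) (simp add: power2_eq_square)
      have 2: "L2_inner (p J l) (p J l) = (\<Sum>k\<in>{..<2 ^ J}. (L2_inner (u l) (phiI J k))\<^sup>2)"
        unfolding L2_norm_square[symmetric] p_def os_proj_def by (rule L2_norm_lincomb[OF phi_orthonormal[OF J]])
      have "(L2_dist (u l) (p J l))\<^sup>2 = ?N l - 2 * L2_inner (u l) (p J l) + L2_inner (p J l) (p J l)"
        unfolding L2_dist_def L2_norm_diff_square[OF u pL] by (simp add: L2_norm_square)
      with 1 2 show "L2_inner (u l) (p J l) = ?N l - (L2_dist (u l) (p J l))\<^sup>2"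
        "L2_inner (p J l) (p J l) = ?N l - (L2_dist (u l) (p J l))\<^sup>2" by linarith+
    qed
    show ?thesis
      unfolding lin L2_dist_def L2_norm_diff_square[OF uL tensor_L2[OF pL]]
      unfolding L2_norm_square[of "\<lambda>x. \<Prod>l\<in>UNIV. u l (x $ l)"] L2_norm_square[of "\<lambda>x. \<Prod>l\<in>UNIV. p J l (x $ l)"]
        tensor_inner[OF u u] tensor_inner[OF u pL] tensor_inner[OF pL pL] up pp
      by (simp add: L2_norm_square[symmetric] L2_dist_def)
  qed
  have "(\<lambda>J. L2_dist (u l) (p J l)) \<longlonglongrightarrow> 0" for l
    using approximable_line[OF u] by (simp add: approximable_def p_def)
  then have "(\<lambda>J. (\<Prod>l\<in>UNIV. ?N l) - ?q J) \<longlonglongrightarrow> (\<Prod>l\<in>UNIV. ?N l) - (\<Prod>l\<in>UNIV. ?N l - 0\<^sup>2)"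
    by (intro tendsto_intros)
  then have "(\<lambda>J. sqrt ((\<Prod>l\<in>UNIV. ?N l) - ?q J)) \<longlonglongrightarrow> 0"
    using tendsto_real_sqrt by fastforce
  moreover have "\<forall>\<^sub>F J in sequentially. sqrt ((\<Prod>l\<in>UNIV. ?N l) - ?q J)
      = L2_dist (\<lambda>x :: real ^ 'n. \<Prod>l\<in>UNIV. u l (x $ l)) (lincomb (index_set J) (tensor_scaling phiI J) (a J))"
    using eventually_ge_at_top[of J0] by eventually_elim (simp add: sq[symmetric])
  ultimately show "(\<lambda>J. L2_dist (\<lambda>x :: real ^ 'n. \<Prod>l\<in>UNIV. u l (x $ l)) (lincomb (index_set J) (tensor_scaling phiI J) (a J))) \<longlonglongrightarrow> 0"
    by (rule Lim_transform_eventually)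
qed

lemma approximable_cube:
  fixes f :: "real ^ 'n::finite \<Rightarrow> real"
  assumes fm: "f \<in> borel_measurable cube_measure" and f: "\<And>x. 0 \<le> f x" "\<And>x. f x \<le> 1"
  shows "approximable index_set (tensor_scaling phiI) f"
proof (rule approximable_unit_valued[where start = J0, OF tensor_orthonormal _ fm f])
  fix A :: "(real ^ 'n) set" assume A: "A \<in> sets borel"
  let ?G = "range (\<lambda>a :: real ^ 'n. {..a})"
  show "approximable index_set (tensor_scaling phiI) (indicator A)"
  proof (rule approximable_indicator[where start = J0 and G = ?G, OF tensor_orthonormal _ borel_eq_atMost _ _ A])
    show "Int_stable ?G"
    proof (rule Int_stableI)
      fix B C assume "B \<in> ?G" "C \<in> ?G"
      then obtain b c where "B = {..b}" "C = {..c}" by auto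
      then have "B \<inter> C = {..inf b c}" by auto
      then show "B \<inter> C \<in> ?G" by auto
    qed
    show "approximable index_set (tensor_scaling phiI) (indicator B)" if "B \<in> ?G" for B
    proof -
      from that obtain b where b: "B = {..b}" by auto
      have "(\<lambda>x. \<Prod>l\<in>UNIV. indicator {..b $ l} (x $ l)) = (indicator B :: real ^ 'n \<Rightarrow> real)"
      proof
        fix x
        show "(\<Prod>l\<in>UNIV. indicator {..b $ l} (x $ l)) = (indicator B x :: real)"
        proof (cases "x \<le> b")
          case True then show ?thesis by (simp add: b less_eq_vec_def)
        next
          case False
          then obtain l where "\<not> x $ l \<le> b $ l" by (auto simp: less_eq_vec_def)
          then have "(indicator {..b $ l} (x $ l) :: real) = 0" by simp
          then have "(\<Prod>l\<in>UNIV. indicator {..b $ l} (x $ l)) = (0 :: real)" by (intro prod_zero bexI[of _ l]) auto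
          then show ?thesis using False by (simp add: b)
        qed
      qed
      moreover have "indicator {..r} \<in> L2_space" for r :: real
        by (rule L2_space_bounded[where B = 1]) (auto intro!: borel_measurable_cubeI simp: indicator_def)
      ultimately show ?thesis using approximable_tensor[of "\<lambda>l. indicator {..b $ l}"] by simp
    qed
    show "approximable index_set (tensor_scaling phiI) (\<lambda>_ :: real ^ 'n. 1)"
      using approximable_tensor[of "\<lambda>_ _. 1"] by simp
  qed
qed

text \<open>
  Elements of \<open>V_space\<close> are genuine linear combinations and not classes of functions, so equality of
  coefficients is equality of functions and the choice in \<open>L2_proj\<close> is unique.
\<close>

lemma P_proj_eq:
  fixes h :: "real ^ 'n::finite \<Rightarrow> real"
  assumes J: "J0 \<le> J" and h: "h \<in> L2_space"
  shows "P_proj phiI J h = os_proj (index_set J) (tensor_scaling phiI J) h"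
proof -
  note os = tensor_orthonormal[OF J, where 'n = 'n]
  have V: "V_space phiI J = range (lincomb (index_set J) (tensor_scaling phiI J :: ('n \<Rightarrow> nat) \<Rightarrow> real ^ 'n \<Rightarrow> real))"
    by (auto simp: V_space_def lincomb_def index_set_def)
  show ?thesis
    unfolding P_proj_def L2_proj_def
  proof (rule some_equality)
    show "os_proj (index_set J) (tensor_scaling phiI J) h \<in> V_space phiI J \<and>
      (\<forall>v\<in>V_space phiI J. L2_inner (\<lambda>x. h x - os_proj (index_set J) (tensor_scaling phiI J) h x) v = 0)"
    proof (intro conjI ballI)
      show "os_proj (index_set J) (tensor_scaling phiI J) h \<in> V_space phiI J"
        unfolding V os_proj_def by simp
      fix v :: "real ^ 'n \<Rightarrow> real" assume "v \<in> V_space phiI J"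
      then obtain a where v: "v = lincomb (index_set J) (tensor_scaling phiI J) a" using V by auto
      show "L2_inner (\<lambda>x. h x - os_proj (index_set J) (tensor_scaling phiI J) h x) v = 0"
        unfolding v
        by (subst L2_inner_diff_left[OF h os_proj_L2[OF os] lincomb_L2[OF os]])
           (simp add: L2_inner_lincomb[OF os h] L2_inner_lincomb[OF os lincomb_L2[OF os]]
             os_proj_def L2_inner_lincomb_basis[OF os])
    qed
    fix p :: "real ^ 'n \<Rightarrow> real" assume p: "p \<in> V_space phiI J \<and> (\<forall>v\<in>V_space phiI J. L2_inner (\<lambda>x. h x - p x) v = 0)"
    then obtain a where a: "p = lincomb (index_set J) (tensor_scaling phiI J) a" using V by auto
    have "a k = L2_inner h (tensor_scaling phiI J k)" if k: "k \<in> index_set J" for k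
    proof -
      have "tensor_scaling phiI J k = lincomb (index_set J) (tensor_scaling phiI J) (\<lambda>i. if i = k then 1 else 0)"
        unfolding lincomb_def using k by (simp add: finite_index_set if_distrib[of "\<lambda>t. t * _"] cong: if_cong)
      then have "tensor_scaling phiI J k \<in> V_space phiI J" unfolding V by blast
      then have "L2_inner (\<lambda>x. h x - p x) (tensor_scaling phiI J k) = 0" using p by blast
      then show ?thesis
        unfolding a by (subst (asm) L2_inner_diff_left[OF h lincomb_L2[OF os] os_L2[OF os k]])
          (simp add: L2_inner_lincomb_basis[OF os k])
    qed
    then show "p = os_proj (index_set J) (tensor_scaling phiI J) h"
      unfolding a os_proj_def lincomb_def by (intro ext sum.cong) auto
  qed
qed

section \<open>The function classes\<close>

lemma F_class_L2: "f \<in> F_class phiI J0 M s \<Longrightarrow> f \<in> L2_space"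
  by (simp add: F_class_def besov_ball_def)

lemma F_class_mono:
  assumes "s \<le> s'"
  shows "F_class phiI J0 M s' \<subseteq> F_class phiI J0 M s"
proof -
  have "besov_norm phiI J0 s h \<le> besov_norm phiI J0 s' h" for h :: "real ^ 'a::finite \<Rightarrow> real"
    unfolding besov_norm_def using assms
    by (intro add_mono SUP_mono' ennreal_leI mult_right_mono) (auto intro!: powr_mono mult_left_mono)
  then show ?thesis unfolding F_class_def besov_ball_def by (auto intro: order.trans)
qed

lemma F_class_cong_AE:
  fixes f f' :: "real ^ 'n::finite \<Rightarrow> real"
  assumes f: "f \<in> F_class phiI J0 M s" and f': "f' \<in> borel_measurable cube_measure"
    and ae: "AE x in cube_measure. f' x = f x"
  shows "f' \<in> F_class phiI J0 M s"
proof -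
  note fL = F_class_L2[OF f]
  note [measurable] = L2_spaceD[OF fL] f'
  have f'L: "f' \<in> L2_space"
    unfolding L2_space_def
    using integrable_square[OF fL] ae
    by (auto simp: f' elim!: integrable_cong_AE_imp intro!: integrable_cong_AE_imp)
  have "os_proj (index_set J) (tensor_scaling phiI J) f' = os_proj (index_set J) (tensor_scaling phiI J) f" if J: "J0 \<le> J" for J
    unfolding os_proj_def lincomb_def
  proof (intro ext sum.cong refl arg_cong2[where f = "(*)"])
    fix k :: "'n \<Rightarrow> nat" assume "k \<in> index_set J"
    then have [measurable]: "tensor_scaling phiI J k \<in> borel_measurable cube_measure"
      using os_L2[OF tensor_orthonormal[OF J]] by (auto dest: L2_spaceD)
    show "L2_inner f' (tensor_scaling phiI J k) = L2_inner f (tensor_scaling phiI J k)"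
      by (rule L2_inner_cong_AE) (use ae in auto)
  qed
  then have "P_proj phiI J f' = P_proj phiI J f" if "J0 \<le> J" for J
    using that by (simp add: P_proj_eq fL f'L)
  then have "besov_norm phiI J0 s f' = besov_norm phiI J0 s f"
    unfolding besov_norm_def Q_proj_def by (auto intro!: arg_cong2[where f = "(+)"] SUP_cong)
  moreover have "AE x in cube_measure. 0 \<le> f' x \<and> f' x \<le> 1"
    using f ae unfolding F_class_def by auto
  ultimately show ?thesis using f f'L unfolding F_class_def besov_ball_def by simp
qed

lemma zero_in_F_class:
  assumes M: "0 < M"
  shows "(\<lambda>_. 0) \<in> F_class phiI J0 M s"
proof -
  have "P_proj phiI J (\<lambda>_ :: real ^ 'a::finite. 0) = (\<lambda>_. 0)" if "J0 \<le> J" for J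
    by (simp add: P_proj_eq[OF that] os_proj_def lincomb_def L2_inner_def fun_eq_iff)
  then have "besov_norm phiI J0 s (\<lambda>_ :: real ^ 'a. 0) = 0"
    by (simp add: besov_norm_def Q_proj_def L2_norm_def)
  then show ?thesis by (simp add: F_class_def besov_ball_def)
qed

text \<open>
  The increments \<open>Q\<^sub>j f\<close> decay geometrically, and density of the spaces \<open>V\<^sub>j\<close> makes their sum converge
  to \<open>f - P\<^sub>J f\<close>.
\<close>

lemma F_class_bias:
  fixes f :: "real ^ 'n::finite \<Rightarrow> real"
  assumes f: "f \<in> F_class phiI J0 M s" and s: "0 < s" and M: "0 < M"
    and r: "\<And>x. 0 \<le> f x" "\<And>x. f x \<le> 1" and J: "J0 \<le> J"
  shows "L2_dist f (os_proj (index_set J) (tensor_scaling phiI J) f)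
    \<le> M / (1 - 2 powr (- s)) * 2 powr (- (real J * s))"
proof -
  note fL = F_class_L2[OF f]
  let ?p = "\<lambda>j. os_proj (index_set j) (tensor_scaling phiI j) f"
  define q where "q = 2 powr (- s)"
  have q: "0 < q" "q < 1" using s by (auto simp: q_def powr_less_one)
  have qpow: "2 powr (- (real j * s)) = q ^ j" for j
    by (simp add: q_def powr_powr powr_realpow[symmetric] mult.commute)
  have pL: "?p j \<in> L2_space" if "J0 \<le> j" for j by (rule os_proj_L2[OF tensor_orthonormal[OF that]])
  have step: "L2_dist (?p (Suc j)) (?p j) \<le> M * q ^ j" if j: "J0 \<le> j" for j
  proof -
    have "ennreal (2 powr (real j * s) * L2_norm (Q_proj phiI j f)) \<le> besov_norm phiI J0 s f"
      unfolding besov_norm_def using j by (intro add_increasing SUP_upper) auto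
    also have "\<dots> \<le> ennreal M" using f by (simp add: F_class_def besov_ball_def)
    finally have "2 powr (real j * s) * L2_norm (Q_proj phiI j f) \<le> M"
      using M by (simp add: ennreal_le_iff)
    then have "2 powr (- (real j * s)) * (2 powr (real j * s) * L2_norm (Q_proj phiI j f)) \<le> 2 powr (- (real j * s)) * M"
      by (intro mult_left_mono) auto
    moreover have "2 powr (- (real j * s)) * (2 powr (real j * s) * L2_norm (Q_proj phiI j f)) = L2_norm (Q_proj phiI j f)"
      by (simp add: powr_minus)
    ultimately have "L2_norm (Q_proj phiI j f) \<le> M * q ^ j"
      unfolding qpow by (simp only: mult.commute)
    then show ?thesis
      using j by (simp add: L2_dist_def Q_proj_def P_proj_eq fL)
  qed
  have tele: "L2_dist (?p K) (?p J) \<le> (\<Sum>j\<in>{J..<K}. M * q ^ j)" if "J \<le> K" for K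
    using that
  proof (induction K rule: dec_induct)
    case (step K)
    have "L2_dist (?p (Suc K)) (?p J) \<le> L2_dist (?p (Suc K)) (?p K) + L2_dist (?p K) (?p J)"
      using J step by (intro L2_dist_triangle pL) auto
    also have "L2_dist (?p (Suc K)) (?p K) \<le> M * q ^ K"
      using J step by (intro \<open>\<And>j. J0 \<le> j \<Longrightarrow> L2_dist (?p (Suc j)) (?p j) \<le> M * q ^ j\<close>) auto
    finally show ?case using step by simp
  qed simp
  have geo: "(\<Sum>j\<in>{J..<K}. M * q ^ j) \<le> M / (1 - q) * q ^ J" if "J \<le> K" for K
  proof -
    have "(\<Sum>j\<in>{J..<K}. M * q ^ j) * (1 - q) = M * (q ^ J - q ^ K)"
      using that
    proof (induction K rule: dec_induct)
      case (step K)
      have "(\<Sum>j\<in>{J..<Suc K}. M * q ^ j) * (1 - q) = (\<Sum>j\<in>{J..<K}. M * q ^ j) * (1 - q) + M * q ^ K * (1 - q)"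
        using step(1) by (simp add: distrib_right)
      then show ?case unfolding step(3) by (simp add: algebra_simps)
    qed simp
    also have "\<dots> \<le> M * q ^ J" using M q by simp
    finally show ?thesis using q by (simp add: field_simps)
  qed
  have "(\<lambda>K. L2_dist f (?p K) + M / (1 - q) * q ^ J) \<longlonglongrightarrow> 0 + M / (1 - q) * q ^ J"
    using approximable_cube[OF L2_spaceD[OF fL] r] unfolding approximable_def by (intro tendsto_intros) auto
  moreover have "\<forall>\<^sub>F K in sequentially. L2_dist f (?p J) \<le> L2_dist f (?p K) + M / (1 - q) * q ^ J"
    using eventually_ge_at_top[of J]
  proof eventually_elim
    case (elim K)
    have "L2_dist f (?p J) \<le> L2_dist f (?p K) + L2_dist (?p K) (?p J)"
      using J elim by (intro L2_dist_triangle fL pL) auto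
    then show ?case using tele[OF elim] geo[OF elim] by linarith
  qed
  ultimately have "L2_dist f (?p J) \<le> 0 + M / (1 - q) * q ^ J"
    by (intro tendsto_lowerbound[where F = sequentially]) auto
  then show ?thesis by (simp add: qpow q_def)
qed

end

section \<open>Random balls\<close>

lemma L2_closed_empty: "L2_closed {}"
  unfolding L2_closed_def L2_open_def by (auto intro: exI[of _ 1])

lemma L2_closed_ball:
  assumes a: "a \<in> L2_space"
  shows "L2_closed {h \<in> L2_space. L2_dist h a \<le> r}"
  unfolding L2_closed_def L2_open_def
proof (intro conjI ballI)
  fix h assume h: "h \<in> L2_space - {h \<in> L2_space. L2_dist h a \<le> r}"
  show "\<exists>e>0. \<forall>u\<in>L2_space. L2_dist u h < e \<longrightarrow> u \<in> L2_space - {h \<in> L2_space. L2_dist h a \<le> r}"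
  proof (intro exI[of _ "L2_dist h a - r"] conjI ballI impI)
    show "0 < L2_dist h a - r" using h by auto
    fix u assume u: "u \<in> L2_space" "L2_dist u h < L2_dist h a - r"
    have "L2_dist h a \<le> L2_dist h u + L2_dist u a" using h u a by (intro L2_dist_triangle) auto
    then show "u \<in> L2_space - {h \<in> L2_space. L2_dist h a \<le> r}" using u by (auto simp: L2_dist_commute)
  qed
qed auto

lemma L2_diam_ball_le:
  assumes a: "a \<in> L2_space" and r: "0 \<le> r"
  shows "L2_diam {h \<in> L2_space. L2_dist h a \<le> r} \<le> ennreal (2 * r)"
proof -
  have "L2_dist u v \<le> 2 * r" if "u \<in> L2_space" "L2_dist u a \<le> r" "v \<in> L2_space" "L2_dist v a \<le> r" for u v
    using L2_dist_triangle[OF that(1) a that(3)] that by (simp add: L2_dist_commute)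
  then show ?thesis
    unfolding L2_diam_def by (auto intro!: SUP_least ennreal_leI)
qed

lemma random_closed_set_empty: "random_closed_set n (\<lambda>_. {})"
  by (simp add: random_closed_set_def L2_closed_empty)

text \<open>
  The centre takes countably many values, so measurability may be checked for a fixed centre.  Then
  the ball meets an open set if and only if the radius lies in an upward closed set of reals, and such
  a set is Borel.
\<close>

lemma random_closed_set_ball:
  assumes idx: "idx \<in> sample_space n \<rightarrow>\<^sub>M count_space (UNIV :: nat set)"
    and hs: "\<And>i. hs i \<in> L2_space" and r: "r \<in> borel_measurable (sample_space n)"
  shows "random_closed_set n (\<lambda>\<omega>. {h \<in> L2_space. L2_dist h (hs (idx \<omega>)) \<le> r \<omega>})"
  unfolding random_closed_set_def
proof (intro conjI ballI allI impI L2_closed_ball hs)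
  fix U :: "(real ^ 'a \<Rightarrow> real) set" assume U: "L2_open U"
  define Q where "Q i x \<longleftrightarrow> (\<exists>h\<in>U. L2_dist h (hs i) \<le> x)" for i x
  have Q: "Measurable.pred borel (Q i)" for i
  proof -
    have "mono (\<lambda>x. if Q i x then 1 else 0 :: real)" by (auto simp: mono_def Q_def intro: order.trans)
    then have "(\<lambda>x. if Q i x then 1 else 0 :: real) \<in> borel_measurable borel" by (rule borel_measurable_mono)
    then have "{x \<in> space borel. (if Q i x then 1 else 0 :: real) = 1} \<in> sets borel" by measurable
    moreover have "{x \<in> space borel. (if Q i x then 1 else 0 :: real) = 1} = {x \<in> space borel. Q i x}" by auto
    ultimately show ?thesis by (simp only: pred_def)
  qed
  have "Measurable.pred (sample_space n) (\<lambda>\<omega>. Q (idx \<omega>) (r \<omega>))"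
    by (rule measurable_compose_countable[OF measurable_compose[OF r Q] idx])
  moreover have "{\<omega> \<in> space (sample_space n). {h \<in> L2_space. L2_dist h (hs (idx \<omega>)) \<le> r \<omega>} \<inter> U \<noteq> {}}
      = {\<omega> \<in> space (sample_space n). Q (idx \<omega>) (r \<omega>)}"
    using U unfolding L2_open_def Q_def by blast
  ultimately show "{\<omega> \<in> space (sample_space n). {h \<in> L2_space. L2_dist h (hs (idx \<omega>)) \<le> r \<omega>} \<inter> U \<noteq> {}} \<in> sets (sample_space n)"
    by (simp add: pred_def)
qed

lemma random_ball_member:
  assumes idx: "idx \<in> sample_space n \<rightarrow>\<^sub>M count_space (UNIV :: nat set)"
    and r: "r \<in> borel_measurable (sample_space n)"
  shows "{\<omega> \<in> space (sample_space n). f \<in> {h \<in> L2_space. L2_dist h (hs (idx \<omega>)) \<le> r \<omega>}} \<in> sets (sample_space n)"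
proof -
  have "Measurable.pred (sample_space n) (\<lambda>\<omega>. L2_dist f (hs i) \<le> r \<omega>)" for i
    using r by measurable
  then have "Measurable.pred (sample_space n) (\<lambda>\<omega>. L2_dist f (hs (idx \<omega>)) \<le> r \<omega>)"
    by (rule measurable_compose_countable[OF _ idx])
  then have "Measurable.pred (sample_space n) (\<lambda>\<omega>. f \<in> L2_space \<and> L2_dist f (hs (idx \<omega>)) \<le> r \<omega>)"
    by measurable
  then show ?thesis by (simp add: pred_def)
qed

section \<open>Resolution levels and rates\<close>

text \<open>
  The least resolution level \<open>j\<close> with \<open>n powr a \<le> 2 ^ j\<close>.
\<close>

definition level :: "real \<Rightarrow> nat \<Rightarrow> nat" where
  "level a n = nat \<lceil>a * log 2 (real n)\<rceil>"

lemma level_lower: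
  assumes "1 \<le> n" shows "real n powr a \<le> 2 ^ level a n"
proof -
  have "real n powr a = 2 powr (a * log 2 (real n))"
    using assms by (simp add: powr_def log_def)
  also have "\<dots> \<le> 2 powr real (level a n)"
    unfolding level_def by (intro powr_mono) (auto simp: real_nat_ceiling_ge)
  finally show ?thesis by (simp add: powr_realpow)
qed

lemma level_upper:
  assumes "1 \<le> n" "0 \<le> a" shows "2 ^ level a n \<le> 2 * real n powr a"
proof -
  have nn: "0 \<le> a * log 2 (real n)" using assms by simp
  have "2 ^ level a n = 2 powr real (level a n)" by (simp add: powr_realpow)
  also have "\<dots> \<le> 2 powr (1 + a * log 2 (real n))"
  proof (rule powr_mono)
    have "real (level a n) = of_int \<lceil>a * log 2 (real n)\<rceil>" using nn by (simp add: level_def)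
    then show "real (level a n) \<le> 1 + a * log 2 (real n)"
      using of_int_ceiling_le_add_one[of "a * log 2 (real n)"] by linarith
  qed simp
  also have "\<dots> = 2 * 2 powr (a * log 2 (real n))" by (simp add: powr_add)
  also have "2 powr (a * log 2 (real n)) = real n powr a"
    using assms by (simp add: powr_def log_def)
  finally show ?thesis .
qed

lemma level_le:
  assumes "1 \<le> n" "a \<le> 1" shows "level a n \<le> n"
proof -
  have "a * log 2 (real n) \<le> 1 * log 2 (real n)" using assms by (intro mult_right_mono) auto
  also have "\<dots> \<le> real n"
  proof -
    have "log 2 (real n) \<le> log 2 (2 ^ n)" using assms by (subst log_le_cancel_iff) (auto simp: of_nat_less_two_power less_imp_le)
    then show ?thesis by simp
  qed
  finally show ?thesis unfolding level_def by (simp add: ceiling_le_iff nat_le_iff)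
qed

lemma level_eventually:
  assumes "0 < a" shows "\<forall>\<^sub>F n in sequentially. k \<le> level a n"
proof -
  have "filterlim (\<lambda>n. a * log 2 (real n)) at_top sequentially"
  proof -
    have "filterlim (\<lambda>n. a / ln 2 * ln (real n)) at_top sequentially"
      using assms by (intro filterlim_tendsto_pos_mult_at_top[OF tendsto_const]
          filterlim_compose[OF ln_at_top filterlim_real_sequentially]) auto
    then show ?thesis by (simp add: log_def)
  qed
  then have "\<forall>\<^sub>F n in sequentially. real k \<le> a * log 2 (real n)"
    by (rule filterlim_at_top[THEN iffD1, rule_format])
  then show ?thesis
  proof eventually_elim
    case (elim n)
    then show ?case unfolding level_def by (simp add: le_nat_iff le_ceiling_iff)
  qed
qed

text \<open>
  The constant is attained at \<open>n = 5\<close>.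
\<close>

lemma third_ge: "3 \<le> n \<Longrightarrow> real n \<le> 5 * real (n div 3)"
proof -
  assume "3 \<le> n"
  then have "n \<le> 5 * (n div 3)" by presburger
  then show ?thesis by (metis of_nat_mult of_nat_numeral of_nat_le_iff)
qed

text \<open>
  At the level with \<open>2 powr (k (2 \<beta> + d))\<close> of order \<open>n\<close> the squared bias is below the variance, and the
  variance is of order \<open>\<epsilon>\<^sub>n(\<beta>)\<^sup>2\<close>.
\<close>

lemma bias_level_bound:
  assumes n: "3 \<le> n" and \<beta>: "0 < \<beta>" and k: "k = level (1 / (2 * \<beta> + real d)) n"
  shows "(2 powr (- (real k * \<beta>)))\<^sup>2 \<le> 2 ^ (k * d) / real (n div 3)"
    and "2 ^ (k * d) / real (n div 3) \<le> 5 * 2 ^ d * (eps_rate d n \<beta>)\<^sup>2"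
proof -
  have n1: "1 \<le> n" and m: "0 < real (n div 3)" "real (n div 3) \<le> real n" using n by auto
  let ?e = "2 * \<beta> + real d"
  have e: "0 < ?e" using \<beta> by simp
  have two: "(2::real) ^ k = 2 powr real k" by (simp add: powr_realpow)
  have "real n = (real n powr (1 / ?e)) powr ?e" using n e by (simp add: powr_powr)
  also have "\<dots> \<le> (2 ^ k) powr ?e"
    unfolding k by (intro powr_mono2 level_lower[OF n1]) (use e in auto)
  also have "\<dots> = 2 powr (real k * \<beta> * 2) * 2 ^ (k * d)"
    unfolding two by (simp add: powr_powr powr_add[symmetric] powr_realpow[symmetric] algebra_simps)
  finally have "real (n div 3) \<le> 2 powr (real k * \<beta> * 2) * 2 ^ (k * d)" using m by linarith
  moreover have "(2 powr (- (real k * \<beta>)))\<^sup>2 = 1 / 2 powr (real k * \<beta> * 2)"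
    by (simp add: power2_eq_square powr_add[symmetric] powr_minus_divide[symmetric] mult_ac)
  ultimately have "real (n div 3) * (2 powr (- (real k * \<beta>)))\<^sup>2 \<le> 2 ^ (k * d)"
    by (simp add: divide_le_eq mult.commute)
  then show "(2 powr (- (real k * \<beta>)))\<^sup>2 \<le> 2 ^ (k * d) / real (n div 3)"
    using m by (simp add: le_divide_eq mult.commute)
  have "(2::real) ^ (k * d) = (2 ^ k) ^ d" by (simp add: power_mult)
  also have "\<dots> \<le> (2 * real n powr (1 / ?e)) ^ d"
    unfolding k by (intro power_mono level_upper n1) (use e in auto)
  also have "\<dots> = 2 ^ d * real n powr (real d / ?e)"
    using n by (simp add: power_mult_distrib powr_realpow[symmetric] powr_powr)
  also have "real n powr (real d / ?e) = real n * (eps_rate d n \<beta>)\<^sup>2"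
  proof -
    have "real d / ?e = (?e - 2 * \<beta>) / ?e" by simp
    also have "\<dots> = ?e / ?e - 2 * \<beta> / ?e" by (rule diff_divide_distrib)
    also have "?e / ?e = 1" using e by simp
    finally have "real d / ?e = 1 + (- \<beta> / ?e + - \<beta> / ?e)" by simp
    then show ?thesis
      using n unfolding eps_rate_def power2_eq_square by (simp only: powr_add powr_one of_nat_0_le_iff)
  qed
  finally have "2 ^ (k * d) \<le> 2 ^ d * (real n * (eps_rate d n \<beta>)\<^sup>2)" .
  also have "\<dots> \<le> 2 ^ d * (5 * real (n div 3) * (eps_rate d n \<beta>)\<^sup>2)"
    using third_ge[OF n] by (intro mult_left_mono mult_right_mono) auto
  finally show "2 ^ (k * d) / real (n div 3) \<le> 5 * 2 ^ d * (eps_rate d n \<beta>)\<^sup>2"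
    using m by (simp add: field_simps)
qed

text \<open>
  At the level with \<open>2 powr (J (4 b + d))\<close> of order \<open>n\<^sup>2\<close> the approximation error and the square root of the noise of
  the cross-product statistic are both of order \<open>\<rho>\<^sub>n(b)\<close>.
\<close>

lemma signal_level_bound:
  assumes n: "3 \<le> n" and b: "0 < b" and J: "J = level (2 / (4 * b + real d)) n"
  shows "2 powr (- (real J * b)) \<le> rho_rate d n b"
    and "sqrt (2 ^ (J * d)) / real (n div 3) \<le> 5 * 2 ^ d * (rho_rate d n b)\<^sup>2"
proof -
  have n1: "1 \<le> n" and m: "0 < real (n div 3)" using n by auto
  let ?e = "4 * b + real d"
  have e: "0 < ?e" using b by simp
  have two: "(2::real) ^ J = 2 powr real J" by (simp add: powr_realpow)
  have "2 powr (- (real J * b)) = (2 ^ J) powr (- b)" unfolding two by (simp add: powr_powr)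
  also have "\<dots> \<le> (real n powr (2 / ?e)) powr (- b)"
    unfolding J using n b by (intro powr_mono2' level_lower[OF n1]) auto
  also have "\<dots> = rho_rate d n b" by (simp add: powr_powr rho_rate_def)
  finally show "2 powr (- (real J * b)) \<le> rho_rate d n b" .
  have "sqrt (2 ^ (J * d)) \<le> 2 ^ d * real n powr (real d / ?e)"
  proof (rule real_le_lsqrt)
    have "(2::real) ^ (J * d) = (2 ^ J) ^ d" by (simp add: power_mult)
    also have "\<dots> \<le> (2 * real n powr (2 / ?e)) ^ d"
      unfolding J by (intro power_mono level_upper n1) (use e in auto)
    also have "\<dots> = 2 ^ d * (real n powr (real d / ?e))\<^sup>2"
      using n by (simp add: power_mult_distrib powr_realpow[symmetric] powr_powr mult.commute)
    also have "\<dots> \<le> (2 ^ d)\<^sup>2 * (real n powr (real d / ?e))\<^sup>2"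
      by (intro mult_right_mono) (auto simp: power2_eq_square)
    finally show "2 ^ (J * d) \<le> (2 ^ d * real n powr (real d / ?e))\<^sup>2" by (simp add: power_mult_distrib)
  qed auto
  also have "real n powr (real d / ?e) = real n * (rho_rate d n b)\<^sup>2"
  proof -
    have "real d / ?e = (?e - 4 * b) / ?e" by simp
    also have "\<dots> = ?e / ?e - 4 * b / ?e" by (rule diff_divide_distrib)
    also have "?e / ?e = 1" using e by simp
    finally have "real d / ?e = 1 + (- 2 * b / ?e + - 2 * b / ?e)" by simp
    then show ?thesis
      using n unfolding rho_rate_def power2_eq_square by (simp only: powr_add powr_one of_nat_0_le_iff)
  qed
  also have "2 ^ d * (real n * (rho_rate d n b)\<^sup>2) \<le> 2 ^ d * (5 * real (n div 3) * (rho_rate d n b)\<^sup>2)"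
    using third_ge[OF n] by (intro mult_left_mono mult_right_mono) auto
  finally show "sqrt (2 ^ (J * d)) / real (n div 3) \<le> 5 * 2 ^ d * (rho_rate d n b)\<^sup>2"
    using m by (simp add: field_simps)
qed

lemma rho_rate_le_eps_rate:
  assumes "1 \<le> n" "0 < b" "0 \<le> \<beta>" "\<beta> \<le> 2 * b" "1 \<le> d"
  shows "rho_rate d n b \<le> eps_rate d n \<beta>"
  unfolding rho_rate_def eps_rate_def
proof (rule powr_mono)
  have "\<beta> * real d \<le> 2 * b * real d" using assms by (intro mult_right_mono) auto
  then have "\<beta> * (4 * b + real d) \<le> 2 * b * (2 * \<beta> + real d)" by (simp add: algebra_simps)
  moreover have "0 < 2 * \<beta> + real d" "0 < 4 * b + real d" using assms by auto
  ultimately have "\<beta> / (2 * \<beta> + real d) \<le> 2 * b / (4 * b + real d)"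
    by (metis divide_le_eq le_divide_eq times_divide_eq_left)
  then show "- 2 * b / (4 * b + real d) \<le> - \<beta> / (2 * \<beta> + real d)" by simp
qed (use assms in auto)

lemma eps_rate_double: "eps_rate d n (2 * b) = rho_rate d n b"
  by (simp add: eps_rate_def rho_rate_def)

lemma sum_exp_dimensions_le_one:
  assumes "finite A" "1 \<le> d"
  shows "(\<Sum>k\<in>A. exp (- real (2 ^ (k * d)))) \<le> 1"
proof -
  have e: "exp (- 1) \<le> (1 / 2 :: real)"
    using exp_ge_add_one_self[of 1] by (simp add: exp_minus field_simps)
  have "exp (- real (2 ^ (k * d))) \<le> (1 / 2) ^ Suc k" for k
  proof -
    have "Suc k \<le> 2 ^ k" by (simp add: Suc_leI)
    also have "\<dots> \<le> 2 ^ (k * d)" using assms(2) by (intro power_increasing) auto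
    finally have "real (Suc k) \<le> real (2 ^ (k * d))" by (simp only: of_nat_le_iff)
    then have "exp (- real (2 ^ (k * d))) \<le> exp (real (Suc k) * (- 1))" by simp
    also have "\<dots> = exp (- 1) ^ Suc k" by (rule exp_of_nat_mult)
    also have "\<dots> \<le> (1 / 2) ^ Suc k" by (intro power_mono e) auto
    finally show ?thesis .
  qed
  then have "(\<Sum>k\<in>A. exp (- real (2 ^ (k * d)))) \<le> (\<Sum>k\<in>A. (1 / 2) ^ Suc k)" by (rule sum_mono)
  also have "\<dots> \<le> (\<Sum>k. (1 / 2) ^ Suc k)"
    using assms(1) power_half_series by (intro sum_le_suminf) (auto dest: sums_summable)
  also have "\<dots> = 1" using power_half_series by (rule sums_unique[symmetric])
  finally show ?thesis .
qed

section \<open>Statements that hold up to a small probability\<close>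

lemma measure_le_of_emeasure_le:
  "0 \<le> \<delta> \<Longrightarrow> emeasure M E \<le> ennreal \<delta> \<Longrightarrow> measure M E \<le> \<delta>"
  unfolding measure_def by (rule enn2real_leI)

text \<open>
  The exceptional event is exhibited as a measurable set, which gives a meaning to properties \<open>Q\<close>
  whose measurability is unclear, such as bounds for diameters.  It also reduces all union bounds to \<open>holds_up_to_conj\<close> and
  \<open>holds_up_to_ball\<close>.
\<close>

definition holds_up_to ::
  "nat \<Rightarrow> (real ^ 'n::finite \<Rightarrow> real) \<Rightarrow> (real ^ 'n \<Rightarrow> real) \<Rightarrow> real \<Rightarrow> ((nat \<Rightarrow> (real ^ 'n) \<times> bool) \<Rightarrow> bool) \<Rightarrow> bool" where
  "holds_up_to n f g \<delta> Q \<longleftrightarrow> (\<exists>E\<in>sets (sample_space n). measure (sample_law n f g) E \<le> \<delta> \<and>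
     (\<forall>\<omega>\<in>space (sample_space n) - E. Q \<omega>))"

lemma holds_up_to_mono:
  assumes "holds_up_to n f g \<delta> Q" "\<delta> \<le> \<delta>'" "\<And>\<omega>. \<omega> \<in> space (sample_space n) \<Longrightarrow> Q \<omega> \<Longrightarrow> Q' \<omega>"
  shows "holds_up_to n f g \<delta>' Q'"
proof -
  obtain E where "E \<in> sets (sample_space n)" "measure (sample_law n f g) E \<le> \<delta>"
    "\<forall>\<omega>\<in>space (sample_space n) - E. Q \<omega>"
    using assms(1) unfolding holds_up_to_def by blast
  then show ?thesis unfolding holds_up_to_def using assms(2,3) by (intro bexI[of _ E]) auto
qed

lemma holds_up_to_conj:
  assumes "holds_up_to n f g \<delta> Q" "holds_up_to n f g \<delta>' Q'"
  shows "holds_up_to n f g (\<delta> + \<delta>') (\<lambda>\<omega>. Q \<omega> \<and> Q' \<omega>)"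
proof -
  obtain E E' where E: "E \<in> sets (sample_space n)" "measure (sample_law n f g) E \<le> \<delta>"
      "\<forall>\<omega>\<in>space (sample_space n) - E. Q \<omega>"
    and E': "E' \<in> sets (sample_space n)" "measure (sample_law n f g) E' \<le> \<delta>'"
      "\<forall>\<omega>\<in>space (sample_space n) - E'. Q' \<omega>"
    using assms unfolding holds_up_to_def by blast
  have "measure (sample_law n f g) (E \<union> E') \<le> \<delta> + \<delta>'"
    using measure_Un_le[of E "sample_law n f g" E'] E E' by simp
  then show ?thesis unfolding holds_up_to_def using E E' by (intro bexI[of _ "E \<union> E'"]) auto
qed

lemma holds_up_to_certain: "(\<And>\<omega>. Q \<omega>) \<Longrightarrow> 0 \<le> \<delta> \<Longrightarrow> holds_up_to n f g \<delta> Q"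
  unfolding holds_up_to_def by (intro bexI[of _ "{}"]) auto

lemma holds_up_to_ball:
  assumes "finite I" "\<And>i. i \<in> I \<Longrightarrow> holds_up_to n f g \<delta> (Q i)"
  shows "holds_up_to n f g (real (card I) * \<delta>) (\<lambda>\<omega>. \<forall>i\<in>I. Q i \<omega>)"
  using assms
proof (induction I rule: finite_induct)
  case (insert i I)
  then have "holds_up_to n f g (\<delta> + real (card I) * \<delta>) (\<lambda>\<omega>. Q i \<omega> \<and> (\<forall>i\<in>I. Q i \<omega>))"
    by (intro holds_up_to_conj) auto
  then show ?case using insert(1,2) by (simp add: distrib_right)
qed (simp add: holds_up_to_certain)

lemma holds_up_to_law_cong:
  "sample_law n f g = sample_law n f' g' \<Longrightarrow> holds_up_to n f' g' \<delta> Q \<Longrightarrow> holds_up_to n f g \<delta> Q"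
  by (simp add: holds_up_to_def)

section \<open>Estimation on the first block, verification on the others\<close>

text \<open>
  The additive error in \<open>cross_stat_deviation\<close> for a model of dimension \<open>D\<close> and blocks of size \<open>m\<close>.
\<close>

definition noise_level :: "real \<Rightarrow> real \<Rightarrow> nat \<Rightarrow> nat \<Rightarrow> real" where
  "noise_level C \<delta> D m = 36 * C\<^sup>2 / \<delta> * (sqrt (real D) / real m)"

lemma noise_level_nonneg: "0 < \<delta> \<Longrightarrow> 0 \<le> noise_level C \<delta> D m"
  by (simp add: noise_level_def)

context binary_regression
begin

text \<open>
  The candidate is chosen on the first block, the statistic lives on the other two, so the deviation
  bound for fixed candidates applies to the chosen one.  It is combined with the comparison of signal
  and distance in both directions: the true distance is bounded by the observed statistic, and the
  statistic is not much larger than the true distance warrants.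
\<close>

lemma verified_distance:
  fixes e :: "'k \<Rightarrow> real ^ 'n \<Rightarrow> real"
  assumes os: "orthonormal_system \<Lambda> e" and ne: "\<Lambda> \<noteq> {}"
    and hm: "\<And>i. hs i \<in> borel_measurable cube_measure"
    and h: "\<And>i x. 0 \<le> hs i x" "\<And>i x. hs i x \<le> 1"
    and m: "1 \<le> m" "3 * m \<le> n"
    and \<delta>: "0 < \<delta>" "\<delta> \<le> 1" and c1: "c \<le> 1" and C: "1 \<le> C"
    and s_def: "s = noise_level C \<delta> (card \<Lambda>) m"
    and idx: "idx \<in> sample_space n \<rightarrow>\<^sub>M count_space (UNIV :: nat set)"
    and idx_dep: "\<And>\<omega> \<omega>'. (\<And>i. i < m \<Longrightarrow> \<omega> i = \<omega>' i) \<Longrightarrow> idx \<omega> = idx \<omega>'"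
  shows "holds_up_to n f g \<delta> (\<lambda>\<omega>.
       L2_dist f (hs (idx \<omega>)) \<le> 1 / c * (sqrt (max 0 (2 * cross_stat m \<Lambda> e (hs (idx \<omega>)) \<omega> + s))
          + 2 * C * (L2_dist f (os_proj \<Lambda> e f) + L2_dist (hs (idx \<omega>)) (os_proj \<Lambda> e (hs (idx \<omega>))))) \<and>
       cross_stat m \<Lambda> e (hs (idx \<omega>)) \<omega> \<le> 2 * (C * L2_dist f (hs (idx \<omega>)))\<^sup>2 + s)"
proof -
  define Q where "Q i \<omega> \<longleftrightarrow> signal \<Lambda> e (hs i) > 2 * cross_stat m \<Lambda> e (hs i) \<omega> + s
      \<or> cross_stat m \<Lambda> e (hs i) \<omega> > 2 * signal \<Lambda> e (hs i) + s" for i \<omega>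
  have em: "k \<in> \<Lambda> \<Longrightarrow> e k \<in> borel_measurable cube_measure" for k
    using os_L2[OF os] by (auto dest: L2_spaceD)
  have Q: "Measurable.pred (sample_space n) (Q i)" for i
  proof -
    have [measurable]: "cross_stat m \<Lambda> e (hs i) \<in> borel_measurable (sample_space n)"
      by (rule cross_stat_measurable[OF hm em m(2)])
    show ?thesis unfolding Q_def[abs_def] by measurable
  qed
  have Q_dep: "Q i \<omega> = Q i \<omega>'" if "\<And>j. m \<le> j \<Longrightarrow> j < n \<Longrightarrow> \<omega> j = \<omega>' j" for i \<omega> \<omega>'
  proof -
    have "empirical_coeff B e (hs i) \<omega> k = empirical_coeff B e (hs i) \<omega>' k" if "B \<subseteq> {m..<n}" for B k
      using that \<open>\<And>j. m \<le> j \<Longrightarrow> j < n \<Longrightarrow> \<omega> j = \<omega>' j\<close> by (intro empirical_coeff_cong) auto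
    moreover have "{m..<2*m} \<subseteq> {m..<n}" "{2*m..<3*m} \<subseteq> {m..<n}" using m by auto
    ultimately have "cross_stat m \<Lambda> e (hs i) \<omega> = cross_stat m \<Lambda> e (hs i) \<omega>'"
      unfolding cross_stat_def by simp
    then show ?thesis by (simp add: Q_def)
  qed
  have bound: "emeasure (sample_law n f g) {\<omega> \<in> space (sample_space n). Q i \<omega>} \<le> ennreal \<delta>" for i
    unfolding Q_def by (rule cross_stat_deviation[OF os ne hm h m \<delta> C s_def[unfolded noise_level_def]])
  have mn: "m \<le> n" using m by simp
  let ?E = "{\<omega> \<in> space (sample_space n). Q (idx \<omega>) \<omega>}"
  have sel: "?E \<in> sets (sample_space n)" "emeasure (sample_law n f g) ?E \<le> ennreal \<delta>"
    by (rule emeasure_selected_event_le[OF mn idx _ Q _ bound]; (rule idx_dep Q_dep, simp))+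
  show ?thesis
    unfolding holds_up_to_def
  proof (intro bexI[of _ ?E] conjI ballI)
    show "?E \<in> sets (sample_space n)" by (rule sel(1))
    show "measure (sample_law n f g) ?E \<le> \<delta>"
      using \<delta> sel(2) by (intro measure_le_of_emeasure_le) auto
    fix \<omega> assume "\<omega> \<in> space (sample_space n) - ?E"
    then have nQ: "\<not> Q (idx \<omega>) \<omega>" by simp
    let ?h = "hs (idx \<omega>)" and ?U = "cross_stat m \<Lambda> e (hs (idx \<omega>)) \<omega>"
    have hL: "?h \<in> L2_space" using hm h by (intro L2_space_bounded[where B = 1]) auto
    have T: "signal \<Lambda> e ?h \<le> 2 * ?U + s" and U: "?U \<le> 2 * signal \<Lambda> e ?h + s"
      using nQ by (auto simp: Q_def not_less)
    have "sqrt (signal \<Lambda> e ?h) \<le> sqrt (max 0 (2 * ?U + s))" using T by (intro real_sqrt_le_mono) auto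
    then have "1 / c * (sqrt (signal \<Lambda> e ?h) + 2 * C * (L2_dist f (os_proj \<Lambda> e f) + L2_dist ?h (os_proj \<Lambda> e ?h)))
       \<le> 1 / c * (sqrt (max 0 (2 * ?U + s)) + 2 * C * (L2_dist f (os_proj \<Lambda> e f) + L2_dist ?h (os_proj \<Lambda> e ?h)))"
      using c_pos by (intro mult_left_mono add_right_mono) auto
    with dist_le_signal[OF os hL c1 C]
    show "L2_dist f ?h \<le> 1 / c * (sqrt (max 0 (2 * ?U + s)) + 2 * C * (L2_dist f (os_proj \<Lambda> e f) + L2_dist ?h (os_proj \<Lambda> e ?h)))"
      by (rule order.trans)
    have "signal \<Lambda> e ?h = (sqrt (signal \<Lambda> e ?h))\<^sup>2" by simp
    also have "\<dots> \<le> (C * L2_dist f ?h)\<^sup>2" by (intro power_mono sqrt_signal_le[OF os hL]) simp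
    finally show "?U \<le> 2 * (C * L2_dist f ?h)\<^sup>2 + s" using U by linarith
  qed
qed

end

context cdv_wavelets
begin

abbreviation proj_err :: "nat \<Rightarrow> (real ^ 'n::finite \<Rightarrow> real) \<Rightarrow> real" where
  "proj_err J f \<equiv> L2_dist f (os_proj (index_set J) (tensor_scaling phiI J) f)"

text \<open>
  The output of the sample: \<open>idx\<close> picks the estimator among the candidates \<open>hs\<close>, and \<open>U\<close> is the
  cross-product statistic at level \<open>J\<close> with noise level \<open>s\<close>.  The constant \<open>b\<close> is the admissible ratio of
  squared bias to variance in the models \<open>Mods\<close>, and \<open>A\<close> the resulting risk in units of the variance.
  The candidates depend on \<open>n\<close> but not on \<open>f\<close> and \<open>g\<close>.
\<close>

definition two_stage ::
  "nat \<Rightarrow> nat \<Rightarrow> nat set \<Rightarrow> (real ^ 'n::finite \<Rightarrow> real) set \<Rightarrow> real \<Rightarrow> real \<Rightarrow> real \<Rightarrow> real \<Rightarrow> real \<Rightarrow> real \<Rightarrow>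
   ((nat \<Rightarrow> (real ^ 'n) \<times> bool) \<Rightarrow> nat) \<Rightarrow> (nat \<Rightarrow> real ^ 'n \<Rightarrow> real) \<Rightarrow> ((nat \<Rightarrow> (real ^ 'n) \<times> bool) \<Rightarrow> real) \<Rightarrow> bool" where
  "two_stage n J Mods H c C b A \<delta> s idx hs U \<longleftrightarrow>
     idx \<in> sample_space n \<rightarrow>\<^sub>M count_space UNIV \<and> (\<forall>i. hs i \<in> H) \<and> U \<in> borel_measurable (sample_space n) \<and>
     (\<forall>f g. binary_regression f g c C \<longrightarrow>
       holds_up_to n f g \<delta> (\<lambda>\<omega>.
         L2_dist f (hs (idx \<omega>)) \<le> 1 / c * (sqrt (max 0 (2 * U \<omega> + s)) + 2 * C * (proj_err J f + proj_err J (hs (idx \<omega>)))) \<and>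
         U \<omega> \<le> 2 * (C * L2_dist f (hs (idx \<omega>)))\<^sup>2 + s) \<and>
       (\<forall>k\<in>Mods. f \<in> H \<longrightarrow> (proj_err k f)\<^sup>2 \<le> b * 2 ^ (k * CARD('n)) / real (n div 3) \<longrightarrow>
         holds_up_to n f g \<delta> (\<lambda>\<omega>. (L2_dist f (hs (idx \<omega>)))\<^sup>2 \<le> A * 2 ^ (k * CARD('n)) / real (n div 3))))"

lemma two_stage_exists:
  assumes c: "0 < c" "c \<le> 1" and C: "1 \<le> C" and b: "0 \<le> b" and \<delta>: "0 < \<delta>" "\<delta> \<le> 1"
  shows "\<exists>A>0. \<forall>n\<ge>(3 :: nat). \<forall>J\<ge>J0. \<forall>Mods (H :: (real ^ 'n::finite \<Rightarrow> real) set).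
    finite Mods \<longrightarrow> Mods \<noteq> {} \<longrightarrow> (\<forall>k\<in>Mods. J0 \<le> k) \<longrightarrow>
    (\<forall>h\<in>H. h \<in> borel_measurable cube_measure \<and> (\<forall>x. 0 \<le> h x \<and> h x \<le> 1)) \<longrightarrow> (\<lambda>_. 0) \<in> H \<longrightarrow>
    (\<exists>idx hs U. two_stage n J Mods H c C b A \<delta> (noise_level C \<delta> (2 ^ (J * CARD('n))) (n div 3)) idx hs U)"
proof -
  obtain A where A_net: "0 < A \<and> (\<forall>m\<ge>1. \<forall>(Mods :: nat set) (\<Lambda> :: nat \<Rightarrow> ('n \<Rightarrow> nat) set)
      (e :: nat \<Rightarrow> ('n \<Rightarrow> nat) \<Rightarrow> real ^ 'n \<Rightarrow> real) H.
    finite Mods \<longrightarrow> Mods \<noteq> {} \<longrightarrow>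
    (\<forall>k\<in>Mods. orthonormal_system (\<Lambda> k) (e k) \<and> \<Lambda> k \<noteq> {}) \<longrightarrow>
    (\<Sum>k\<in>Mods. exp (- real (card (\<Lambda> k)))) \<le> 1 \<longrightarrow>
    (\<forall>h\<in>H. h \<in> borel_measurable cube_measure \<and> (\<forall>x. 0 \<le> h x \<and> h x \<le> 1)) \<longrightarrow> (\<lambda>_. 0) \<in> H \<longrightarrow>
    (\<exists>K hs P. 0 < K \<and> (\<forall>i. hs i \<in> H) \<and> net_risk_bound m Mods \<Lambda> e H c C b \<delta> A K hs P))"
    using net_estimator[OF c(1) C b \<delta>(1), where 'k = "'n \<Rightarrow> nat" and 'n = 'n] by (rule exE)
  have A: "0 < A" by (rule conjunct1[OF A_net])
  note net = conjunct2[OF A_net, rule_format (no_asm)]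
  show ?thesis
  proof (intro exI[of _ A] conjI A allI impI)
    fix n J :: nat and Mods and H :: "(real ^ 'n \<Rightarrow> real) set"
    assume n: "3 \<le> n" and J: "J0 \<le> J" and Mods: "finite Mods" "Mods \<noteq> {}" "\<forall>k\<in>Mods. J0 \<le> k"
      and H: "\<forall>h\<in>H. h \<in> borel_measurable cube_measure \<and> (\<forall>x. 0 \<le> h x \<and> h x \<le> 1)" and H0: "(\<lambda>_. 0) \<in> H"
    define m where "m = n div 3"
    have m: "1 \<le> m" "3 * m \<le> n" "m \<le> n" using n by (auto simp: m_def)
    let ?\<Lambda> = "index_set :: nat \<Rightarrow> ('n \<Rightarrow> nat) set" and ?e = "tensor_scaling phiI :: nat \<Rightarrow> ('n \<Rightarrow> nat) \<Rightarrow> real ^ 'n \<Rightarrow> real"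
    have ne: "?\<Lambda> k \<noteq> {}" for k using card_index_set[of k, where 'n = 'n] by auto
    have card: "real (card (?\<Lambda> k)) = 2 ^ (k * CARD('n))" for k by (simp add: card_index_set)
    have osM: "\<forall>k\<in>Mods. orthonormal_system (?\<Lambda> k) (?e k) \<and> ?\<Lambda> k \<noteq> {}"
      using Mods(3) tensor_orthonormal ne by blast
    have sumM: "(\<Sum>k\<in>Mods. exp (- real (card (?\<Lambda> k)))) \<le> 1"
      using sum_exp_dimensions_le_one[OF Mods(1), of "CARD('n)"] by (simp add: card_index_set Suc_leI)
    obtain K hs P where K: "0 < K" and hsH: "\<And>i. hs i \<in> H" and tail: "net_risk_bound m Mods ?\<Lambda> ?e H c C b \<delta> A K hs P"
      using net[OF m(1) Mods(1,2) osM sumM H H0] by blast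
    have hm: "hs i \<in> borel_measurable cube_measure" and h: "0 \<le> hs i x" "hs i x \<le> 1" for i x
      using hsH[of i] H by auto
    define idx where "idx = (selected m K hs P :: (nat \<Rightarrow> (real ^ 'n) \<times> bool) \<Rightarrow> nat)"
    define U where "U \<omega> = cross_stat m (?\<Lambda> J) (?e J) (hs (idx \<omega>)) \<omega>" for \<omega>
    have idx: "idx \<in> sample_space n \<rightarrow>\<^sub>M count_space UNIV"
      unfolding idx_def by (rule selected_measurable[OF hm m(3)])
    have idx_dep: "idx \<omega> = idx \<omega>'" if "\<And>i. i < m \<Longrightarrow> \<omega> i = \<omega>' i" for \<omega> \<omega>'
      unfolding idx_def using that by (rule selected_cong)
    have em: "k \<in> ?\<Lambda> J \<Longrightarrow> ?e J k \<in> borel_measurable cube_measure" for k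
      using os_L2[OF tensor_orthonormal[OF J]] by (auto dest: L2_spaceD)
    have Um: "U \<in> borel_measurable (sample_space n)"
      unfolding U_def
      by (rule measurable_compose_countable[OF _ idx]) (rule cross_stat_measurable[OF hm em m(2)])
    show "\<exists>idx hs U. two_stage n J Mods H c C b A \<delta> (noise_level C \<delta> (2 ^ (J * CARD('n))) (n div 3)) idx hs U"
      unfolding two_stage_def
    proof (intro exI[of _ idx] exI[of _ hs] exI[of _ U] conjI idx allI hsH Um impI ballI)
      fix f g :: "real ^ 'n \<Rightarrow> real" assume BR: "binary_regression f g c C"
      then interpret binary_regression f g c C .
      let ?s = "noise_level C \<delta> (2 ^ (J * CARD('n))) (n div 3)"
      show "holds_up_to n f g \<delta> (\<lambda>\<omega>.
         L2_dist f (hs (idx \<omega>)) \<le> 1 / c * (sqrt (max 0 (2 * U \<omega> + ?s)) + 2 * C * (proj_err J f + proj_err J (hs (idx \<omega>)))) \<and>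
         U \<omega> \<le> 2 * (C * L2_dist f (hs (idx \<omega>)))\<^sup>2 + ?s)"
        unfolding U_def
        by (rule verified_distance[OF tensor_orthonormal[OF J] ne hm h m(1,2) \<delta> c(2) C _ idx idx_dep])
           (simp_all add: card_index_set m_def)
      fix k assume k: "k \<in> Mods" and f: "f \<in> H"
        and bias: "(proj_err k f)\<^sup>2 \<le> b * 2 ^ (k * CARD('n)) / real (n div 3)"
      let ?E = "{\<omega> \<in> space (sample_space n). A * 2 ^ (k * CARD('n)) / real m < (L2_dist f (hs (idx \<omega>)))\<^sup>2}"
      show "holds_up_to n f g \<delta> (\<lambda>\<omega>. (L2_dist f (hs (idx \<omega>)))\<^sup>2 \<le> A * 2 ^ (k * CARD('n)) / real (n div 3))"
        unfolding holds_up_to_def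
      proof (intro bexI[of _ ?E] conjI ballI)
        have "Measurable.pred (sample_space n) (\<lambda>\<omega>. A * 2 ^ (k * CARD('n)) / real m < (L2_dist f (hs (idx \<omega>)))\<^sup>2)"
          by (rule measurable_compose_countable[OF _ idx]) simp
        then show "?E \<in> sets (sample_space n)" by (simp add: pred_def)
        have "emeasure (sample_law n f g) {\<omega> \<in> space (sample_space n).
            A * real (card (?\<Lambda> k)) / real m < (L2_dist f (hs (selected m K hs P \<omega>)))\<^sup>2} \<le> ennreal \<delta>"
          using tail[unfolded net_risk_bound_def, rule_format, OF BR m(3) f k] bias by (simp add: card m_def)
        then show "measure (sample_law n f g) ?E \<le> \<delta>"
          using \<delta> by (intro measure_le_of_emeasure_le) (auto simp: card idx_def)
        fix \<omega> assume "\<omega> \<in> space (sample_space n) - ?E"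
        then show "(L2_dist f (hs (idx \<omega>)))\<^sup>2 \<le> A * 2 ^ (k * CARD('n)) / real (n div 3)"
          by (simp add: m_def not_less)
      qed
    qed
  qed
qed

lemma F_class_clip:
  fixes f g :: "real ^ 'n::finite \<Rightarrow> real"
  assumes f: "f \<in> F_class phiI J0 M s" and g: "g \<in> G_class c C" and c: "0 < c" "c \<le> C"
  shows "binary_regression (clip 0 1 f) (clip c C g) c C"
    and "sample_law n f g = sample_law n (clip 0 1 f) (clip c C g)"
    and "clip 0 1 f \<in> F_class phiI J0 M s"
    and "h \<in> L2_space \<Longrightarrow> L2_dist f h = L2_dist (clip 0 1 f) h"
    and "0 \<le> clip 0 1 f x" "clip 0 1 f x \<le> 1"
proof -
  have fm: "f \<in> borel_measurable cube_measure" by (rule L2_spaceD[OF F_class_L2[OF f]])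
  have ae: "AE x in cube_measure. clip 0 1 f x = f x"
    using f by (intro clip_AE) (simp add: F_class_def)
  show "binary_regression (clip 0 1 f) (clip c C g) c C" by (rule binary_regression_clip[OF fm g c])
  show "sample_law n f g = sample_law n (clip 0 1 f) (clip c C g)"
    unfolding sample_law_def by (simp only: obs_law_clip[OF fm g])
  show "clip 0 1 f \<in> F_class phiI J0 M s"
    by (rule F_class_cong_AE[OF f clip_measurable[OF fm] ae])
  show "L2_dist f h = L2_dist (clip 0 1 f) h" if "h \<in> L2_space"
    using ae L2_spaceD[OF that] fm by (intro L2_dist_cong_AE) auto
qed (auto simp: clip_def)

lemma F_class_bias_uniform:
  fixes f :: "real ^ 'n::finite \<Rightarrow> real"
  assumes f: "f \<in> F_class phiI J0 M \<beta>" and b: "0 < b" "b \<le> \<beta>" and M: "0 < M"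
    and r: "\<And>x. 0 \<le> f x" "\<And>x. f x \<le> 1" and J: "J0 \<le> J"
  shows "proj_err J f
    \<le> M / (1 - 2 powr (- b)) * 2 powr (- (real J * \<beta>))"
proof -
  have "(2::real) powr (- b) < 1" using b by (simp add: powr_less_one)
  moreover have "2 powr (- \<beta>) \<le> (2::real) powr (- b)" using b by (intro powr_mono) auto
  ultimately have "M / (1 - 2 powr (- \<beta>)) \<le> M / (1 - 2 powr (- b))" using M by (intro frac_le) auto
  then have "M / (1 - 2 powr (- \<beta>)) * 2 powr (- (real J * \<beta>)) \<le> M / (1 - 2 powr (- b)) * 2 powr (- (real J * \<beta>))"
    by (intro mult_right_mono) auto
  moreover have "0 < \<beta>" using b by simp
  ultimately show ?thesis using F_class_bias[OF f _ M r J] by linarith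
qed

lemma F_class_bias_level:
  fixes f :: "real ^ 'n::finite \<Rightarrow> real"
  assumes f: "f \<in> F_class phiI J0 M \<beta>" and b: "0 < b" "b \<le> \<beta>" and M: "0 < M"
    and r: "\<And>x. 0 \<le> f x" "\<And>x. f x \<le> 1"
    and n: "3 \<le> n" and k: "k = level (1 / (2 * \<beta> + real CARD('n))) n" "J0 \<le> k"
  shows "(proj_err k f)\<^sup>2
    \<le> (M / (1 - 2 powr (- b)))\<^sup>2 * 2 ^ (k * CARD('n)) / real (n div 3)"
proof -
  have \<beta>: "0 < \<beta>" using b by simp
  have "(proj_err k f)\<^sup>2 \<le> (M / (1 - 2 powr (- b)) * 2 powr (- (real k * \<beta>)))\<^sup>2"
    by (intro power_mono F_class_bias_uniform[OF f b M r k(2)]) simp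
  also have "\<dots> = (M / (1 - 2 powr (- b)))\<^sup>2 * (2 powr (- (real k * \<beta>)))\<^sup>2" by (rule power_mult_distrib)
  also have "\<dots> \<le> (M / (1 - 2 powr (- b)))\<^sup>2 * (2 ^ (k * CARD('n)) / real (n div 3))"
    by (intro mult_left_mono bias_level_bound(1)[OF n \<beta> k(1)]) simp
  finally show ?thesis by simp
qed

lemma two_stage_error:
  fixes hs :: "nat \<Rightarrow> real ^ 'n::finite \<Rightarrow> real"
  assumes "two_stage n J Mods H c C b0 A \<delta> s idx hs U" and "binary_regression f g c C"
  shows "holds_up_to n f g \<delta> (\<lambda>\<omega>.
         L2_dist f (hs (idx \<omega>)) \<le> 1 / c * (sqrt (max 0 (2 * U \<omega> + s)) + 2 * C * (proj_err J f + proj_err J (hs (idx \<omega>)))) \<and>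
         U \<omega> \<le> 2 * (C * L2_dist f (hs (idx \<omega>)))\<^sup>2 + s)"
  using assms unfolding two_stage_def by blast

lemma two_stage_risk:
  fixes hs :: "nat \<Rightarrow> real ^ 'n::finite \<Rightarrow> real"
  assumes "two_stage n J Mods H c C b0 A \<delta> s idx hs U" and "binary_regression f g c C" and "f \<in> H" and "k \<in> Mods"
    and "(proj_err k f)\<^sup>2 \<le> b0 * 2 ^ (k * CARD('n)) / real (n div 3)"
  shows "holds_up_to n f g \<delta> (\<lambda>\<omega>. (L2_dist f (hs (idx \<omega>)))\<^sup>2 \<le> A * 2 ^ (k * CARD('n)) / real (n div 3))"
  using assms unfolding two_stage_def by blast

lemma noise_level_bound:
  assumes n: "3 \<le> n" and b: "0 < b" and \<delta>: "0 < \<delta>"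
  shows "noise_level C \<delta> (2 ^ (level (2 / (4 * b + real d)) n * d)) (n div 3)
    \<le> 36 * C\<^sup>2 / \<delta> * (5 * 2 ^ d) * (rho_rate d n b)\<^sup>2"
proof -
  have "noise_level C \<delta> (2 ^ (level (2 / (4 * b + real d)) n * d)) (n div 3)
      \<le> 36 * C\<^sup>2 / \<delta> * (5 * 2 ^ d * (rho_rate d n b)\<^sup>2)"
    unfolding noise_level_def using signal_level_bound(2)[OF n b refl, where d = d] \<delta>
    by (intro mult_left_mono) simp_all
  then show ?thesis by (simp add: mult.assoc)
qed

text \<open>
  The task for a window \<open>[b, 2 b]\<close> of smoothness degrees: cover uniformly over the roughest class and
  have the optimal diameter for every degree in the window.
\<close>

definition window_sets ::
  "real \<Rightarrow> real \<Rightarrow> real \<Rightarrow> real \<Rightarrow> real \<Rightarrow>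
   (nat \<Rightarrow> (nat \<Rightarrow> (real ^ 'n::finite) \<times> bool) \<Rightarrow> (real ^ 'n \<Rightarrow> real) set) \<Rightarrow> real \<Rightarrow> bool" where
  "window_sets M c C \<delta> b Cn K \<longleftrightarrow> 0 < K \<and> (\<forall>n. random_closed_set n (Cn n)) \<and>
    (\<forall>n f. {\<omega> \<in> space (sample_space n). f \<in> Cn n \<omega>} \<in> sets (sample_space n)) \<and>
    (\<forall>\<^sub>F n in sequentially. \<forall>f\<in>F_class phiI J0 M b. \<forall>g\<in>G_class c C.
       holds_up_to n f g \<delta> (\<lambda>\<omega>. f \<in> Cn n \<omega>)) \<and>
    (\<forall>\<beta>\<in>{b..2*b}. \<forall>\<^sub>F n in sequentially. \<forall>f\<in>F_class phiI J0 M \<beta>. \<forall>g\<in>G_class c C.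
       holds_up_to n f g (2 * \<delta>) (\<lambda>\<omega>. L2_diam (Cn n \<omega>) \<le> ennreal (K * eps_rate CARD('n) n \<beta>)))"

text \<open>
  The radius \<open>r\<close> is the bound on \<open>\<parallel>f - h\<parallel>\<close> in \<open>two_stage\<close> with the only unobservable term, the distance
  from \<open>f\<close> to \<open>V\<^sub>J\<close>, replaced by its maximum over \<open>\<F>\<^sub>b(M)\<close>; coverage is then immediate.  Conversely
  \<open>U\<close> is at most of order \<open>\<parallel>f - h\<parallel>\<^sup>2 + \<rho>\<^sub>n(b)\<^sup>2\<close>, and \<open>h\<close> is as close to \<open>V\<^sub>J\<close> as \<open>f\<close> is, up to
  \<open>\<parallel>f - h\<parallel>\<close>.  Both \<open>\<parallel>f - h\<parallel>\<close> and \<open>\<rho>\<^sub>n(b)\<close> are of order at most \<open>\<epsilon>\<^sub>n(\<beta>)\<close>.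
\<close>

lemma window_confidence_set:
  assumes M: "0 < M" and c: "0 < c" "c \<le> 1" and C: "1 \<le> C" and \<delta>: "0 < \<delta>" "\<delta> \<le> 1" and b: "0 < b"
  shows "\<exists>(Cn :: nat \<Rightarrow> (nat \<Rightarrow> (real ^ 'n::finite) \<times> bool) \<Rightarrow> (real ^ 'n \<Rightarrow> real) set) K.
    window_sets M c C \<delta> b Cn K"
proof -
  let ?d = "CARD('n)"
  have cC: "c \<le> C" using c C by simp
  define M1 where "M1 = M / (1 - 2 powr (- b))"
  have M1: "0 < M1" unfolding M1_def using M b by (simp add: powr_less_one)
  obtain A where A: "0 < A" and stage: "\<forall>n\<ge>(3::nat). \<forall>J\<ge>J0. \<forall>Mods (H :: (real ^ 'n \<Rightarrow> real) set).
    finite Mods \<longrightarrow> Mods \<noteq> {} \<longrightarrow> (\<forall>k\<in>Mods. J0 \<le> k) \<longrightarrow>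
    (\<forall>h\<in>H. h \<in> borel_measurable cube_measure \<and> (\<forall>x. 0 \<le> h x \<and> h x \<le> 1)) \<longrightarrow> (\<lambda>_. 0) \<in> H \<longrightarrow>
    (\<exists>idx hs U. two_stage n J Mods H c C (M1\<^sup>2) A \<delta> (noise_level C \<delta> (2 ^ (J * CARD('n))) (n div 3)) idx hs U)"
    using two_stage_exists[OF c C zero_le_power2[of M1] \<delta>, where 'n = 'n] by (elim exE conjE) (rule that)
  define J where "J n = level (2 / (4 * b + real ?d)) n" for n
  define sl where "sl n = noise_level C \<delta> (2 ^ (J n * ?d)) (n div 3)" for n
  define good where "good n \<longleftrightarrow> 3 \<le> n \<and> J0 \<le> J n" for n
  define H where "H = {h :: real ^ 'n \<Rightarrow> real. h \<in> borel_measurable cube_measure \<and> (\<forall>x. 0 \<le> h x \<and> h x \<le> 1)}"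
  have "\<exists>idx hs U. two_stage n (J n) {J0..J0 + n} H c C (M1\<^sup>2) A \<delta> (sl n) idx hs U" if "good n" for n
    unfolding sl_def
    by (rule stage[rule_format]) (use that in \<open>auto simp: good_def H_def\<close>)
  then obtain idx hs U where ts: "\<And>n. good n \<Longrightarrow> two_stage n (J n) {J0..J0 + n} H c C (M1\<^sup>2) A \<delta> (sl n) (idx n) (hs n) (U n)"
    by metis
  define r where "r n \<omega> = 1 / c * (sqrt (max 0 (2 * U n \<omega> + sl n)) + 2 * C * (M1 * 2 powr (- (real (J n) * b)) + proj_err (J n) (hs n (idx n \<omega>))))" for n \<omega>
  (* For the finitely many n that are not good any closed set will do. *)
  define Cn where "Cn n = (if good n then (\<lambda>\<omega>. {h \<in> L2_space. L2_dist h (hs n (idx n \<omega>)) \<le> r n \<omega>}) else (\<lambda>_. {}))" for n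
  have idx: "idx n \<in> sample_space n \<rightarrow>\<^sub>M count_space UNIV" and hsH: "hs n i \<in> H" and Um: "U n \<in> borel_measurable (sample_space n)"
    if "good n" for n i
    using ts[OF that] by (auto simp: two_stage_def)
  have hsL: "hs n i \<in> L2_space" if "good n" for n i
    using hsH[OF that] by (intro L2_space_bounded[where B = 1]) (auto simp: H_def)
  have rm: "r n \<in> borel_measurable (sample_space n)" if "good n" for n
  proof -
    note [measurable] = Um[OF that]
    have [measurable]: "(\<lambda>\<omega>. proj_err (J n) (hs n (idx n \<omega>))) \<in> borel_measurable (sample_space n)"
      by (rule measurable_compose_countable[OF _ idx[OF that]]) simp
    show ?thesis unfolding r_def[abs_def] by measurable
  qed
  have closed: "random_closed_set n (Cn n)" for n
    using random_closed_set_ball[OF idx hsL rm] by (auto simp: Cn_def random_closed_set_empty)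
  have member: "{\<omega> \<in> space (sample_space n). f \<in> Cn n \<omega>} \<in> sets (sample_space n)" for n f
    using random_ball_member[OF idx rm] by (auto simp: Cn_def)
  have ev_good: "\<forall>\<^sub>F n in sequentially. good n"
    unfolding good_def J_def using b
    by (intro eventually_conj eventually_ge_at_top level_eventually) auto
  define \<sigma> where "\<sigma> = sqrt (36 * C\<^sup>2 / \<delta> * (5 * 2 ^ ?d))"
  have sl_le: "sqrt (sl n) \<le> \<sigma> * rho_rate ?d n b" if "good n" for n
  proof -
    have "sqrt (sl n) \<le> sqrt (36 * C\<^sup>2 / \<delta> * (5 * 2 ^ ?d) * (rho_rate ?d n b)\<^sup>2)"
      unfolding sl_def J_def using that by (intro real_sqrt_le_mono noise_level_bound b \<delta>) (simp add: good_def)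
    also have "\<dots> = \<sigma> * rho_rate ?d n b"
      unfolding \<sigma>_def real_sqrt_mult[of _ "(rho_rate ?d n b)\<^sup>2"] by (simp add: rho_rate_def)
    finally show ?thesis .
  qed
  have sl0: "0 \<le> sl n" for n unfolding sl_def by (rule noise_level_nonneg[OF \<delta>(1)])
  have bias_J: "proj_err (J n) f \<le> M1 * 2 powr (- (real (J n) * b))"
    if "good n" "f \<in> F_class phiI J0 M b" "\<And>x. 0 \<le> f x" "\<And>x. f x \<le> 1" for n f
    unfolding M1_def using that M b by (intro F_class_bias_uniform) (auto simp: good_def)
  define \<tau> where "\<tau> = sqrt (A * (5 * 2 ^ ?d))"
  (* R multiplies the rate in the bound for the radius. *)
  define R where "R = 1 / c * (4 * C * \<tau> + 2 * \<sigma> + 4 * C * M1)"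
  have \<tau>0: "0 < \<tau>" and \<sigma>0: "0 \<le> \<sigma>" unfolding \<tau>_def \<sigma>_def using A \<delta> by auto
  have R: "0 < R" unfolding R_def using c C \<tau>0 \<sigma>0 M1 by (intro mult_pos_pos add_pos_pos add_pos_nonneg) auto
  have cover: "holds_up_to n f g \<delta> (\<lambda>\<omega>. f \<in> Cn n \<omega>)"
    if n: "good n" and f: "f \<in> F_class phiI J0 M b" and g: "g \<in> G_class c C" for n f g
  proof -
    note clip = F_class_clip[OF f g c(1) cC]
    let ?f = "clip 0 1 f"
    have "f \<in> Cn n \<omega>"
      if "L2_dist ?f (hs n (idx n \<omega>)) \<le> 1 / c * (sqrt (max 0 (2 * U n \<omega> + sl n)) + 2 * C * (proj_err (J n) ?f + proj_err (J n) (hs n (idx n \<omega>))))" for \<omega>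
    proof -
      have "L2_dist ?f (hs n (idx n \<omega>)) \<le> r n \<omega>"
        unfolding r_def using c C bias_J[OF n clip(3,5,6)]
        by (intro order.trans[OF that] mult_left_mono add_left_mono add_right_mono) auto
      then show ?thesis
        using n clip(4)[OF hsL[OF n]] F_class_L2[OF f] by (simp add: Cn_def)
    qed
    then show ?thesis
      by (intro holds_up_to_law_cong[OF clip(2)] holds_up_to_mono[OF two_stage_error[OF ts[OF n] clip(1)]]) auto
  qed
  have diam: "holds_up_to n f g (2 * \<delta>) (\<lambda>\<omega>. L2_diam (Cn n \<omega>) \<le> ennreal (2 * R * eps_rate ?d n \<beta>))"
    if n: "good n" and \<beta>: "\<beta> \<in> {b..2*b}" and k_ge: "J0 \<le> level (1 / (2 * \<beta> + real ?d)) n"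
      and f: "f \<in> F_class phiI J0 M \<beta>" and g: "g \<in> G_class c C" for n f g \<beta>
  proof -
    note clip = F_class_clip[OF f g c(1) cC]
    let ?f = "clip 0 1 f" and ?g = "clip c C g"
    let ?k = "level (1 / (2 * \<beta> + real ?d)) n"
    have n3: "3 \<le> n" using n by (simp add: good_def)
    have f_b: "?f \<in> F_class phiI J0 M b" using clip(3) F_class_mono[of b \<beta>] \<beta> by auto
    have d1: "1 \<le> real ?d" by (simp add: Suc_leI)
    have "b \<le> \<beta>" using \<beta> by simp
    with d1 b have "1 \<le> 2 * \<beta> + real ?d" by linarith
    then have "?k \<le> n" using n3 by (intro level_le) (auto simp: divide_le_eq_1)
    then have k: "?k \<in> {J0..J0 + n}" using k_ge by simp
    have fH: "?f \<in> H" using clip(5,6) L2_spaceD[OF F_class_L2[OF clip(3)]] by (simp add: H_def)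
    have bias: "(proj_err ?k ?f)\<^sup>2 \<le> M1\<^sup>2 * 2 ^ (?k * ?d) / real (n div 3)"
      unfolding M1_def using \<beta> b M n3 k_ge by (intro F_class_bias_level[OF clip(3)]) (auto simp: clip(5,6))
    let ?\<rho> = "rho_rate ?d n b" and ?\<epsilon> = "eps_rate ?d n \<beta>"
    have \<rho>\<epsilon>: "?\<rho> \<le> ?\<epsilon>" using n3 \<beta> b by (intro rho_rate_le_eps_rate) (auto simp: Suc_leI)
    have \<epsilon>0: "0 \<le> ?\<epsilon>" and \<rho>0: "0 \<le> ?\<rho>" by (simp_all add: eps_rate_def rho_rate_def)
    have bound: "L2_diam (Cn n \<omega>) \<le> ennreal (2 * R * ?\<epsilon>)"
      if U_le: "U n \<omega> \<le> 2 * (C * L2_dist ?f (hs n (idx n \<omega>)))\<^sup>2 + sl n"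
        and risk: "(L2_dist ?f (hs n (idx n \<omega>)))\<^sup>2 \<le> A * 2 ^ (?k * ?d) / real (n div 3)" for \<omega>
    proof -
      let ?h = "hs n (idx n \<omega>)"
      let ?D = "L2_dist ?f ?h"
      have D: "?D \<le> \<tau> * ?\<epsilon>"
      proof (rule power2_le_imp_le)
        have "?D\<^sup>2 \<le> A * (2 ^ (?k * ?d) / real (n div 3))" using risk by simp
        also have "\<dots> \<le> A * (5 * 2 ^ ?d * ?\<epsilon>\<^sup>2)"
          using A \<beta> b n3 by (intro mult_left_mono bias_level_bound(2)) auto
        also have "\<dots> = (\<tau> * ?\<epsilon>)\<^sup>2" using A by (simp add: \<tau>_def power_mult_distrib)
        finally show "?D\<^sup>2 \<le> (\<tau> * ?\<epsilon>)\<^sup>2" .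
      qed (use \<tau>0 \<epsilon>0 in simp)
      have CD0: "0 \<le> C * ?D" using C by simp
      have root: "sqrt (max 0 (2 * U n \<omega> + sl n)) \<le> 2 * (C * ?D) + 2 * sqrt (sl n)"
      proof (rule real_le_lsqrt)
        have "2 * U n \<omega> + sl n \<le> 4 * (C * ?D)\<^sup>2 + 3 * sl n" using U_le by simp
        also have "\<dots> \<le> 4 * (C * ?D)\<^sup>2 + 8 * (C * ?D) * sqrt (sl n) + 4 * sl n" using CD0 sl0[of n] by simp
        also have "\<dots> = (2 * (C * ?D) + 2 * sqrt (sl n))\<^sup>2"
          using sl0[of n] by (simp add: power2_sum power_mult_distrib)
        finally show "max 0 (2 * U n \<omega> + sl n) \<le> (2 * (C * ?D) + 2 * sqrt (sl n))\<^sup>2" by simp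
      qed (use CD0 sl0[of n] in auto)
      have scale: "M1 * 2 powr (- (real (J n) * b)) \<le> M1 * ?\<rho>"
        using M1 n3 b by (intro mult_left_mono signal_level_bound(1)) (auto simp: J_def)
      have J: "J0 \<le> J n" using n by (simp add: good_def)
      have "proj_err (J n) ?h \<le> L2_dist ?h (os_proj (index_set (J n)) (tensor_scaling phiI (J n)) ?f)"
        unfolding os_proj_def[of _ _ ?f] by (rule os_proj_nearest[OF tensor_orthonormal[OF J] hsL[OF n]])
      also have "\<dots> \<le> L2_dist ?h ?f + proj_err (J n) ?f"
        using F_class_L2[OF clip(3)] by (intro L2_dist_triangle hsL[OF n] os_proj_L2[OF tensor_orthonormal[OF J]])
      finally have pj: "proj_err (J n) ?h \<le> ?D + M1 * ?\<rho>"
        using bias_J[OF n f_b clip(5,6)] scale by (simp add: L2_dist_commute)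
      have "c * r n \<omega> = sqrt (max 0 (2 * U n \<omega> + sl n)) + 2 * C * (M1 * 2 powr (- (real (J n) * b)) + proj_err (J n) ?h)"
        unfolding r_def using c by simp
      also have "\<dots> \<le> (2 * (C * ?D) + 2 * sqrt (sl n)) + 2 * C * (M1 * ?\<rho> + (?D + M1 * ?\<rho>))"
        using C by (intro add_mono mult_left_mono root scale pj) auto
      also have "\<dots> \<le> 4 * C * (\<tau> * ?\<epsilon>) + 2 * (\<sigma> * ?\<epsilon>) + 4 * C * M1 * ?\<epsilon>"
      proof -
        have "C * ?D \<le> C * (\<tau> * ?\<epsilon>)" using D C by (intro mult_left_mono) auto
        moreover have "sqrt (sl n) \<le> \<sigma> * ?\<epsilon>"
          using sl_le[OF n] mult_left_mono[OF \<rho>\<epsilon> \<sigma>0] by linarith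
        moreover have "C * M1 * ?\<rho> \<le> C * M1 * ?\<epsilon>" using \<rho>\<epsilon> C M1 by (intro mult_left_mono) auto
        ultimately show ?thesis by (simp add: algebra_simps)
      qed
      also have "\<dots> = c * (R * ?\<epsilon>)" unfolding R_def using c by (simp add: algebra_simps)
      finally have r_le: "r n \<omega> \<le> R * ?\<epsilon>" using c by simp
      have r0: "0 \<le> r n \<omega>" unfolding r_def using c C M1 by simp
      have "L2_diam (Cn n \<omega>) \<le> ennreal (2 * r n \<omega>)"
        using n L2_diam_ball_le[OF hsL[OF n] r0] by (simp add: Cn_def)
      also have "\<dots> \<le> ennreal (2 * R * ?\<epsilon>)" using r_le by (intro ennreal_leI) simp
      finally show ?thesis .
    qed
    have "holds_up_to n ?f ?g (\<delta> + \<delta>) (\<lambda>\<omega>. L2_diam (Cn n \<omega>) \<le> ennreal (2 * R * ?\<epsilon>))"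
      using bound
      by (intro holds_up_to_mono[OF holds_up_to_conj[OF two_stage_error[OF ts[OF n] clip(1)]
            two_stage_risk[OF ts[OF n] clip(1) fH k bias]]]) auto
    then show ?thesis by (intro holds_up_to_law_cong[OF clip(2)]) simp
  qed
  show ?thesis
    unfolding window_sets_def
  proof (intro exI[of _ Cn] exI[of _ "2 * R"] conjI allI closed member ballI)
    show "0 < 2 * R" using R by simp
    show "\<forall>\<^sub>F n in sequentially. \<forall>f\<in>F_class phiI J0 M b. \<forall>g\<in>G_class c C. holds_up_to n f g \<delta> (\<lambda>\<omega>. f \<in> Cn n \<omega>)"
      using ev_good by eventually_elim (intro ballI cover)
    fix \<beta> assume \<beta>: "\<beta> \<in> {b..2*b}"
    have "\<forall>\<^sub>F n in sequentially. J0 \<le> level (1 / (2 * \<beta> + real ?d)) n"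
      using \<beta> b by (intro level_eventually) (auto intro!: divide_pos_pos add_pos_pos)
    with ev_good show "\<forall>\<^sub>F n in sequentially. \<forall>f\<in>F_class phiI J0 M \<beta>. \<forall>g\<in>G_class c C.
       holds_up_to n f g (2 * \<delta>) (\<lambda>\<omega>. L2_diam (Cn n \<omega>) \<le> ennreal (2 * R * eps_rate ?d n \<beta>))"
      by eventually_elim (intro ballI diam \<beta>)
  qed
qed

text \<open>
  \<open>\<Psi>\<close> is the rejection of the hypothesis that \<open>f\<close> lies in the class of degree \<open>2 b\<close>.
\<close>

definition smoothness_tests ::
  "real \<Rightarrow> real \<Rightarrow> real \<Rightarrow> real \<Rightarrow> real \<Rightarrow> (nat \<Rightarrow> (nat \<Rightarrow> (real ^ 'n::finite) \<times> bool) \<Rightarrow> bool) \<Rightarrow> real \<Rightarrow> bool" where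
  "smoothness_tests M c C \<delta> b \<Psi> L0 \<longleftrightarrow> 0 < L0 \<and> (\<forall>n. Measurable.pred (sample_space n) (\<Psi> n)) \<and>
    (\<forall>\<^sub>F n in sequentially. \<forall>f\<in>F_class phiI J0 M (2 * b). \<forall>g\<in>G_class c C.
       holds_up_to n f g (2 * \<delta>) (\<lambda>\<omega>. \<not> \<Psi> n \<omega>)) \<and>
    (\<forall>\<^sub>F n in sequentially. \<forall>L\<ge>L0. \<forall>f\<in>F_class phiI J0 M b. \<forall>g\<in>G_class c C.
       L * rho_rate CARD('n) n b \<le> L2_setdist f (F_class phiI J0 M (2 * b)) \<longrightarrow> holds_up_to n f g \<delta> (\<Psi> n))"

text \<open>
  The candidates are taken from \<open>\<F>\<^bsub>2b\<^esub>(M)\<close> itself.  Under the hypothesis the estimator is within order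
  \<open>\<epsilon>\<^sub>n(2 b) = \<rho>\<^sub>n(b)\<close> of \<open>f\<close>, so the statistic is at most \<open>t \<rho>\<^sub>n(b)\<^sup>2\<close>.  Under the alternative every
  candidate is at distance at least \<open>L \<rho>\<^sub>n(b)\<close> from \<open>f\<close>, which a statistic below that threshold would contradict
  once \<open>L\<close> is large.
\<close>

lemma smoothness_test:
  assumes M: "0 < M" and c: "0 < c" "c \<le> 1" and C: "1 \<le> C" and \<delta>: "0 < \<delta>" "\<delta> \<le> 1" and b: "0 < b"
  shows "\<exists>(\<Psi> :: nat \<Rightarrow> (nat \<Rightarrow> (real ^ 'n::finite) \<times> bool) \<Rightarrow> bool) L0. smoothness_tests M c C \<delta> b \<Psi> L0"
proof -
  let ?d = "CARD('n)"
  have cC: "c \<le> C" using c C by simp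
  define M1 where "M1 = M / (1 - 2 powr (- b))"
  have M1: "0 < M1" unfolding M1_def using M b by (simp add: powr_less_one)
  obtain A where A: "0 < A" and stage: "\<forall>n\<ge>(3::nat). \<forall>J\<ge>J0. \<forall>Mods (H :: (real ^ 'n \<Rightarrow> real) set).
    finite Mods \<longrightarrow> Mods \<noteq> {} \<longrightarrow> (\<forall>k\<in>Mods. J0 \<le> k) \<longrightarrow>
    (\<forall>h\<in>H. h \<in> borel_measurable cube_measure \<and> (\<forall>x. 0 \<le> h x \<and> h x \<le> 1)) \<longrightarrow> (\<lambda>_. 0) \<in> H \<longrightarrow>
    (\<exists>idx hs U. two_stage n J Mods H c C (M1\<^sup>2) A \<delta> (noise_level C \<delta> (2 ^ (J * CARD('n))) (n div 3)) idx hs U)"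
    using two_stage_exists[OF c C zero_le_power2[of M1] \<delta>, where 'n = 'n] by (elim exE conjE) (rule that)
  define J where "J n = level (2 / (4 * b + real ?d)) n" for n
  define k where "k n = level (1 / (2 * (2 * b) + real ?d)) n" for n
  define sl where "sl n = noise_level C \<delta> (2 ^ (J n * ?d)) (n div 3)" for n
  define good where "good n \<longleftrightarrow> 3 \<le> n \<and> J0 \<le> J n \<and> J0 \<le> k n" for n
  define H where "H = {h \<in> F_class phiI J0 M (2 * b) :: (real ^ 'n \<Rightarrow> real) set. \<forall>x. 0 \<le> h x \<and> h x \<le> 1}"
  have Hm: "h \<in> borel_measurable cube_measure" if "h \<in> H" for h
    using that L2_spaceD[OF F_class_L2] unfolding H_def by blast
  have H0: "(\<lambda>_. 0) \<in> H" using zero_in_F_class[OF M] by (simp add: H_def)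
  have "\<exists>idx hs U. two_stage n (J n) {k n} H c C (M1\<^sup>2) A \<delta> (sl n) idx hs U" if "good n" for n
    unfolding sl_def
    by (rule stage[rule_format]) (use that Hm H0 in \<open>auto simp: good_def H_def\<close>)
  then obtain idx hs U where ts: "\<And>n. good n \<Longrightarrow> two_stage n (J n) {k n} H c C (M1\<^sup>2) A \<delta> (sl n) (idx n) (hs n) (U n)"
    by metis
  have hsH: "hs n i \<in> H" and Um: "U n \<in> borel_measurable (sample_space n)" if "good n" for n i
    using ts[OF that] by (auto simp: two_stage_def)
  have hsL: "hs n i \<in> L2_space" if "good n" for n i
    using F_class_L2 hsH[OF that] by (auto simp: H_def)
  have ev_good: "\<forall>\<^sub>F n in sequentially. good n"
    unfolding good_def J_def k_def using b
    by (intro eventually_conj eventually_ge_at_top level_eventually) auto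
  define v where "v = 36 * C\<^sup>2 / \<delta> * (5 * 2 ^ ?d)"
  have v0: "0 \<le> v" unfolding v_def using \<delta> by simp
  have sl_le: "sl n \<le> v * (rho_rate ?d n b)\<^sup>2" if "good n" for n
    unfolding sl_def J_def v_def using that by (intro noise_level_bound b \<delta>) (simp add: good_def)
  define t where "t = 2 * C\<^sup>2 * (A * (5 * 2 ^ ?d)) + v"
  have t0: "0 \<le> t" unfolding t_def using A v0 by simp
  define L0 where "L0 = 1 / c * (sqrt (2 * t + v) + 4 * C * M1) + 1"
  have L0: "0 < L0" unfolding L0_def using c C M1 t0 v0 by (intro add_nonneg_pos mult_nonneg_nonneg) auto
  define \<Psi> where "\<Psi> n \<omega> \<longleftrightarrow> good n \<and> t * (rho_rate ?d n b)\<^sup>2 < U n \<omega>" for n \<omega>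
  have \<Psi>m: "Measurable.pred (sample_space n) (\<Psi> n)" for n
  proof (cases "good n")
    case True
    note [measurable] = Um[OF True]
    show ?thesis unfolding \<Psi>_def[abs_def] by measurable
  qed (simp add: \<Psi>_def[abs_def])
  have level_err: "holds_up_to n f g (2 * \<delta>) (\<lambda>\<omega>. \<not> \<Psi> n \<omega>)"
    if n: "good n" and f: "f \<in> F_class phiI J0 M (2 * b)" and g: "g \<in> G_class c C" for n f g
  proof -
    note clip = F_class_clip[OF f g c(1) cC]
    let ?f = "clip 0 1 f" and ?g = "clip c C g" and ?\<rho> = "rho_rate ?d n b"
    have n3: "3 \<le> n" using n by (simp add: good_def)
    have fH: "?f \<in> H" using clip(3,5,6) by (simp add: H_def)
    have bias: "(proj_err (k n) ?f)\<^sup>2 \<le> M1\<^sup>2 * 2 ^ (k n * ?d) / real (n div 3)"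
      unfolding M1_def using b M n by (intro F_class_bias_level[OF clip(3)]) (auto simp: clip(5,6) good_def k_def)
    have bound: "\<not> \<Psi> n \<omega>"
      if U_le: "U n \<omega> \<le> 2 * (C * L2_dist ?f (hs n (idx n \<omega>)))\<^sup>2 + sl n"
        and risk: "(L2_dist ?f (hs n (idx n \<omega>)))\<^sup>2 \<le> A * 2 ^ (k n * ?d) / real (n div 3)" for \<omega>
    proof -
      let ?D = "L2_dist ?f (hs n (idx n \<omega>))"
      have "?D\<^sup>2 \<le> A * (2 ^ (k n * ?d) / real (n div 3))" using risk by simp
      also have "\<dots> \<le> A * (5 * 2 ^ ?d * (eps_rate ?d n (2 * b))\<^sup>2)"
        using A b n3 by (intro mult_left_mono bias_level_bound(2)) (auto simp: k_def)
      finally have "?D\<^sup>2 \<le> A * (5 * 2 ^ ?d) * ?\<rho>\<^sup>2" by (simp add: eps_rate_double)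
      then have "2 * C\<^sup>2 * ?D\<^sup>2 \<le> 2 * C\<^sup>2 * (A * (5 * 2 ^ ?d) * ?\<rho>\<^sup>2)" by (intro mult_left_mono) auto
      moreover have "U n \<omega> \<le> 2 * C\<^sup>2 * ?D\<^sup>2 + sl n" using U_le by (simp add: power_mult_distrib)
      ultimately have "U n \<omega> \<le> 2 * C\<^sup>2 * (A * (5 * 2 ^ ?d) * ?\<rho>\<^sup>2) + v * ?\<rho>\<^sup>2"
        using sl_le[OF n] by linarith
      also have "\<dots> = t * ?\<rho>\<^sup>2" by (simp add: t_def algebra_simps)
      finally show ?thesis by (simp add: \<Psi>_def)
    qed
    have "holds_up_to n ?f ?g (\<delta> + \<delta>) (\<lambda>\<omega>. \<not> \<Psi> n \<omega>)"
      using bound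
      by (intro holds_up_to_mono[OF holds_up_to_conj[OF two_stage_error[OF ts[OF n] clip(1)]
            two_stage_risk[OF ts[OF n] clip(1) fH singletonI bias]]]) auto
    then show ?thesis by (intro holds_up_to_law_cong[OF clip(2)]) simp
  qed
  have power_err: "holds_up_to n f g \<delta> (\<Psi> n)"
    if n: "good n" and L: "L0 \<le> L" and f: "f \<in> F_class phiI J0 M b" and g: "g \<in> G_class c C"
      and sep: "L * rho_rate ?d n b \<le> L2_setdist f (F_class phiI J0 M (2 * b))" for n L f g
  proof -
    note clip = F_class_clip[OF f g c(1) cC]
    let ?f = "clip 0 1 f" and ?\<rho> = "rho_rate ?d n b"
    have n3: "3 \<le> n" and J: "J0 \<le> J n" using n by (auto simp: good_def)
    have \<rho>: "0 < ?\<rho>" using n3 by (simp add: rho_rate_def)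
    have pj: "proj_err (J n) h \<le> M1 * ?\<rho>" if h: "h \<in> F_class phiI J0 M b" "\<And>x. 0 \<le> h x" "\<And>x. h x \<le> 1" for h
    proof -
      have "proj_err (J n) h \<le> M1 * 2 powr (- (real (J n) * b))"
        unfolding M1_def using h M b J by (intro F_class_bias_uniform) auto
      also have "\<dots> \<le> M1 * ?\<rho>"
        using M1 n3 b by (intro mult_left_mono signal_level_bound(1)) (auto simp: J_def)
      finally show ?thesis .
    qed
    have bound: "\<Psi> n \<omega>"
      if dist: "L2_dist ?f (hs n (idx n \<omega>)) \<le> 1 / c * (sqrt (max 0 (2 * U n \<omega> + sl n)) + 2 * C * (proj_err (J n) ?f + proj_err (J n) (hs n (idx n \<omega>))))" for \<omega>
    proof (rule ccontr)
      let ?h = "hs n (idx n \<omega>)"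
      assume "\<not> \<Psi> n \<omega>"
      then have U: "U n \<omega> \<le> t * ?\<rho>\<^sup>2" using n by (simp add: \<Psi>_def)
      have hF: "?h \<in> F_class phiI J0 M (2 * b)" "\<And>x. 0 \<le> ?h x" "\<And>x. ?h x \<le> 1"
        using hsH[OF n, of "idx n \<omega>"] by (auto simp: H_def)
      have hFb: "?h \<in> F_class phiI J0 M b" using hF(1) F_class_mono[of b "2 * b"] b by auto
      have "L * ?\<rho> \<le> L2_setdist f (F_class phiI J0 M (2 * b))" by (rule sep)
      also have "\<dots> \<le> L2_dist f ?h"
        unfolding L2_setdist_def by (intro cINF_lower hF(1)) (auto intro!: bdd_belowI2[of _ 0])
      also have "\<dots> = L2_dist ?f ?h" by (rule clip(4)[OF hsL[OF n]])
      also have "\<dots> \<le> 1 / c * (sqrt (max 0 (2 * U n \<omega> + sl n)) + 2 * C * (proj_err (J n) ?f + proj_err (J n) ?h))"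
        by (rule dist)
      also have "\<dots> \<le> 1 / c * (sqrt (2 * t + v) * ?\<rho> + 2 * C * (M1 * ?\<rho> + M1 * ?\<rho>))"
      proof (intro mult_left_mono add_mono pj clip(3,5,6) hFb hF(2,3))
        have "2 * U n \<omega> + sl n \<le> (2 * t + v) * ?\<rho>\<^sup>2" using U sl_le[OF n] by (simp add: algebra_simps)
        moreover have "0 \<le> (2 * t + v) * ?\<rho>\<^sup>2" using t0 v0 by simp
        ultimately have "sqrt (max 0 (2 * U n \<omega> + sl n)) \<le> sqrt ((2 * t + v) * ?\<rho>\<^sup>2)"
          by (intro real_sqrt_le_mono) simp
        then show "sqrt (max 0 (2 * U n \<omega> + sl n)) \<le> sqrt (2 * t + v) * ?\<rho>"
          using \<rho> by (simp add: real_sqrt_mult)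
      qed (use c C in auto)
      also have "\<dots> = (L0 - 1) * ?\<rho>" unfolding L0_def by (simp add: algebra_simps)
      also have "\<dots> < L * ?\<rho>" using L \<rho> by (intro mult_strict_right_mono) auto
      finally show False by simp
    qed
    show ?thesis
      using bound
      by (intro holds_up_to_law_cong[OF clip(2)] holds_up_to_mono[OF two_stage_error[OF ts[OF n] clip(1)]]) auto
  qed
  show ?thesis
    unfolding smoothness_tests_def
  proof (intro exI[of _ \<Psi>] exI[of _ L0] conjI L0 allI \<Psi>m)
    show "\<forall>\<^sub>F n in sequentially. \<forall>f\<in>F_class phiI J0 M (2 * b). \<forall>g\<in>G_class c C.
       holds_up_to n f g (2 * \<delta>) (\<lambda>\<omega>. \<not> \<Psi> n \<omega>)"
      using ev_good by eventually_elim (intro ballI level_err)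
    show "\<forall>\<^sub>F n in sequentially. \<forall>L\<ge>L0. \<forall>f\<in>F_class phiI J0 M b. \<forall>g\<in>G_class c C.
       L * rho_rate CARD('n) n b \<le> L2_setdist f (F_class phiI J0 M (2 * b)) \<longrightarrow> holds_up_to n f g \<delta> (\<Psi> n)"
      using ev_good by eventually_elim (intro allI impI ballI power_err)
  qed
qed

end

section \<open>Adaptive confidence sets\<close>

lemma coverage_prob_ge:
  assumes P: "prob_space (sample_law n f g)"
    and A: "{\<omega> \<in> space (sample_space n). f \<in> A \<omega>} \<in> sets (sample_space n)"
    and cover: "holds_up_to n f g a (\<lambda>\<omega>. f \<in> A \<omega>)" "a \<le> a'"
  shows "1 - a' \<le> coverage_prob n A f g"
proof -
  interpret P: prob_space "sample_law n f g" by (rule P)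
  obtain E where E: "E \<in> sets (sample_space n)" "measure (sample_law n f g) E \<le> a"
    "\<forall>\<omega>\<in>space (sample_space n) - E. f \<in> A \<omega>"
    using cover(1) unfolding holds_up_to_def by blast
  have "1 - a' \<le> measure (sample_law n f g) (space (sample_law n f g) - E)"
    using P.prob_compl[of E] E(1,2) cover(2) by simp
  also have "\<dots> \<le> measure (sample_law n f g) {\<omega> \<in> space (sample_law n f g). f \<in> A \<omega>}"
    using A E(3) by (intro P.finite_measure_mono) auto
  finally show ?thesis by (simp add: coverage_prob_def)
qed

lemma diam_exceed_prob_le:
  assumes P: "prob_space (sample_law n f g)"
    and diam: "holds_up_to n f g a (\<lambda>\<omega>. L2_diam (A \<omega>) \<le> ennreal r)" "a \<le> a'"
  shows "diam_exceed_prob n A r f g \<le> a'"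
proof -
  interpret P: prob_space "sample_law n f g" by (rule P)
  obtain E where E: "E \<in> sets (sample_space n)" "measure (sample_law n f g) E \<le> a"
    "\<forall>\<omega>\<in>space (sample_space n) - E. L2_diam (A \<omega>) \<le> ennreal r"
    using diam(1) unfolding holds_up_to_def by blast
  have "diam_exceed_prob n A r f g \<le> measure (sample_law n f g) E"
    unfolding diam_exceed_prob_def using E(1,3) by (intro P.finite_measure_mono) (auto simp: not_less[symmetric])
  then show ?thesis using E(2) diam(2) by simp
qed

lemma eps_rate_antimono:
  assumes "1 \<le> n" "0 < \<beta>" "\<beta> \<le> \<beta>'"
  shows "eps_rate d n \<beta>' \<le> eps_rate d n \<beta>"
  unfolding eps_rate_def
proof (rule powr_mono)
  have "\<beta> * real d \<le> \<beta>' * real d" using assms by (intro mult_right_mono) auto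
  then have "\<beta> * (2 * \<beta>' + real d) \<le> \<beta>' * (2 * \<beta> + real d)" by (simp add: algebra_simps)
  moreover have "0 < 2 * \<beta> + real d" "0 < 2 * \<beta>' + real d" using assms by auto
  ultimately have "\<beta> / (2 * \<beta> + real d) \<le> \<beta>' / (2 * \<beta>' + real d)"
    by (metis divide_le_eq le_divide_eq times_divide_eq_left)
  then show "- \<beta>' / (2 * \<beta>' + real d) \<le> - \<beta> / (2 * \<beta> + real d)" by simp
qed (use assms in auto)

context cdv_wavelets
begin

lemma F_class_prob_space:
  assumes "f \<in> F_class phiI J0 M s" "g \<in> G_class c C" "0 < c" "c \<le> C"
  shows "prob_space (sample_law n f g)"
  unfolding F_class_clip(2)[OF assms] by (rule binary_regression.prob_space_sample_law[OF F_class_clip(1)[OF assms]])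

lemma adaptive_small_window:
  assumes M: "0 < M" and c: "0 < c" "c \<le> 1" and C: "1 \<le> C"
    and bm: "0 < bm" and bp: "bp \<le> 2 * bm" and \<alpha>: "0 < \<alpha>" "\<alpha> < 1" "0 < \<alpha>'" "\<alpha>' < 1"
  shows "\<exists>(Cn :: nat \<Rightarrow> (nat \<Rightarrow> (real ^ 'n::finite) \<times> bool) \<Rightarrow> (real ^ 'n \<Rightarrow> real) set) (K :: real).
          0 < K \<and> (\<forall>n. random_closed_set n (Cn n)) \<and>
          liminf (\<lambda>n. INF \<beta>\<in>{bm..bp}. INF f\<in>F_class phiI J0 M \<beta>. INF g\<in>G_class c C.
            ereal (coverage_prob n (Cn n) f g)) \<ge> ereal (1 - \<alpha>) \<and>
          (\<forall>\<beta>\<in>{bm..bp}.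
             limsup (\<lambda>n. SUP f\<in>F_class phiI J0 M \<beta>. SUP g\<in>G_class c C.
               ereal (diam_exceed_prob n (Cn n) (K * eps_rate CARD('n) n \<beta>) f g)) \<le> ereal \<alpha>')"
proof -
  have cC: "c \<le> C" using c C by simp
  define \<delta> where "\<delta> = min \<alpha> (\<alpha>' / 2)"
  have \<delta>: "0 < \<delta>" "\<delta> \<le> 1" "\<delta> \<le> \<alpha>" "2 * \<delta> \<le> \<alpha>'" using \<alpha> by (auto simp: \<delta>_def)
  obtain Cn :: "nat \<Rightarrow> (nat \<Rightarrow> (real ^ 'n) \<times> bool) \<Rightarrow> (real ^ 'n \<Rightarrow> real) set" and K
    where W: "window_sets M c C \<delta> bm Cn K"
    using window_confidence_set[OF M c C \<delta>(1,2) bm, where 'n = 'n] by blast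
  have K: "0 < K" and closed: "\<forall>n. random_closed_set n (Cn n)"
    and member: "\<forall>n f. {\<omega> \<in> space (sample_space n). f \<in> Cn n \<omega>} \<in> sets (sample_space n)"
    and cover: "\<forall>\<^sub>F n in sequentially. \<forall>f\<in>F_class phiI J0 M bm. \<forall>g\<in>G_class c C.
       holds_up_to n f g \<delta> (\<lambda>\<omega>. f \<in> Cn n \<omega>)"
    and diam: "\<forall>\<beta>\<in>{bm..2*bm}. \<forall>\<^sub>F n in sequentially. \<forall>f\<in>F_class phiI J0 M \<beta>. \<forall>g\<in>G_class c C.
       holds_up_to n f g (2 * \<delta>) (\<lambda>\<omega>. L2_diam (Cn n \<omega>) \<le> ennreal (K * eps_rate CARD('n) n \<beta>))"
    using W unfolding window_sets_def by blast+
  show ?thesis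
  proof (intro exI[of _ Cn] exI[of _ K] conjI K closed ballI)
    have "\<forall>\<^sub>F n in sequentially. ereal (1 - \<alpha>) \<le> (INF \<beta>\<in>{bm..bp}. INF f\<in>F_class phiI J0 M \<beta>. INF g\<in>G_class c C.
            ereal (coverage_prob n (Cn n) f g))"
      using cover
    proof eventually_elim
      case (elim n)
      have "1 - \<alpha> \<le> coverage_prob n (Cn n) f g"
        if \<beta>: "\<beta> \<in> {bm..bp}" and f: "f \<in> F_class phiI J0 M \<beta>" and g: "g \<in> G_class c C" for \<beta> f g
      proof -
        have "f \<in> F_class phiI J0 M bm" using f F_class_mono[of bm \<beta>] \<beta> by auto
        then show ?thesis
          using elim g \<delta>(3) by (intro coverage_prob_ge[OF F_class_prob_space[OF f g c(1) cC] member[rule_format]]) auto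
      qed
      then show ?case by (intro INF_greatest) simp
    qed
    then show "ereal (1 - \<alpha>) \<le> liminf (\<lambda>n. INF \<beta>\<in>{bm..bp}. INF f\<in>F_class phiI J0 M \<beta>. INF g\<in>G_class c C.
            ereal (coverage_prob n (Cn n) f g))"
      by (rule Liminf_bounded)
    fix \<beta> assume \<beta>: "\<beta> \<in> {bm..bp}"
    then have \<beta>2: "\<beta> \<in> {bm..2*bm}" using bp by auto
    have "\<forall>\<^sub>F n in sequentially. (SUP f\<in>F_class phiI J0 M \<beta>. SUP g\<in>G_class c C.
               ereal (diam_exceed_prob n (Cn n) (K * eps_rate CARD('n) n \<beta>) f g)) \<le> ereal \<alpha>'"
      using bspec[OF diam \<beta>2]
    proof eventually_elim
      case (elim n)
      have "diam_exceed_prob n (Cn n) (K * eps_rate CARD('n) n \<beta>) f g \<le> \<alpha>'"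
        if f: "f \<in> F_class phiI J0 M \<beta>" and g: "g \<in> G_class c C" for f g
        using elim f g \<delta>(4) by (intro diam_exceed_prob_le[OF F_class_prob_space[OF f g c(1) cC]]) auto
      then show ?case by (intro SUP_least) simp
    qed
    then show "limsup (\<lambda>n. SUP f\<in>F_class phiI J0 M \<beta>. SUP g\<in>G_class c C.
               ereal (diam_exceed_prob n (Cn n) (K * eps_rate CARD('n) n \<beta>) f g)) \<le> ereal \<alpha>'"
      by (rule Limsup_bounded)
  qed
qed

lemma scale_Suc: "1 \<le> j \<Longrightarrow> scale b (j + 1) = 2 * scale b j"
  by (cases j) (auto simp: scale_def)

lemma scale_mono: "0 < b \<Longrightarrow> i \<le> j \<Longrightarrow> scale b i \<le> scale b j"
  unfolding scale_def by (intro mult_right_mono power_increasing) auto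

lemma num_scales_bounds:
  assumes "0 < bm" "2 * bm < bp"
  shows "2 \<le> num_scales bm bp" and "bp \<le> 2 * scale bm (num_scales bm bp)"
proof -
  let ?N = "num_scales bm bp"
  have "2 < bp / bm" using assms by (simp add: less_divide_eq)
  then have "log 2 2 < log 2 (bp / bm)" by (subst log_less_cancel_iff) auto
  then have l: "1 < log 2 (bp / bm)" by simp
  then have N: "real ?N = of_int \<lceil>log 2 (bp / bm)\<rceil>" by (simp add: num_scales_def)
  then have le: "log 2 (bp / bm) \<le> real ?N" by simp
  then show N2: "2 \<le> ?N" using l by linarith
  have "bp / bm = 2 powr (log 2 (bp / bm))" using assms by simp
  also have "\<dots> \<le> 2 powr real ?N" using le by (intro powr_mono) auto
  also have "\<dots> = 2 ^ ?N" by (simp add: powr_realpow)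
  finally have "bp \<le> 2 ^ ?N * bm" using assms by (simp add: divide_le_eq)
  also have "(2::real) ^ ?N = 2 * 2 ^ (?N - 1)" using N2 by (simp add: power_eq_if)
  finally show "bp \<le> 2 * scale bm ?N" by (simp add: scale_def mult.assoc)
qed

text \<open>
  Let \<open>f\<close> lie in the \<open>j\<close>-th component.  For \<open>i < j\<close> it also lies in the class of degree \<open>2 s\<^sub>i \<le> s\<^sub>j\<close>, so
  the tests at these scales accept, while the test at scale \<open>j < N\<close> rejects.  Hence \<open>jhat = j\<close> up to a
  small probability, and the window \<open>[s\<^sub>j, 2 s\<^sub>j]\<close> is the right one.  If \<open>f\<close> has degree \<open>\<beta> > 2 s\<^sub>j\<close> and \<open>j < N\<close>, then its
  distance to the class of degree \<open>2 s\<^sub>j\<close> is \<open>0\<close>, which the separation forbids; and a degree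
  \<open>\<beta> < s\<^sub>j\<close> only makes the claim about the diameter weaker.
\<close>

lemma adaptive_separated:
  assumes M: "0 < M" and c: "0 < c" "c \<le> 1" and C: "1 \<le> C"
    and bm: "0 < bm" and bp: "2 * bm < bp" and \<alpha>: "0 < \<alpha>" "\<alpha> < 1" "0 < \<alpha>'" "\<alpha>' < 1"
  shows "\<exists>(Cn :: nat \<Rightarrow> (nat \<Rightarrow> (real ^ 'n::finite) \<times> bool) \<Rightarrow> (real ^ 'n \<Rightarrow> real) set)
          (L0 :: real) (K :: real).
          0 < L0 \<and> 0 < K \<and> (\<forall>n. random_closed_set n (Cn n)) \<and>
          (\<forall>L\<ge>L0.
             liminf (\<lambda>n. INF f\<in>F_sep phiI J0 M bm bp L n. INF g\<in>G_class c C.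
               ereal (coverage_prob n (Cn n) f g)) \<ge> ereal (1 - \<alpha>) \<and>
             (\<forall>\<beta>\<in>{bm..bp}.
                limsup (\<lambda>n. SUP f\<in>F_sep phiI J0 M bm bp L n \<inter> F_class phiI J0 M \<beta>.
                  SUP g\<in>G_class c C.
                  ereal (diam_exceed_prob n (Cn n) (K * eps_rate CARD('n) n \<beta>) f g)) \<le> ereal \<alpha>'))"
proof -
  let ?d = "CARD('n)"
  have cC: "c \<le> C" using c C by simp
  define N where "N = num_scales bm bp"
  have N: "2 \<le> N" "bp \<le> 2 * scale bm N" unfolding N_def using num_scales_bounds[OF bm bp] by auto
  let ?s = "scale bm"
  have s0: "0 < ?s j" for j using bm by (simp add: scale_def)
  (* At most N - 1 level errors of size 2 \<delta>, one power error \<delta> and a diameter error 2 \<delta> have to fit. *)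
  define \<delta> where "\<delta> = min \<alpha> \<alpha>' / (2 * real N + 1)"
  have \<delta>N: "(2 * real N + 1) * \<delta> = min \<alpha> \<alpha>'" unfolding \<delta>_def by simp
  have \<delta>: "0 < \<delta>" unfolding \<delta>_def using \<alpha> by simp
  have \<delta>1: "\<delta> \<le> 1"
  proof -
    have "1 * \<delta> \<le> (2 * real N + 1) * \<delta>" using \<delta> by (intro mult_right_mono) auto
    then show ?thesis using \<delta>N \<alpha> by linarith
  qed
  have "\<exists>(Cn :: nat \<Rightarrow> (nat \<Rightarrow> (real ^ 'n) \<times> bool) \<Rightarrow> (real ^ 'n \<Rightarrow> real) set) K. window_sets M c C \<delta> (?s j) Cn K" for j
    by (rule window_confidence_set[OF M c C \<delta> \<delta>1 s0])
  then obtain CC :: "nat \<Rightarrow> nat \<Rightarrow> (nat \<Rightarrow> (real ^ 'n) \<times> bool) \<Rightarrow> (real ^ 'n \<Rightarrow> real) set" and KK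
    where W: "\<And>j. window_sets M c C \<delta> (?s j) (CC j) (KK j)"
    by metis
  have "\<exists>(\<Psi> :: nat \<Rightarrow> (nat \<Rightarrow> (real ^ 'n) \<times> bool) \<Rightarrow> bool) L0. smoothness_tests M c C \<delta> (?s j) \<Psi> L0" for j
    by (rule smoothness_test[OF M c C \<delta> \<delta>1 s0])
  then obtain \<Psi> :: "nat \<Rightarrow> nat \<Rightarrow> (nat \<Rightarrow> (real ^ 'n) \<times> bool) \<Rightarrow> bool" and LL
    where T: "\<And>j. smoothness_tests M c C \<delta> (?s j) (\<Psi> j) (LL j)"
    by metis
  define jhat where "jhat n \<omega> = (LEAST j. 1 \<le> j \<and> (N \<le> j \<or> \<Psi> j n \<omega>))" for n \<omega>
  define Cn where "Cn n \<omega> = CC (jhat n \<omega>) n \<omega>" for n \<omega>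
  define L0 where "L0 = 1 + (\<Sum>j\<in>{1..N}. LL j)"
  define K where "K = 1 + (\<Sum>j\<in>{1..N}. KK j)"
  have LL0: "0 < LL j" and KK0: "0 < KK j" for j using T[of j] W[of j] by (auto simp: smoothness_tests_def window_sets_def)
  have L0: "0 < L0" unfolding L0_def using LL0 by (intro add_pos_nonneg sum_nonneg) (auto simp: less_imp_le)
  have K0: "0 < K" unfolding K_def using KK0 by (intro add_pos_nonneg sum_nonneg) (auto simp: less_imp_le)
  have LL_le: "LL j \<le> L0" if "j \<in> {1..N}" for j
    using member_le_sum[OF that, of LL] LL0 unfolding L0_def by (force simp: less_imp_le)
  have KK_le: "KK j \<le> K" if "j \<in> {1..N}" for j
    using member_le_sum[OF that, of KK] KK0 unfolding K_def by (force simp: less_imp_le)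
  have jm: "jhat n \<in> sample_space n \<rightarrow>\<^sub>M count_space UNIV" for n
    unfolding jhat_def[abs_def]
  proof (rule measurable_Least)
    fix j
    have [measurable]: "Measurable.pred (sample_space n) (\<Psi> j n)" using T[of j] by (simp add: smoothness_tests_def)
    show "(\<lambda>\<omega>. 1 \<le> j \<and> (N \<le> j \<or> \<Psi> j n \<omega>)) \<in> sample_space n \<rightarrow>\<^sub>M count_space UNIV" by measurable
  qed
  have closed: "random_closed_set n (Cn n)" for n
    unfolding random_closed_set_def
  proof (intro conjI ballI allI impI)
    have rc: "random_closed_set n (CC j n)" for j using W[of j] by (simp add: window_sets_def)
    show "L2_closed (Cn n \<omega>)" if "\<omega> \<in> space (sample_space n)" for \<omega>
      using rc that unfolding random_closed_set_def Cn_def by blast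
    fix V :: "(real ^ 'n \<Rightarrow> real) set" assume "L2_open V"
    then have "Measurable.pred (sample_space n) (\<lambda>\<omega>. CC j n \<omega> \<inter> V \<noteq> {})" for j
      using rc[of j] unfolding random_closed_set_def pred_def by blast
    from measurable_compose_countable[OF this jm]
    show "{\<omega> \<in> space (sample_space n). Cn n \<omega> \<inter> V \<noteq> {}} \<in> sets (sample_space n)"
      by (simp add: Cn_def pred_def)
  qed
  have member: "{\<omega> \<in> space (sample_space n). f \<in> Cn n \<omega>} \<in> sets (sample_space n)" for n f
  proof -
    have "Measurable.pred (sample_space n) (\<lambda>\<omega>. f \<in> CC j n \<omega>)" for j
      using W[of j] unfolding window_sets_def pred_def by blast
    from measurable_compose_countable[OF this jm] show ?thesis by (simp add: Cn_def pred_def)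
  qed
  (* comp n L f j: the function f belongs to the j-th of the N components of the separated class. *)
  define comp where "comp n L f j \<longleftrightarrow> j \<in> {1..N} \<and> f \<in> F_class phiI J0 M (?s j) \<and>
      (j < N \<longrightarrow> L * rho_rate ?d n (?s j) \<le> L2_setdist f (F_class phiI J0 M (2 * ?s j)))"
    for n L and f :: "real ^ 'n \<Rightarrow> real" and j
  have comp_ex: "\<exists>j. comp n L f j" if f: "f \<in> F_sep phiI J0 M bm bp L n" for n L and f :: "real ^ 'n \<Rightarrow> real"
  proof -
    consider "f \<in> F_class phiI J0 M (?s N)" |
      j where "j \<in> {1..N - 1}" "f \<in> F_class phiI J0 M (?s j)"
        "L * rho_rate ?d n (?s j) \<le> L2_setdist f (F_class phiI J0 M (?s (j + 1)))"
      using f unfolding F_sep_def N_def[symmetric] by blast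
    then show ?thesis
    proof cases
      case 1
      then show ?thesis using N(1) by (intro exI[of _ N]) (simp add: comp_def)
    next
      case (2 j)
      then show ?thesis using scale_Suc[of j bm] by (intro exI[of _ j]) (auto simp: comp_def)
    qed
  qed
  have ev_null: "\<forall>\<^sub>F n in sequentially. \<forall>i\<in>{1..N}. \<forall>f\<in>F_class phiI J0 M (2 * ?s i). \<forall>g\<in>G_class c C.
       holds_up_to n f g (2 * \<delta>) (\<lambda>\<omega>. \<not> \<Psi> i n \<omega>)"
    by (rule eventually_ball_finite[OF finite_atLeastAtMost], rule ballI)
       (rule T[unfolded smoothness_tests_def, THEN conjunct2, THEN conjunct2, THEN conjunct1])
  have ev_alt: "\<forall>\<^sub>F n in sequentially. \<forall>i\<in>{1..N}. \<forall>L\<ge>LL i. \<forall>f\<in>F_class phiI J0 M (?s i). \<forall>g\<in>G_class c C.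
       L * rho_rate ?d n (?s i) \<le> L2_setdist f (F_class phiI J0 M (2 * ?s i)) \<longrightarrow>
       holds_up_to n f g \<delta> (\<Psi> i n)"
    by (rule eventually_ball_finite[OF finite_atLeastAtMost], rule ballI)
       (rule T[unfolded smoothness_tests_def, THEN conjunct2, THEN conjunct2, THEN conjunct2])
  have ev_cover: "\<forall>\<^sub>F n in sequentially. \<forall>j\<in>{1..N}. \<forall>f\<in>F_class phiI J0 M (?s j). \<forall>g\<in>G_class c C.
       holds_up_to n f g \<delta> (\<lambda>\<omega>. f \<in> CC j n \<omega>)"
    by (rule eventually_ball_finite[OF finite_atLeastAtMost], rule ballI)
       (rule W[unfolded window_sets_def, THEN conjunct2, THEN conjunct2, THEN conjunct2, THEN conjunct1])
  define selects where "selects n \<longleftrightarrow> (\<forall>L\<ge>L0. \<forall>f j. \<forall>g\<in>G_class c C. comp n L f j \<longrightarrow>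
      holds_up_to n f g ((2 * real N - 1) * \<delta>) (\<lambda>\<omega>. jhat n \<omega> = j))" for n
  have ev_select: "\<forall>\<^sub>F n in sequentially. selects n"
    using ev_null ev_alt
  proof eventually_elim
    case (elim n)
    show ?case unfolding selects_def
    proof (intro allI ballI impI)
      fix L j and f g :: "real ^ 'n \<Rightarrow> real"
      assume L: "L0 \<le> L" and g: "g \<in> G_class c C" and cmp: "comp n L f j"
      have j: "j \<in> {1..N}" and f: "f \<in> F_class phiI J0 M (?s j)" using cmp by (auto simp: comp_def)
      have null: "holds_up_to n f g (2 * \<delta>) (\<lambda>\<omega>. \<not> \<Psi> i n \<omega>)" if i: "i \<in> {1..<j}" for i
      proof -
        have "2 * ?s i = ?s (i + 1)" using i scale_Suc[of i bm] by simp
        also have "\<dots> \<le> ?s j" using i bm by (intro scale_mono) auto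
        finally have "f \<in> F_class phiI J0 M (2 * ?s i)" using f F_class_mono by blast
        moreover have "i \<in> {1..N}" using i j by auto
        ultimately show ?thesis using elim(1) g by blast
      qed
      have power: "holds_up_to n f g \<delta> (\<lambda>\<omega>. N \<le> j \<or> \<Psi> j n \<omega>)"
      proof (cases "j < N")
        case True
        have "LL j \<le> L" using LL_le[OF j] L by simp
        moreover have "L * rho_rate ?d n (?s j) \<le> L2_setdist f (F_class phiI J0 M (2 * ?s j))"
          using cmp True by (simp add: comp_def)
        ultimately have "holds_up_to n f g \<delta> (\<Psi> j n)" by (intro elim(2)[rule_format, OF j _ f g])
        then show ?thesis by (rule holds_up_to_mono) auto
      qed (use \<delta> in \<open>auto intro: holds_up_to_certain\<close>)
      have "holds_up_to n f g (real (card {1..<j}) * (2 * \<delta>) + \<delta>) (\<lambda>\<omega>. (\<forall>i\<in>{1..<j}. \<not> \<Psi> i n \<omega>) \<and> (N \<le> j \<or> \<Psi> j n \<omega>))"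
        by (intro holds_up_to_conj holds_up_to_ball null power) auto
      then show "holds_up_to n f g ((2 * real N - 1) * \<delta>) (\<lambda>\<omega>. jhat n \<omega> = j)"
      proof (rule holds_up_to_mono)
        have "(real j - 1) * (2 * \<delta>) + \<delta> \<le> (real N - 1) * (2 * \<delta>) + \<delta>"
          using j \<delta> by (intro add_right_mono mult_right_mono) auto
        then show "real (card {1..<j}) * (2 * \<delta>) + \<delta> \<le> (2 * real N - 1) * \<delta>"
          using j by (simp add: of_nat_diff algebra_simps)
        fix \<omega> assume \<omega>: "(\<forall>i\<in>{1..<j}. \<not> \<Psi> i n \<omega>) \<and> (N \<le> j \<or> \<Psi> j n \<omega>)"
        show "jhat n \<omega> = j"
          unfolding jhat_def
        proof (rule Least_equality)
          show "1 \<le> j \<and> (N \<le> j \<or> \<Psi> j n \<omega>)" using j \<omega> by auto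
          show "j \<le> i" if "1 \<le> i \<and> (N \<le> i \<or> \<Psi> i n \<omega>)" for i
            using that \<omega> j by (cases "i < j") auto
        qed
      qed
    qed
  qed
  have cover: "1 - \<alpha> \<le> coverage_prob n (Cn n) f g"
    if sel: "selects n" and cov: "\<forall>j\<in>{1..N}. \<forall>f\<in>F_class phiI J0 M (?s j). \<forall>g\<in>G_class c C.
       holds_up_to n f g \<delta> (\<lambda>\<omega>. f \<in> CC j n \<omega>)"
      and L: "L0 \<le> L" and f: "f \<in> F_sep phiI J0 M bm bp L n" and g: "g \<in> G_class c C"
    for n L and f g :: "real ^ 'n \<Rightarrow> real"
  proof -
    obtain j where cmp: "comp n L f j" using comp_ex[OF f] by blast
    then have j: "j \<in> {1..N}" and fj: "f \<in> F_class phiI J0 M (?s j)" by (auto simp: comp_def)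
    have "holds_up_to n f g ((2 * real N - 1) * \<delta>) (\<lambda>\<omega>. jhat n \<omega> = j)"
      using sel L g cmp unfolding selects_def by blast
    moreover have "holds_up_to n f g \<delta> (\<lambda>\<omega>. f \<in> CC j n \<omega>)" using cov j fj g by blast
    ultimately have "holds_up_to n f g ((2 * real N - 1) * \<delta> + \<delta>) (\<lambda>\<omega>. jhat n \<omega> = j \<and> f \<in> CC j n \<omega>)"
      by (rule holds_up_to_conj)
    then have "holds_up_to n f g (min \<alpha> \<alpha>') (\<lambda>\<omega>. f \<in> Cn n \<omega>)"
      by (rule holds_up_to_mono) (use \<delta> \<delta>N in \<open>auto simp: Cn_def algebra_simps\<close>)
    then show ?thesis
      by (intro coverage_prob_ge[OF F_class_prob_space[OF fj g c(1) cC] member]) auto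
  qed
  have diam: "diam_exceed_prob n (Cn n) (K * eps_rate ?d n \<beta>) f g \<le> \<alpha>'"
    if sel: "selects n" and n: "1 \<le> n" and \<beta>: "\<beta> \<in> {bm..bp}"
      and dm: "\<forall>j\<in>{1..N}. max \<beta> (?s j) \<in> {?s j..2 * ?s j} \<longrightarrow> (\<forall>f\<in>F_class phiI J0 M (max \<beta> (?s j)). \<forall>g\<in>G_class c C.
       holds_up_to n f g (2 * \<delta>) (\<lambda>\<omega>. L2_diam (CC j n \<omega>) \<le> ennreal (KK j * eps_rate ?d n (max \<beta> (?s j)))))"
      and L: "L0 \<le> L" and f: "f \<in> F_sep phiI J0 M bm bp L n" and f\<beta>: "f \<in> F_class phiI J0 M \<beta>" and g: "g \<in> G_class c C"
    for n L \<beta> and f g :: "real ^ 'n \<Rightarrow> real"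
  proof -
    obtain j where cmp: "comp n L f j" using comp_ex[OF f] by blast
    then have j: "j \<in> {1..N}" and fj: "f \<in> F_class phiI J0 M (?s j)" by (auto simp: comp_def)
    (* f has both degrees, hence the larger one, and that one lies in the window of scale j. *)
    let ?b = "max \<beta> (?s j)"
    have fb: "f \<in> F_class phiI J0 M ?b" using f\<beta> fj by (simp add: max_def)
    have "\<beta> \<le> 2 * ?s j"
    proof (cases "j < N")
      case False
      then show ?thesis using j \<beta> N(2) by auto
    next
      case True
      show ?thesis
      proof (rule ccontr)
        assume "\<not> \<beta> \<le> 2 * ?s j"
        then have "f \<in> F_class phiI J0 M (2 * ?s j)" using f\<beta> F_class_mono[of "2 * ?s j" \<beta>] by auto
        then have "L2_setdist f (F_class phiI J0 M (2 * ?s j)) \<le> L2_dist f f"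
          unfolding L2_setdist_def by (intro cINF_lower) (auto intro!: bdd_belowI2[of _ 0])
        moreover have "L * rho_rate ?d n (?s j) \<le> L2_setdist f (F_class phiI J0 M (2 * ?s j))"
          using cmp True by (simp add: comp_def)
        moreover have "0 < L * rho_rate ?d n (?s j)" using L L0 n by (simp add: rho_rate_def)
        ultimately show False by simp
      qed
    qed
    then have bw: "?b \<in> {?s j..2 * ?s j}" using s0[of j] by auto
    have rate: "KK j * eps_rate ?d n ?b \<le> K * eps_rate ?d n \<beta>"
      using KK_le[OF j] K0 n \<beta> bm by (intro mult_mono eps_rate_antimono) (auto simp: eps_rate_def)
    have "holds_up_to n f g ((2 * real N - 1) * \<delta>) (\<lambda>\<omega>. jhat n \<omega> = j)"
      using sel L g cmp unfolding selects_def by blast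
    moreover have "holds_up_to n f g (2 * \<delta>) (\<lambda>\<omega>. L2_diam (CC j n \<omega>) \<le> ennreal (KK j * eps_rate ?d n ?b))"
      using dm j bw fb g by blast
    ultimately have "holds_up_to n f g ((2 * real N - 1) * \<delta> + 2 * \<delta>)
        (\<lambda>\<omega>. jhat n \<omega> = j \<and> L2_diam (CC j n \<omega>) \<le> ennreal (KK j * eps_rate ?d n ?b))"
      by (rule holds_up_to_conj)
    then have "holds_up_to n f g (min \<alpha> \<alpha>') (\<lambda>\<omega>. L2_diam (Cn n \<omega>) \<le> ennreal (K * eps_rate ?d n \<beta>))"
    proof (rule holds_up_to_mono)
      show "(2 * real N - 1) * \<delta> + 2 * \<delta> \<le> min \<alpha> \<alpha>'" using \<delta>N by (simp add: algebra_simps)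
      fix \<omega> assume "jhat n \<omega> = j \<and> L2_diam (CC j n \<omega>) \<le> ennreal (KK j * eps_rate ?d n ?b)"
      then show "L2_diam (Cn n \<omega>) \<le> ennreal (K * eps_rate ?d n \<beta>)"
        using ennreal_leI[OF rate] by (auto simp: Cn_def intro: order.trans)
    qed
    then show ?thesis
      by (intro diam_exceed_prob_le[OF F_class_prob_space[OF fj g c(1) cC]]) auto
  qed
  show ?thesis
  proof (rule exI[of _ Cn], rule exI[of _ L0], rule exI[of _ K], intro conjI L0 K0 allI closed impI ballI)
    fix L assume L: "L0 \<le> L"
    have "\<forall>\<^sub>F n in sequentially. ereal (1 - \<alpha>) \<le> (INF f\<in>F_sep phiI J0 M bm bp L n. INF g\<in>G_class c C.
               ereal (coverage_prob n (Cn n) f g))"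
      using ev_select ev_cover
    proof eventually_elim
      case (elim n)
      show ?case using cover[OF elim L] by (intro INF_greatest) simp
    qed
    then show "ereal (1 - \<alpha>) \<le> liminf (\<lambda>n. INF f\<in>F_sep phiI J0 M bm bp L n. INF g\<in>G_class c C.
               ereal (coverage_prob n (Cn n) f g))"
      by (rule Liminf_bounded)
    fix \<beta> assume \<beta>: "\<beta> \<in> {bm..bp}"
    have "\<forall>\<^sub>F n in sequentially. \<forall>j\<in>{1..N}. max \<beta> (?s j) \<in> {?s j..2 * ?s j} \<longrightarrow> (\<forall>f\<in>F_class phiI J0 M (max \<beta> (?s j)). \<forall>g\<in>G_class c C.
       holds_up_to n f g (2 * \<delta>) (\<lambda>\<omega>. L2_diam (CC j n \<omega>) \<le> ennreal (KK j * eps_rate ?d n (max \<beta> (?s j)))))"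
    proof (rule eventually_ball_finite[OF finite_atLeastAtMost], rule ballI)
      fix j
      show "\<forall>\<^sub>F n in sequentially. max \<beta> (?s j) \<in> {?s j..2 * ?s j} \<longrightarrow> (\<forall>f\<in>F_class phiI J0 M (max \<beta> (?s j)). \<forall>g\<in>G_class c C.
       holds_up_to n f g (2 * \<delta>) (\<lambda>\<omega>. L2_diam (CC j n \<omega>) \<le> ennreal (KK j * eps_rate ?d n (max \<beta> (?s j)))))"
      proof (cases "max \<beta> (?s j) \<in> {?s j..2 * ?s j}")
        case True
        have "\<forall>\<beta>\<in>{?s j..2 * ?s j}. \<forall>\<^sub>F n in sequentially. \<forall>f\<in>F_class phiI J0 M \<beta>. \<forall>g\<in>G_class c C.
       holds_up_to n f g (2 * \<delta>) (\<lambda>\<omega>. L2_diam (CC j n \<omega>) \<le> ennreal (KK j * eps_rate ?d n \<beta>))"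
          using W[of j] unfolding window_sets_def by (elim conjE)
        from bspec[OF this True] show ?thesis by (rule eventually_mono) simp
      qed (simp only: simp_thms eventually_True)
    qed
    with ev_select eventually_ge_at_top[of 1]
    have "\<forall>\<^sub>F n in sequentially. (SUP f\<in>F_sep phiI J0 M bm bp L n \<inter> F_class phiI J0 M \<beta>.
                  SUP g\<in>G_class c C. ereal (diam_exceed_prob n (Cn n) (K * eps_rate ?d n \<beta>) f g)) \<le> ereal \<alpha>'"
    proof eventually_elim
      case (elim n)
      show ?case using diam[OF elim(1,2) \<beta> elim(3) L] by (intro SUP_least) auto
    qed
    then show "limsup (\<lambda>n. SUP f\<in>F_sep phiI J0 M bm bp L n \<inter> F_class phiI J0 M \<beta>.
                  SUP g\<in>G_class c C. ereal (diam_exceed_prob n (Cn n) (K * eps_rate ?d n \<beta>) f g)) \<le> ereal \<alpha>'"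
      by (rule Limsup_bounded)
  qed
qed

end

theorem theorem1p1:
  fixes S bm bp M c C \<alpha> \<alpha>' :: real
    and J0 :: nat
    and phiI psiI :: "nat \<Rightarrow> nat \<Rightarrow> real \<Rightarrow> real"
  assumes "cdv_basis S J0 phiI psiI"
    and "0 < bm" and "bm \<le> bp" and "bp < S"
    and "0 < M"
    and "0 < c" and "c \<le> 1" and "1 \<le> C"
    and "0 < \<alpha>" and "\<alpha> < 1" and "0 < \<alpha>'" and "\<alpha>' < 1"
  shows
    "(bp \<le> 2 * bm \<longrightarrow>
       (\<exists>(Cn :: nat \<Rightarrow> (nat \<Rightarrow> (real ^ 'n::finite) \<times> bool) \<Rightarrow> (real ^ 'n \<Rightarrow> real) set) (K :: real).
          0 < K \<and> (\<forall>n. random_closed_set n (Cn n)) \<and>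
          liminf (\<lambda>n. INF \<beta>\<in>{bm..bp}. INF f\<in>F_class phiI J0 M \<beta>. INF g\<in>G_class c C.
            ereal (coverage_prob n (Cn n) f g)) \<ge> ereal (1 - \<alpha>) \<and>
          (\<forall>\<beta>\<in>{bm..bp}.
             limsup (\<lambda>n. SUP f\<in>F_class phiI J0 M \<beta>. SUP g\<in>G_class c C.
               ereal (diam_exceed_prob n (Cn n) (K * eps_rate CARD('n) n \<beta>) f g)) \<le> ereal \<alpha>')))
     \<and>
     (bp > 2 * bm \<longrightarrow>
       (\<exists>(Cn :: nat \<Rightarrow> (nat \<Rightarrow> (real ^ 'n::finite) \<times> bool) \<Rightarrow> (real ^ 'n \<Rightarrow> real) set)
          (L0 :: real) (K :: real).
          0 < L0 \<and> 0 < K \<and> (\<forall>n. random_closed_set n (Cn n)) \<and>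
          (\<forall>L\<ge>L0.
             liminf (\<lambda>n. INF f\<in>F_sep phiI J0 M bm bp L n. INF g\<in>G_class c C.
               ereal (coverage_prob n (Cn n) f g)) \<ge> ereal (1 - \<alpha>) \<and>
             (\<forall>\<beta>\<in>{bm..bp}.
                limsup (\<lambda>n. SUP f\<in>F_sep phiI J0 M bm bp L n \<inter> F_class phiI J0 M \<beta>.
                  SUP g\<in>G_class c C.
                  ereal (diam_exceed_prob n (Cn n) (K * eps_rate CARD('n) n \<beta>) f g)) \<le> ereal \<alpha>'))))"
proof -
  interpret cdv_wavelets S J0 phiI psiI by unfold_locales (rule assms(1))
  show ?thesis
    by (intro conjI impI adaptive_small_window adaptive_separated) (use assms in auto)
qed

end
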